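(* Let $\mathcal{A}$ be a symmetric weakly irreducible nonnegative tensor of order $m\ge2$ and dimension $n$, and let $\ell\ge2$ be an integer. Then $\mathcal{A}$ is spectral $\ell$-symmetric if and only if $\mathcal{A}$ is $(m,\ell)$-colorable.
   Context: Tensor $\mathcal{A}=(a_{i_1\ldots i_m})$ indexed by $[n]^m$; nonnegative: entries $\ge0$; symmetric: entries invariant under index permutations; weakly irreducible: the directed graph on $[n]$ with arc $(i,j)$ iff some $a_{ii_2\ldots i_m}\ne0$ with $j\in\{i_2,\dots,i_m\}$ is strongly connected. $\mathrm{Spec}(\mathcal{A})$ is the multiset of roots (with multiplicity) of $\det(\lambda\mathcal{I}-\mathcal{A})$, where the determinant of a tensor $\mathcal{B}$ is the resultant of the polynomials $(\mathcal{B}x^{m-1})_i=\sum_{i_2,\dots,i_m}b_{ii_2\ldots i_m}x_{i_2}\cdots x_{i_m}$ and $\mathcal{I}$ is the identity tensor. $\mathcal{A}$ is spectral $\ell$-symmetric if $\mathrm{Spec}(\mathcal{A})=e^{\mathbf{i}2\pi/\ell}\mathrm{Spec}(\mathcal{A})$. $\mathcal{A}$ is $(m,\ell)$-colorable if $\ell\mid m$ and there exists $\phi:[n]\to[m]$ such that $a_{i_1\ldots i_m}\ne0$ implies $\phi(i_1)+\cdots+\phi(i_m)\equiv m/\ell\pmod m$.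
   Formalization: Strong connectivity is required through walks of positive length, which for n=1 excludes exactly the zero tensor: its spectrum {0} is ℓ-symmetric for every ℓ, yet it is not (m,ℓ)-colorable when ℓ does not divide m. For n≥2 nothing changes. *)

theory Defs
  imports
    "HOL-Library.Poly_Mapping"
    "HOL-Computational_Algebra.Computational_Algebra"
    "HOL-Number_Theory.Cong"
begin

type_synonym ('v, 'a) mpoly = "('v \<Rightarrow>\<^sub>0 nat) \<Rightarrow>\<^sub>0 'a"

(* The coefficients are moved to the target ring by c. *)
definition eval_mpoly ::
  "('a::zero \<Rightarrow> 'b::comm_semiring_1) \<Rightarrow> ('v \<Rightarrow> 'b) \<Rightarrow> ('v, 'a) mpoly \<Rightarrow> 'b" where
  "eval_mpoly c x p = (\<Sum>t\<in>Poly_Mapping.keys p.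
     c (Poly_Mapping.lookup p t) * (\<Prod>v\<in>Poly_Mapping.keys t. x v ^ Poly_Mapping.lookup t v))"

definition monomials :: "nat \<Rightarrow> nat \<Rightarrow> (nat \<Rightarrow>\<^sub>0 nat) set" where
  "monomials n d = {t. Poly_Mapping.keys t \<subseteq> {1..n} \<and>
     (\<Sum>v\<in>Poly_Mapping.keys t. Poly_Mapping.lookup t v) = d}"

definition forms :: "nat \<Rightarrow> nat \<Rightarrow> (nat, 'a::zero) mpoly set" where
  "forms n d = {f. Poly_Mapping.keys f \<subseteq> monomials n d}"

definition nontrivial_common_zero :: "nat \<Rightarrow> (nat \<Rightarrow> (nat, complex) mpoly) \<Rightarrow> bool" where
  "nontrivial_common_zero n F \<longleftrightarrow>
     (\<exists>x. (\<exists>i\<in>{1..n}. x i \<noteq> 0) \<and> (\<forall>i\<in>{1..n}. eval_mpoly id x (F i) = 0))"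

(* The variable (i, t) stands for the coefficient of the monomial t in the i-th form. *)
definition subst_coeffs ::
  "(complex \<Rightarrow> 'b::comm_semiring_1) \<Rightarrow> (nat \<times> (nat \<Rightarrow>\<^sub>0 nat), complex) mpoly \<Rightarrow>
     (nat \<Rightarrow> (nat, 'b) mpoly) \<Rightarrow> 'b" where
  "subst_coeffs c R F = eval_mpoly c (\<lambda>(i, t). Poly_Mapping.lookup (F i) t) R"

(* The standard characterization of the resultant of n forms of degree d in n variables: the
   irreducible polynomial in their coefficients that vanishes exactly at the systems with a
   nontrivial common zero, normalized to 1 at x_1^d, ..., x_n^d. Irreducibility in the ambient
   ring with infinitely many variables is the same as in the ring of the variables that occur. *)
definition is_resultant ::
  "nat \<Rightarrow> nat \<Rightarrow> (nat \<times> (nat \<Rightarrow>\<^sub>0 nat), complex) mpoly \<Rightarrow> bool" where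
  "is_resultant n d R \<longleftrightarrow>
     (\<Union>t\<in>Poly_Mapping.keys R. Poly_Mapping.keys t) \<subseteq> {1..n} \<times> monomials n d \<and>
     irreducible R \<and>
     (\<forall>F. (\<forall>i\<in>{1..n}. F i \<in> forms n d) \<longrightarrow>
        (subst_coeffs id R F = 0 \<longleftrightarrow> nontrivial_common_zero n F)) \<and>
     subst_coeffs id R (\<lambda>i. Poly_Mapping.single (Poly_Mapping.single i d) 1) = 1"

(* Well defined for n, d > 0, by the classical existence and uniqueness theorem. *)
definition resultant_mpoly :: "nat \<Rightarrow> nat \<Rightarrow> (nat \<times> (nat \<Rightarrow>\<^sub>0 nat), complex) mpoly" where
  "resultant_mpoly n d = (THE R. is_resultant n d R)"

(* A tensor of order m and dimension n is a function on index lists, of which only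
   the values on this set matter. *)
definition tensor_indices :: "nat \<Rightarrow> nat \<Rightarrow> nat list set" where
  "tensor_indices n m = {is. set is \<subseteq> {1..n} \<and> length is = m}"

definition identity_tensor :: "nat list \<Rightarrow> 'a::zero_neq_one" where
  "identity_tensor is = (if \<forall>i\<in>set is. \<forall>j\<in>set is. i = j then 1 else 0)"

(* The i-th component of B x^(m-1), as a polynomial in x_1, ..., x_n. *)
definition tensor_form ::
  "nat \<Rightarrow> nat \<Rightarrow> (nat list \<Rightarrow> 'a::comm_monoid_add) \<Rightarrow> nat \<Rightarrow> (nat, 'a) mpoly" where
  "tensor_form n m B i = (\<Sum>is\<in>tensor_indices n (m - 1).
     Poly_Mapping.single (\<Sum>j\<leftarrow>is. Poly_Mapping.single j 1) (B (i # is)))"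

(* The entries lie in an algebra over the complex numbers with structure map c. *)
definition tensor_det ::
  "(complex \<Rightarrow> 'b::comm_semiring_1) \<Rightarrow> nat \<Rightarrow> nat \<Rightarrow> (nat list \<Rightarrow> 'b) \<Rightarrow> 'b" where
  "tensor_det c n m B = subst_coeffs c (resultant_mpoly n (m - 1)) (tensor_form n m B)"

definition tensor_charpoly :: "nat \<Rightarrow> nat \<Rightarrow> (nat list \<Rightarrow> complex) \<Rightarrow> complex poly" where
  "tensor_charpoly n m A =
     tensor_det (\<lambda>z. [:z:]) n m (\<lambda>is. [:0, 1:] * identity_tensor is - [:A is:])"

definition Spec :: "nat \<Rightarrow> nat \<Rightarrow> (nat list \<Rightarrow> complex) \<Rightarrow> complex multiset" where
  "Spec n m A = proots (tensor_charpoly n m A)"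

definition spectral_symmetric :: "nat \<Rightarrow> nat \<Rightarrow> nat \<Rightarrow> (nat list \<Rightarrow> complex) \<Rightarrow> bool" where
  "spectral_symmetric n m l A \<longleftrightarrow>
     Spec n m A = image_mset (\<lambda>z. cis (2 * pi / real l) * z) (Spec n m A)"

definition nonnegative_tensor :: "nat \<Rightarrow> nat \<Rightarrow> (nat list \<Rightarrow> real) \<Rightarrow> bool" where
  "nonnegative_tensor n m A \<longleftrightarrow> (\<forall>is\<in>tensor_indices n m. A is \<ge> 0)"

definition symmetric_tensor :: "nat \<Rightarrow> nat \<Rightarrow> (nat list \<Rightarrow> 'a) \<Rightarrow> bool" where
  "symmetric_tensor n m A \<longleftrightarrow>
     (\<forall>is\<in>tensor_indices n m. \<forall>js\<in>tensor_indices n m. mset is = mset js \<longrightarrow> A is = A js)"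

definition tensor_arcs :: "nat \<Rightarrow> nat \<Rightarrow> (nat list \<Rightarrow> 'a::zero) \<Rightarrow> (nat \<times> nat) set" where
  "tensor_arcs n m A = {(i, j). \<exists>is. i # is \<in> tensor_indices n m \<and> A (i # is) \<noteq> 0 \<and> j \<in> set is}"

(* Strong connectivity is required through walks of positive length. This matters only for
   n = 1, where it excludes the zero tensor, just as the 1 x 1 zero matrix is often taken to be
   reducible: its spectrum is invariant under every rotation, whatever the order m. *)
definition weakly_irreducible :: "nat \<Rightarrow> nat \<Rightarrow> (nat list \<Rightarrow> 'a::zero) \<Rightarrow> bool" where
  "weakly_irreducible n m A \<longleftrightarrow> (\<forall>i\<in>{1..n}. \<forall>j\<in>{1..n}. (i, j) \<in> (tensor_arcs n m A)\<^sup>+)"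

definition colorable :: "nat \<Rightarrow> nat \<Rightarrow> nat \<Rightarrow> (nat list \<Rightarrow> 'a::zero) \<Rightarrow> bool" where
  "colorable n m l A \<longleftrightarrow> l dvd m \<and>
     (\<exists>\<phi>. \<phi> ` {1..n} \<subseteq> {1..m} \<and>
        (\<forall>is\<in>tensor_indices n m. A is \<noteq> 0 \<longrightarrow> [(\<Sum>i\<leftarrow>is. \<phi> i) = m div l] (mod m)))"

end

theory Submission
  imports Defs "HOL-Library.Product_Lexorder"
begin

text \<open>
  The polynomials in the coefficients that vanish at all systems with a nontrivial zero form a prime
  ideal, because these systems are the image of an affine space. By Chevalley's extension theorem,
  its zero set contains no further systems. Adding multiples of the unit system
  \<open>x\<^sub>1\<^sup>d, \<dots>, x\<^sub>n\<^sup>d\<close> to a system F, one meets a system with a nontrivial zero for generic F, but only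
  at parameters bounded in terms of F. So an element of the ideal of minimal degree in this
  parameter can be made monic, and it generates the ideal. This yields the existence and the
  uniqueness of the resultant, and it shows that every rescaling of the coefficients that preserves
  the systems with a nontrivial zero multiplies the resultant by a constant.

  A coloring gives a diagonal similarity between the tensor and its multiple by \<open>cis (2 * pi / l)\<close>,
  and the rescaling property carries multiplicities along. Conversely, the maximum \<open>\<rho>\<close> of the
  homogeneous form of a symmetric nonnegative tensor on the unit sphere of the m-norm is an
  eigenvalue. An eigenvector for \<open>cis (2 * pi / l) * \<rho>\<close> has moduli that attain the maximum, so it has
  no zero coordinate, and equality in the triangle inequality turns its phases into a coloring.
\<close>

subsection \<open>Evaluation of multivariate polynomials\<close>

text \<open>\<open>resultant_mpoly\<close> is a definite description, so nothing is known about it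
  before existence and uniqueness are proved. Its zero set alone would not be enough:
  \<open>Spec\<close> counts roots with multiplicity, which vanishing at the same systems controls
  only up to powers. Divisibility controls them: if a rescaling and its inverse both preserve the
  zero set, a generator R of the vanishing ideal divides both rescaled copies of itself, and
  comparing the two shows that the quotient is a unit, hence a constant. In the search for R, the
  shift parameter s along the unit system serves as a distinguished variable, and boundedness of the
  roots s does the work of Gauss's lemma: it bounds all coefficients by the leading one, and such
  bounds force divisibility. Symmetry enters the converse twice. It makes the gradient of the form
  equal to m times A x^(m-1), so that a maximum yields an eigenvector, and it allows any index of a
  nonzero entry to be moved to the front, so that the m-th powers of the phases agree along
  arcs.\<close>

definition mono_eval :: "('v \<Rightarrow> 'b::comm_semiring_1) \<Rightarrow> ('v \<Rightarrow>\<^sub>0 nat) \<Rightarrow> 'b" where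
  "mono_eval x t = (\<Prod>v\<in>Poly_Mapping.keys t. x v ^ Poly_Mapping.lookup t v)"

lemma mono_eval_superset:
  assumes "finite V" "Poly_Mapping.keys t \<subseteq> V"
  shows "mono_eval x t = (\<Prod>v\<in>V. x v ^ Poly_Mapping.lookup t v)"
  unfolding mono_eval_def
  by (rule prod.mono_neutral_left) (use assms in \<open>auto simp: in_keys_iff\<close>)

lemma mono_eval_0 [simp]: "mono_eval x 0 = 1"
  by (simp add: mono_eval_def)

lemma mono_eval_single [simp]: "mono_eval x (Poly_Mapping.single v k) = x v ^ k"
  by (cases "k = 0") (simp_all add: mono_eval_def)

lemma mono_eval_add: "mono_eval x (s + t) = mono_eval x s * mono_eval x t"
proof -
  let ?V = "Poly_Mapping.keys s \<union> Poly_Mapping.keys t"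
  have "Poly_Mapping.keys (s + t) \<subseteq> ?V"
    by (rule keys_add)
  then show ?thesis
    by (simp add: mono_eval_superset[of ?V] lookup_add power_add prod.distrib)
qed

lemma mono_eval_times: "mono_eval (\<lambda>v. x v * y v) t = mono_eval x t * mono_eval y t"
  by (simp add: mono_eval_def power_mult_distrib prod.distrib)

lemma mono_eval_cong:
  "(\<And>v. v \<in> Poly_Mapping.keys t \<Longrightarrow> x v = y v) \<Longrightarrow> mono_eval x t = mono_eval y t"
  by (simp add: mono_eval_def)

lemma poly_mapping_sum_singles:
  "(\<Sum>t\<in>Poly_Mapping.keys p. Poly_Mapping.single t (Poly_Mapping.lookup p t)) = p"
  by (rule poly_mapping_eqI)
    (auto simp: lookup_sum lookup_single when_def in_keys_iff sum.delta)

lemma eval_mpoly_mono_eval: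
  "eval_mpoly c x p = (\<Sum>t\<in>Poly_Mapping.keys p. c (Poly_Mapping.lookup p t) * mono_eval x t)"
  by (simp add: eval_mpoly_def mono_eval_def)

locale ring_morphism =
  fixes c :: "'a::comm_ring_1 \<Rightarrow> 'b::comm_ring_1"
  assumes hom_one [simp]: "c 1 = 1"
    and hom_add: "c (a + b) = c a + c b"
    and hom_mult: "c (a * b) = c a * c b"
begin

lemma hom_zero [simp]: "c 0 = 0"
  using hom_add[of 0 0] by simp

lemma hom_uminus: "c (- a) = - c a"
  using hom_add[of a "- a"] by (simp add: eq_neg_iff_add_eq_0 add.commute)

lemma hom_diff: "c (a - b) = c a - c b"
  using hom_add[of a "- b"] by (simp add: hom_uminus)

lemma hom_power: "c (a ^ k) = c a ^ k"
  by (induction k) (simp_all add: hom_mult)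

lemma hom_sum: "c (\<Sum>i\<in>I. f i) = (\<Sum>i\<in>I. c (f i))"
  by (induction I rule: infinite_finite_induct) (simp_all add: hom_add)

lemma hom_prod: "c (\<Prod>i\<in>I. f i) = (\<Prod>i\<in>I. c (f i))"
  by (induction I rule: infinite_finite_induct) (simp_all add: hom_mult)

lemma hom_mono_eval: "c (mono_eval x t) = mono_eval (\<lambda>v. c (x v)) t"
  by (simp add: mono_eval_def hom_prod hom_power)

lemma eval_mpoly_superset:
  assumes "finite T" "Poly_Mapping.keys p \<subseteq> T"
  shows "eval_mpoly c x p = (\<Sum>t\<in>T. c (Poly_Mapping.lookup p t) * mono_eval x t)"
  unfolding eval_mpoly_mono_eval
  by (rule sum.mono_neutral_left) (use assms in \<open>auto simp: in_keys_iff\<close>)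

lemma eval_mpoly_single [simp]:
  "eval_mpoly c x (Poly_Mapping.single t a) = c a * mono_eval x t"
  by (cases "a = 0") (simp_all add: eval_mpoly_mono_eval)

lemma eval_mpoly_add: "eval_mpoly c x (p + q) = eval_mpoly c x p + eval_mpoly c x q"
proof -
  let ?T = "Poly_Mapping.keys p \<union> Poly_Mapping.keys q"
  have "Poly_Mapping.keys (p + q) \<subseteq> ?T"
    by (rule keys_add)
  then show ?thesis
    by (simp add: eval_mpoly_superset[of ?T] lookup_add hom_add distrib_right sum.distrib)
qed

lemma eval_mpoly_0 [simp]: "eval_mpoly c x 0 = 0"
  by (simp add: eval_mpoly_def)

lemma eval_mpoly_1 [simp]: "eval_mpoly c x 1 = 1"
  by (simp flip: single_one)

lemma eval_mpoly_sum: "eval_mpoly c x (\<Sum>i\<in>I. f i) = (\<Sum>i\<in>I. eval_mpoly c x (f i))"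
  by (induction I rule: infinite_finite_induct) (simp_all add: eval_mpoly_add)

lemma eval_mpoly_mult: "eval_mpoly c x (p * q) = eval_mpoly c x p * eval_mpoly c x q"
proof -
  have "eval_mpoly c x
      ((\<Sum>s\<in>Poly_Mapping.keys p. Poly_Mapping.single s (Poly_Mapping.lookup p s)) *
       (\<Sum>t\<in>Poly_Mapping.keys q. Poly_Mapping.single t (Poly_Mapping.lookup q t))) =
    eval_mpoly c x p * eval_mpoly c x q"
    by (simp add: sum_product eval_mpoly_sum mult_single hom_mult mono_eval_add
        eval_mpoly_mono_eval[of c x p] eval_mpoly_mono_eval[of c x q] mult_ac)
  then show ?thesis
    by (simp add: poly_mapping_sum_singles)
qed

lemma ring_morphism_eval_mpoly: "ring_morphism (eval_mpoly c x)"
  by unfold_locales (simp_all add: eval_mpoly_add eval_mpoly_mult)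

end

lemma eval_mpoly_comp:
  fixes f :: "'b::comm_ring_1 \<Rightarrow> 'c::comm_ring_1" and c :: "'a::comm_ring_1 \<Rightarrow> 'b"
  assumes "ring_morphism f"
  shows "f (eval_mpoly c x p) = eval_mpoly (\<lambda>z. f (c z)) (\<lambda>v. f (x v)) p"
proof -
  interpret ring_morphism f by fact
  show ?thesis
    by (simp add: eval_mpoly_mono_eval hom_sum hom_mult hom_mono_eval)
qed

lemma ring_morphism_id: "ring_morphism id"
  by unfold_locales auto

lemma ring_morphism_single: "ring_morphism (Poly_Mapping.single (0 :: _ \<Rightarrow>\<^sub>0 nat))"
  by unfold_locales (simp_all add: single_add mult_single)

lemma ring_morphism_pCons: "ring_morphism (\<lambda>a. [:a:])"
  by unfold_locales (simp_all add: one_pCons)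

lemma ring_morphism_poly: "ring_morphism (\<lambda>p. poly p a)"
  by unfold_locales auto

lemma ring_morphism_comp:
  "ring_morphism f \<Longrightarrow> ring_morphism g \<Longrightarrow> ring_morphism (\<lambda>z. g (f z))"
  unfolding ring_morphism_def by simp

abbreviation ev :: "('v \<Rightarrow> complex) \<Rightarrow> ('v, complex) mpoly \<Rightarrow> complex" where
  "ev \<equiv> eval_mpoly id"

interpretation ev: ring_morphism "ev x" for x :: "'v \<Rightarrow> complex"
  by (rule ring_morphism.ring_morphism_eval_mpoly) (rule ring_morphism_id)

lemma ev_single [simp]: "ev x (Poly_Mapping.single t a) = a * mono_eval x t"
  using ring_morphism.eval_mpoly_single[OF ring_morphism_id, of x t a] by simp

abbreviation Const :: "'a::zero \<Rightarrow> ('v, 'a) mpoly" where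
  "Const \<equiv> Poly_Mapping.single 0"

definition Var :: "'v \<Rightarrow> ('v, 'a::zero_neq_one) mpoly" where
  "Var v = Poly_Mapping.single (Poly_Mapping.single v 1) 1"

lemma (in ring_morphism) eval_mpoly_Var [simp]: "eval_mpoly c x (Var v) = x v"
  by (simp add: Var_def)

lemma ev_Var [simp]: "ev x (Var v) = x v"
  by (simp add: Var_def)

lemma mono_eval_Var:
  "mono_eval Var t = (Poly_Mapping.single t 1 :: ('v, 'a::comm_ring_1) mpoly)"
proof -
  have pow: "(Var v :: ('v, 'a) mpoly) ^ k = Poly_Mapping.single (Poly_Mapping.single v k) 1"
    for v :: 'v and k
    by (induction k) (simp_all add: Var_def mult_single flip: single_add)
  have prod: "(\<Prod>v\<in>V. (Poly_Mapping.single (s v) 1 :: ('v, 'a) mpoly)) = Poly_Mapping.single (\<Sum>v\<in>V. s v) 1"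
    if "finite V" for s :: "'v \<Rightarrow> 'v \<Rightarrow>\<^sub>0 nat" and V
    using that by (induction V) (simp_all add: mult_single)
  show ?thesis
    by (simp add: mono_eval_def pow prod poly_mapping_sum_singles)
qed

lemma eval_mpoly_Const_Var [simp]: "eval_mpoly Const Var p = (p :: ('v, 'a::comm_ring_1) mpoly)"
  by (simp add: eval_mpoly_mono_eval mono_eval_Var mult_single poly_mapping_sum_singles)

text \<open>Distinct monomials are distinct multiplicative characters of the torus, hence linearly
  independent.\<close>

lemma monomials_independent:
  fixes a :: "('v \<Rightarrow>\<^sub>0 nat) \<Rightarrow> complex"
  assumes "finite T" "\<And>x. (\<And>v. x v \<noteq> 0) \<Longrightarrow> (\<Sum>t\<in>T. a t * mono_eval x t) = 0"
  shows "\<forall>t\<in>T. a t = 0"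
  using assms
proof (induction T arbitrary: a)
  case (insert s T)
  have "a t = 0" if t: "t \<in> T" for t
  proof -
    from t insert.hyps have "t \<noteq> s" by auto
    then obtain v where v: "Poly_Mapping.lookup t v \<noteq> Poly_Mapping.lookup s v"
      by (metis poly_mapping_eqI)
    \<comment> \<open>Scaling the single coordinate v separates s from t, as 2^k is injective in k.
      Twisting the relation by y and subtracting \<open>mono_eval y s\<close> times the relation
      itself cancels the term of s, so that the induction hypothesis for T applies.\<close>
    define y where "y = (\<lambda>u. if u = v then 2 else 1 :: complex)"
    have y: "mono_eval y u = 2 ^ Poly_Mapping.lookup u v" for u
    proof (cases "v \<in> Poly_Mapping.keys u")
      case True
      then show ?thesis
        by (simp add: mono_eval_def y_def prod.remove[of _ v])
    next
      case False
      then show ?thesis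
        by (auto simp: mono_eval_def y_def in_keys_iff intro: prod.neutral)
    qed
    have "(\<Sum>t\<in>T. a t * (mono_eval y t - mono_eval y s) * mono_eval x t) = 0"
      if x: "\<And>v. x v \<noteq> 0" for x
    proof -
      have "(\<Sum>t\<in>insert s T. a t * mono_eval (\<lambda>v. x v * y v) t) = 0"
        by (rule insert.prems) (use x in \<open>auto simp: y_def\<close>)
      moreover have "(\<Sum>t\<in>insert s T. a t * mono_eval x t) = 0"
        by (rule insert.prems) (use x in auto)
      ultimately have "(\<Sum>t\<in>insert s T. a t * mono_eval (\<lambda>v. x v * y v) t) -
          mono_eval y s * (\<Sum>t\<in>insert s T. a t * mono_eval x t) = 0"
        by simp
      then show ?thesis
        using insert.hyps
        by (simp add: mono_eval_times sum_distrib_left algebra_simps sum_subtractf)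
    qed
    from insert.IH[OF this] t have "a t * (mono_eval y t - mono_eval y s) = 0"
      by blast
    moreover have "mono_eval y t \<noteq> mono_eval y s"
    proof
      assume "mono_eval y t = mono_eval y s"
      then have "complex_of_nat (2 ^ Poly_Mapping.lookup t v) = of_nat (2 ^ Poly_Mapping.lookup s v)"
        by (simp add: y)
      then show False
        using v by (simp only: of_nat_eq_iff) simp
    qed
    ultimately show ?thesis by simp
  qed
  moreover from this insert.prems[of "\<lambda>_. 1"] insert.hyps have "a s = 0"
    by (simp add: mono_eval_def)
  ultimately show ?case by blast
qed auto

text \<open>Independence of the monomials was already tested on the torus only. This restriction
  matters later: the parametrization of the systems with a nontrivial zero is guaranteed to produce
  one when the coordinates of the parameter are nonzero.\<close>

lemma mpoly_eq_0I_torus: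
  fixes p :: "('v, complex) mpoly"
  assumes "\<And>x. (\<And>v. x v \<noteq> 0) \<Longrightarrow> ev x p = 0"
  shows "p = 0"
proof -
  have "\<forall>t\<in>Poly_Mapping.keys p. Poly_Mapping.lookup p t = 0"
    by (rule monomials_independent) (use assms in \<open>auto simp: eval_mpoly_mono_eval\<close>)
  then show ?thesis
    by (auto simp: in_keys_iff intro: poly_mapping_eqI)
qed

lemma mpoly_eq_0I: "(\<And>x. ev x p = 0) \<Longrightarrow> p = 0"
  by (rule mpoly_eq_0I_torus) auto

lemma mpoly_eqI:
  assumes "\<And>x. ev x p = ev x q"
  shows "p = q"
  using mpoly_eq_0I[of "p - q"] assms by (simp add: ev.hom_diff)

section \<open>Restriction to complex lines, and the units of the polynomial ring\<close>

lemma ev_line: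
  obtains h where "\<And>\<tau>. poly h \<tau> = ev (\<lambda>v. x v + \<tau> * y v) p"
proof
  show "poly (eval_mpoly (\<lambda>z. [:z:]) (\<lambda>v. [:x v, y v:]) p) \<tau> = ev (\<lambda>v. x v + \<tau> * y v) p" for \<tau>
    using eval_mpoly_comp[OF ring_morphism_poly, of "\<lambda>z. [:z:]" "\<lambda>v. [:x v, y v:]" p \<tau>]
    by (simp add: id_def)
qed

lemma nonvanishing_poly_const:
  fixes h :: "complex poly"
  assumes "\<And>\<tau>. poly h \<tau> \<noteq> 0"
  shows "poly h a = poly h b"
proof -
  have "constant (poly h)"
    using assms fundamental_theorem_of_algebra by blast
  then show ?thesis
    by (simp add: constant_def)
qed

lemma ev_nonvanishing_const:
  assumes "\<And>x. ev x p \<noteq> 0"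
  shows "ev x p = ev y p"
proof -
  obtain h where h: "\<And>\<tau>. poly h \<tau> = ev (\<lambda>v. x v + \<tau> * (y v - x v)) p"
    using ev_line by metis
  have "poly h 0 = poly h 1"
    by (rule nonvanishing_poly_const) (simp add: h assms)
  then show ?thesis
    by (simp add: h)
qed

text \<open>A unit vanishes nowhere. On the line through any two points it is a one-variable
  polynomial without roots, hence constant by the fundamental theorem of algebra.\<close>

lemma mpoly_unit_const:
  fixes p :: "('v, complex) mpoly"
  assumes "p * q = 1"
  obtains z where "z \<noteq> 0" "p = Const z"
proof
  have "ev x p * ev x q = 1" for x
    using assms by (metis ev.hom_mult ev.hom_one)
  then have nz: "ev x p \<noteq> 0" for x
    by (metis mult_zero_left zero_neq_one)
  then show "ev (\<lambda>_. 0) p \<noteq> 0" .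
  show "p = Const (ev (\<lambda>_. 0) p)"
    by (rule mpoly_eqI) (use ev_nonvanishing_const[OF nz] in simp)
qed

subsection \<open>Extension of partial homomorphisms\<close>

text \<open>A ring homomorphism from a subring of a field to \<open>\<complex>\<close> is encoded by its graph: a set of pairs
  closed under the ring operations that does not contain (0, 1).\<close>

locale partial_hom = ring_morphism c for c :: "complex \<Rightarrow> 'k::field" +
  fixes G :: "('k \<times> complex) set"
  assumes const_mem: "(c z, z) \<in> G"
    and add_mem: "(a, v) \<in> G \<Longrightarrow> (b, w) \<in> G \<Longrightarrow> (a + b, v + w) \<in> G"
    and mult_mem: "(a, v) \<in> G \<Longrightarrow> (b, w) \<in> G \<Longrightarrow> (a * b, v * w) \<in> G"
    and proper: "(0, 1) \<notin> G"
begin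

lemma zero_mem: "(0, 0) \<in> G" and one_mem: "(1, 1) \<in> G"
  using const_mem[of 0] const_mem[of 1] by simp_all

lemma uminus_mem: "(a, v) \<in> G \<Longrightarrow> (- a, - v) \<in> G"
  using mult_mem[OF const_mem[of "-1"]] by (fastforce simp: hom_uminus)

lemma sum_mem: "(\<And>i. i \<in> I \<Longrightarrow> (a i, v i) \<in> G) \<Longrightarrow> ((\<Sum>i\<in>I. a i), (\<Sum>i\<in>I. v i)) \<in> G"
  by (induction I rule: infinite_finite_induct) (auto intro: zero_mem add_mem)

lemma power_mem: "(a, v) \<in> G \<Longrightarrow> (a ^ k, v ^ k) \<in> G"
  by (induction k) (auto intro: one_mem mult_mem)

lemma prod_mem: "(\<And>i. i \<in> I \<Longrightarrow> (a i, v i) \<in> G) \<Longrightarrow> ((\<Prod>i\<in>I. a i), (\<Prod>i\<in>I. v i)) \<in> G"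
  by (induction I rule: infinite_finite_induct) (auto intro: one_mem mult_mem)

lemma mono_eval_mem:
  "(\<And>v. v \<in> Poly_Mapping.keys t \<Longrightarrow> (x v, y v) \<in> G) \<Longrightarrow> (mono_eval x t, mono_eval y t) \<in> G"
  by (auto simp: mono_eval_def intro: prod_mem power_mem)

text \<open>A nonzero value at 0 could be scaled to 1 by a constant. So the single pair forbidden by
  \<open>proper\<close> already makes the relation G single-valued.\<close>

lemma zero_memD:
  assumes "(0, w) \<in> G"
  shows "w = 0"
proof (rule ccontr)
  assume "w \<noteq> 0"
  then show False
    using mult_mem[OF const_mem[of "inverse w"] assms] proper by simp
qed

lemma value_unique: "(a, v) \<in> G \<Longrightarrow> (a, w) \<in> G \<Longrightarrow> v = w"
  using add_mem[OF _ uminus_mem, of a v a w] zero_memD by fastforce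

text \<open>The coefficients of f lie in the subring on which the homomorphism is defined, and p is
  their reduction. Extending the homomorphism by sending y to a means sending
  \<open>poly f y\<close> to \<open>poly p a\<close> for all such pairs.\<close>

definition lifts :: "'k poly \<Rightarrow> complex poly \<Rightarrow> bool" where
  "lifts f p \<longleftrightarrow> (\<forall>i. (coeff f i, coeff p i) \<in> G)"

lemma lifts_add: "lifts f p \<Longrightarrow> lifts g q \<Longrightarrow> lifts (f + g) (p + q)"
  by (auto simp: lifts_def intro: add_mem)

lemma lifts_mult: "lifts f p \<Longrightarrow> lifts g q \<Longrightarrow> lifts (f * g) (p * q)"
  by (auto simp: lifts_def coeff_mult intro: sum_mem mult_mem)

lemma lifts_pCons_0: "(a, v) \<in> G \<Longrightarrow> lifts [:a:] [:v:]"
  by (auto simp: lifts_def coeff_pCons zero_mem split: nat.split)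

lemma lifts_X: "lifts [:0, 1:] [:0, 1:]"
  by (auto simp: lifts_def coeff_pCons zero_mem one_mem split: nat.split)

lemma lifts_map_poly: "lifts (map_poly c p) p"
  by (simp add: lifts_def coeff_map_poly const_mem)

text \<open>The assumption is the well-definedness of the extension that sends y to a: every
  relation of y over the subring must reduce to a relation of a. This is what keeps (0, 1) out of
  the new graph.\<close>

lemma partial_hom_adjoin:
  assumes "\<And>f p. lifts f p \<Longrightarrow> poly f y = 0 \<Longrightarrow> poly p a = 0"
  shows "partial_hom c {(poly f y, poly p a) |f p. lifts f p}"
proof unfold_locales
  show "(c z, z) \<in> {(poly f y, poly p a) |f p. lifts f p}" for z
    using lifts_pCons_0[OF const_mem, of z] by force
next
  fix r v s w
  assume "(r, v) \<in> {(poly f y, poly p a) |f p. lifts f p}"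
    "(s, w) \<in> {(poly f y, poly p a) |f p. lifts f p}"
  then obtain f p g q where "r = poly f y" "v = poly p a" "s = poly g y" "w = poly q a"
    "lifts f p" "lifts g q" by blast
  then show "(r + s, v + w) \<in> {(poly f y, poly p a) |f p. lifts f p}"
    "(r * s, v * w) \<in> {(poly f y, poly p a) |f p. lifts f p}"
    using lifts_add[of f p g q] lifts_mult[of f p g q] by (force, force)
next
  show "(0, 1) \<notin> {(poly f y, poly p a) |f p. lifts f p}"
  proof
    assume "(0, 1) \<in> {(poly f y, poly p a) |f p. lifts f p}"
    then obtain f p where "lifts f p" "poly f y = 0" "poly p a = 1" by force
    with assms show False by fastforce
  qed
qed

lemma adjoin_extends: "G \<subseteq> {(poly f y, poly p a) |f p. lifts f p}"
proof (rule subrelI)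
  fix r v assume "(r, v) \<in> G"
  then show "(r, v) \<in> {(poly f y, poly p a) |f p. lifts f p}"
    using lifts_pCons_0[of r v] by force
qed

text \<open>The reductions of the relations of y form an ideal J of \<complex>[X], because constants
  lift through \<open>c\<close>. By assumption J does not contain 1. If J is zero, any value is
  admissible for y, and 0 is taken; otherwise an element of minimal degree generates J, is not
  constant, and any root of it will do.\<close>

lemma nonextendable_relation:
  assumes "\<And>f. \<not> (lifts f 1 \<and> poly f y = 0)"
  obtains a where "\<And>f p. lifts f p \<Longrightarrow> poly f y = 0 \<Longrightarrow> poly p a = 0"
proof -
  define J where "J = {p. \<exists>f. lifts f p \<and> poly f y = 0}"
  have J_add: "p + q \<in> J" if "p \<in> J" "q \<in> J" for p q
  proof -
    from that obtain f g where "lifts f p" "poly f y = 0" "lifts g q" "poly g y = 0"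
      unfolding J_def by blast
    then have "lifts (f + g) (p + q)" "poly (f + g) y = 0"
      by (simp_all add: lifts_add)
    then show ?thesis
      unfolding J_def by blast
  qed
  have J_mult: "q * p \<in> J" if "p \<in> J" for p q
  proof -
    from that obtain f where "lifts f p" "poly f y = 0"
      unfolding J_def by blast
    then have "lifts (map_poly c q * f) (q * p)" "poly (map_poly c q * f) y = 0"
      by (simp_all add: lifts_mult[OF lifts_map_poly])
    then show ?thesis
      unfolding J_def by blast
  qed
  show thesis
  proof (cases "\<exists>p\<in>J. p \<noteq> 0")
    case False
    then have "poly p 0 = 0" if "p \<in> J" for p
      using that by fastforce
    then show ?thesis
      using that[of 0] unfolding J_def by blast
  next
    case True
    then obtain p0 where "p0 \<in> J \<and> p0 \<noteq> 0"
      by blast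
    from arg_min_nat_lemma[of "\<lambda>p. p \<in> J \<and> p \<noteq> 0", OF this, of degree]
    obtain p where p: "p \<in> J" "p \<noteq> 0"
      and min: "\<And>q. q \<in> J \<Longrightarrow> q \<noteq> 0 \<Longrightarrow> degree p \<le> degree q"
      by blast
    have dvd: "p dvd q" if "q \<in> J" for q
    proof -
      have "q + (- (q div p)) * p \<in> J"
        by (intro J_add J_mult that p)
      then have "q mod p \<in> J"
        by (simp add: minus_div_mult_eq_mod)
      then have "q mod p = 0"
        using min[of "q mod p"] degree_mod_less'[of p q] p by linarith
      then show ?thesis by blast
    qed
    have "degree p \<noteq> 0"
    proof
      assume "degree p = 0"
      then obtain z where z: "p = [:z:]" by (metis degree_eq_zeroE)
      then have "[:inverse z:] * p \<in> J"
        by (intro J_mult p)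
      moreover have "[:inverse z:] * p = 1"
        using z p by (simp add: one_pCons)
      ultimately have "1 \<in> J" by simp
      then show False
        using assms unfolding J_def by blast
    qed
    then obtain a where "poly p a = 0"
      using fundamental_theorem_of_algebra[of p] constant_degree[of p] by metis
    then have "poly q a = 0" if "q \<in> J" for q
      using dvd[OF that] by auto
    then show ?thesis
      using that[of a] unfolding J_def by blast
  qed
qed

text \<open>The coefficients reduce to the constant polynomial 1, which is the obstruction to giving
  y a value. The bound p need not be the exact degree, which lets the induction lower it by one
  without inspecting leading terms.\<close>

definition relation_upto :: "'k \<Rightarrow> nat \<Rightarrow> (nat \<Rightarrow> 'k) \<Rightarrow> bool" where
  "relation_upto y p f \<longleftrightarrow> (\<Sum>i\<le>p. f i * y ^ i) = 0 \<and> (\<forall>i. (f i, of_bool (i = 0)) \<in> G)"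

lemma relation_upto_0: "\<not> relation_upto y 0 f"
  using proper by (auto simp: relation_upto_def dest: spec[of _ 0])

text \<open>The leading term of f is eliminated with the help of g.\<close>

lemma relation_upto_reduce:
  assumes f: "relation_upto y p f" and g: "relation_upto (inverse y) q g"
    and "q \<le> p" "y \<noteq> 0"
  obtains h where "relation_upto y (p - 1) h"
proof
  have p: "p \<noteq> 0"
    using f relation_upto_0 by metis
  \<comment> \<open>Multiplying the relation of \<open>inverse y\<close> by
    \<open>f p * y ^ p\<close> turns it into a relation of y whose coefficient at
    \<open>y ^ i\<close> is \<open>f p * g (p - i)\<close>; at i = p this is
    \<open>f p * g 0\<close>, which cancels against \<open>g 0 * f p\<close>. As p > 0,
    \<open>f p\<close> has value 0, so the subtraction does not change the values 1, 0, 0, ... of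
    the coefficients.\<close>
  define h where "h = (\<lambda>i. g 0 * f i + - (if p - q \<le> i \<and> i \<le> p then f p * g (p - i) else 0))"
  have mem: "(h i, of_bool (i = 0)) \<in> G" for i
  proof -
    have fg: "(f i, of_bool (i = 0)) \<in> G" "(g i, of_bool (i = 0)) \<in> G" for i
      using f g by (simp_all add: relation_upto_def)
    have "(f p * g (p - i), of_bool (p = 0) * of_bool (p - i = 0)) \<in> G"
      by (intro mult_mem fg)
    then have "(if p - q \<le> i \<and> i \<le> p then f p * g (p - i) else 0, 0) \<in> G"
      using zero_mem p by auto
    moreover have "(g 0 * f i, of_bool (0 = (0::nat)) * of_bool (i = 0)) \<in> G"
      by (intro mult_mem fg)
    ultimately have "(h i, of_bool (0 = (0::nat)) * of_bool (i = 0) + - 0) \<in> G"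
      unfolding h_def by (intro add_mem uminus_mem)
    then show ?thesis by simp
  qed
  have "(\<Sum>i\<le>p. (if p - q \<le> i \<and> i \<le> p then f p * g (p - i) else 0) * y ^ i) =
      (\<Sum>i\<in>{p - q..p}. f p * g (p - i) * y ^ i)"
    by (rule sum.mono_neutral_cong_right) auto
  also have "\<dots> = (\<Sum>j\<le>q. f p * g j * y ^ (p - j))"
    by (rule sum.reindex_bij_witness[of _ "\<lambda>j. p - j" "\<lambda>i. p - i"]) (use \<open>q \<le> p\<close> in auto)
  also have "\<dots> = f p * y ^ p * (\<Sum>j\<le>q. g j * inverse y ^ j)"
    unfolding sum_distrib_left
  proof (rule sum.cong)
    fix j assume "j \<in> {..q}"
    then have "y ^ p = y ^ (p - j) * y ^ j"
      using \<open>q \<le> p\<close> by (simp flip: power_add)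
    then show "f p * g j * y ^ (p - j) = f p * y ^ p * (g j * inverse y ^ j)"
      using \<open>y \<noteq> 0\<close> by (simp add: field_simps)
  qed simp
  also have "\<dots> = 0"
    using g by (simp add: relation_upto_def)
  finally have *: "(\<Sum>i\<le>p. (if p - q \<le> i \<and> i \<le> p then f p * g (p - i) else 0) * y ^ i) = 0" .
  have "(\<Sum>i\<le>p. h i * y ^ i) = g 0 * (\<Sum>i\<le>p. f i * y ^ i) -
      (\<Sum>i\<le>p. (if p - q \<le> i \<and> i \<le> p then f p * g (p - i) else 0) * y ^ i)"
    unfolding h_def sum_distrib_left sum_subtractf[symmetric]
    by (rule sum.cong) (auto simp: algebra_simps)
  also have "\<dots> = 0"
    using f unfolding * by (simp add: relation_upto_def)
  finally have "(\<Sum>i\<le>p. h i * y ^ i) = 0" .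
  moreover have "h p = 0"
    by (simp add: h_def)
  moreover have "{..p} = insert p {..p - 1}"
    using p by auto
  ultimately have "(\<Sum>i\<le>p - 1. h i * y ^ i) = 0"
    using p by simp
  with mem show "relation_upto y (p - 1) h"
    by (simp add: relation_upto_def)
qed

text \<open>Of two such relations, the one with the larger bound can always be shortened by the
  other. The descent ends at bound 0, where the relation would put (0, 1) into G.\<close>

lemma no_two_relations:
  assumes "y \<noteq> 0" "relation_upto y p f"
  shows "\<not> relation_upto (inverse y) q g"
  using assms
proof (induction "p + q" arbitrary: y p q f g rule: less_induct)
  case less
  show ?case
  proof
    assume g: "relation_upto (inverse y) q g"
    have "p \<noteq> 0" "q \<noteq> 0"
      using less.prems g relation_upto_0 by metis+
    show False
    proof (cases "q \<le> p")
      case True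
      then obtain h where "relation_upto y (p - 1) h"
        using relation_upto_reduce less.prems g by blast
      then show False
        using less.hyps[of "p - 1" q y h g] \<open>p \<noteq> 0\<close> less.prems g by simp
    next
      case False
      then obtain h where "relation_upto (inverse y) (q - 1) h"
        using relation_upto_reduce[of "inverse y" q g p f] less.prems g by auto
      then show False
        using less.hyps[of p "q - 1" y f h] \<open>q \<noteq> 0\<close> less.prems g by simp
    qed
  qed
qed

lemma relation_uptoI:
  assumes "lifts f 1" "poly f y = 0"
  shows "relation_upto y (degree f) (coeff f)"
  using assms by (simp add: relation_upto_def lifts_def poly_altdef coeff_1 of_bool_def)

lemma extend_or_inverse:
  assumes "y \<noteq> 0"
  obtains a where "\<And>f p. lifts f p \<Longrightarrow> poly f y = 0 \<Longrightarrow> poly p a = 0"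
  | a where "\<And>f p. lifts f p \<Longrightarrow> poly f (inverse y) = 0 \<Longrightarrow> poly p a = 0"
proof (cases "\<exists>f. lifts f 1 \<and> poly f y = 0")
  case False
  then show ?thesis
    using nonextendable_relation[of y] that(1) by blast
next
  case True
  then have "\<not> (lifts g 1 \<and> poly g (inverse y) = 0)" for g
    using no_two_relations[OF assms] relation_uptoI by blast
  then show ?thesis
    using nonextendable_relation[of "inverse y"] that(2) by blast
qed

end

text \<open>A maximal extension exists by Zorn's lemma. Since y or its inverse admits a value, and
  adjoining it cannot enlarge a maximal graph, the domain of G is a valuation ring.\<close>

theorem chevalley_extension:
  assumes "partial_hom c G0"
  obtains G where "partial_hom c G" "G0 \<subseteq> G"
    "\<And>y. y \<noteq> 0 \<Longrightarrow> (\<exists>w. (y, w) \<in> G) \<or> (\<exists>w. (inverse y, w) \<in> G)"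
proof -
  define A where "A = {G. partial_hom c G \<and> G0 \<subseteq> G}"
  have "\<exists>M\<in>A. \<forall>X\<in>A. M \<subseteq> X \<longrightarrow> X = M"
  proof (rule subset_Zorn_nonempty)
    show "A \<noteq> {}" using assms by (auto simp: A_def)
  next
    fix C assume C: "C \<noteq> {}" "subset.chain A C"
    then have CA: "\<And>X. X \<in> C \<Longrightarrow> partial_hom c X \<and> G0 \<subseteq> X"
      by (auto simp: subset.chain_def A_def)
    obtain X0 where X0: "X0 \<in> C" using C by blast
    interpret X0: partial_hom c X0 using CA X0 by blast
    have common: "\<exists>X\<in>C. p \<in> X \<and> q \<in> X" if "p \<in> \<Union>C" "q \<in> \<Union>C" for p q
    proof -
      from that obtain X Y where "X \<in> C" "Y \<in> C" "p \<in> X" "q \<in> Y" by blast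
      moreover from this have "X \<subseteq> Y \<or> Y \<subseteq> X"
        using C by (auto simp: subset_chain_def)
      ultimately show ?thesis by blast
    qed
    have "partial_hom c (\<Union>C)"
    proof unfold_locales
      show "(c z, z) \<in> \<Union>C" for z
        using X0 X0.const_mem[of z] by (rule UnionI)
      show "(0, 1) \<notin> \<Union>C"
      proof
        assume "(0, 1) \<in> \<Union>C"
        then obtain X where "X \<in> C" "(0, 1) \<in> X" by (rule UnionE)
        then show False using CA[of X] partial_hom.proper[of c X] by simp
      qed
      fix a v b w assume "(a, v) \<in> \<Union>C" "(b, w) \<in> \<Union>C"
      then have "\<exists>X\<in>C. (a, v) \<in> X \<and> (b, w) \<in> X" by (rule common)
      then obtain X where X: "X \<in> C" "(a, v) \<in> X" "(b, w) \<in> X" by blast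
      interpret X: partial_hom c X using CA X(1) by simp
      show "(a + b, v + w) \<in> \<Union>C" "(a * b, v * w) \<in> \<Union>C"
        using X X.add_mem[OF X(2,3)] X.mult_mem[OF X(2,3)] by (simp_all only: Union_iff) auto
    qed
    moreover have "G0 \<subseteq> \<Union>C"
      using CA[OF X0] X0 by (meson Union_upper subset_trans)
    ultimately show "\<Union>C \<in> A" by (simp add: A_def)
  qed
  then obtain G where "G \<in> A" and GA: "\<forall>X\<in>A. G \<subseteq> X \<longrightarrow> X = G" by (rule bexE)
  then have G: "partial_hom c G" "G0 \<subseteq> G"
    by (simp_all add: A_def)
  have max: "X = G" if "partial_hom c X" "G \<subseteq> X" for X
    using GA G that by (simp add: A_def)
  interpret partial_hom c G by fact
  have mem: "(y, a) \<in> G" if "\<And>f p. lifts f p \<Longrightarrow> poly f y = 0 \<Longrightarrow> poly p a = 0" for y a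
  proof -
    \<comment> \<open>The graph after adjoining y with value a contains G, hence equals G by
      maximality. The polynomial X, which lifts itself, shows that (y, a) belongs to it.\<close>
    have "(poly [:0, 1:] y, poly [:0, 1:] a) \<in> {(poly f y, poly p a) |f p. lifts f p}"
      using lifts_X by blast
    moreover have "{(poly f y, poly p a) |f p. lifts f p} = G"
      by (rule max[OF partial_hom_adjoin adjoin_extends]) (rule that)
    ultimately show ?thesis by simp
  qed
  show thesis
  proof (rule that[OF G])
    fix y :: 'a assume "y \<noteq> 0"
    show "(\<exists>w. (y, w) \<in> G) \<or> (\<exists>w. (inverse y, w) \<in> G)"
    proof (rule extend_or_inverse[OF \<open>y \<noteq> 0\<close>])
      fix a assume "\<And>f p. lifts f p \<Longrightarrow> poly f y = 0 \<Longrightarrow> poly p a = 0"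
      then have "(y, a) \<in> G" by (rule mem)
      then show ?thesis by (intro disjI1 exI)
    next
      fix a assume "\<And>f p. lifts f p \<Longrightarrow> poly f (inverse y) = 0 \<Longrightarrow> poly p a = 0"
      then have "(inverse y, a) \<in> G" by (rule mem)
      then show ?thesis by (intro disjI2 exI)
    qed
  qed
qed

text \<open>Divisibility in a valuation ring is total, so one of finitely many nonzero elements
  divides all others. Dividing homogeneous coordinates by this one makes them specializable, with at
  least one coordinate specializing to 1.\<close>

lemma (in partial_hom) dominating_element:
  assumes valuation: "\<And>y. y \<noteq> 0 \<Longrightarrow> (\<exists>w. (y, w) \<in> G) \<or> (\<exists>w. (inverse y, w) \<in> G)"
    and "finite S" "S \<noteq> {}" "0 \<notin> S"
  shows "\<exists>k\<in>S. \<forall>j\<in>S. \<exists>w. (j / k, w) \<in> G"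
  using assms(2-)
proof (induction S rule: finite_ne_induct)
  case (singleton x)
  then show ?case using one_mem by auto
next
  case (insert x S)
  then obtain k where k: "k \<in> S" "\<And>j. j \<in> S \<Longrightarrow> \<exists>w. (j / k, w) \<in> G" by auto
  with insert.prems insert.hyps have nz: "x \<noteq> 0" "k \<noteq> 0" by auto
  have "(\<exists>w. (x / k, w) \<in> G) \<or> (\<exists>w. (k / x, w) \<in> G)"
    using valuation[of "x / k"] nz by (auto simp: field_simps)
  then show ?case
  proof
    assume "\<exists>w. (x / k, w) \<in> G"
    then show ?thesis using k by blast
  next
    assume "\<exists>w. (k / x, w) \<in> G"
    then obtain w where w: "(k / x, w) \<in> G" by blast
    have "\<exists>w. (j / x, w) \<in> G" if "j \<in> S" for j
    proof -
      obtain v where "(j / k, v) \<in> G" using k \<open>j \<in> S\<close> by blast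
      from mult_mem[OF this w] nz show ?thesis by auto
    qed
    moreover have "(x / x, 1) \<in> G"
      using nz one_mem by simp
    ultimately show ?thesis by blast
  qed
qed

subsection \<open>Systems of forms with a nontrivial zero\<close>

lemma finite_monomials [simp]: "finite (monomials n d)"
proof -
  have lookup: "Poly_Mapping.lookup t i \<le> d" "i \<notin> {1..n} \<Longrightarrow> Poly_Mapping.lookup t i = 0"
    if t: "t \<in> monomials n d" for t i
  proof -
    show "Poly_Mapping.lookup t i \<le> d"
    proof (cases "i \<in> Poly_Mapping.keys t")
      case True
      then show ?thesis
        using member_le_sum[of i "Poly_Mapping.keys t" "Poly_Mapping.lookup t"] t
        by (simp add: monomials_def)
    qed (simp add: in_keys_iff)
    show "i \<notin> {1..n} \<Longrightarrow> Poly_Mapping.lookup t i = 0"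
      using t unfolding monomials_def by (auto simp: in_keys_iff)
  qed
  have "Poly_Mapping.lookup ` monomials n d \<subseteq>
      {f. \<forall>i. (i \<in> {1..n} \<longrightarrow> f i \<in> {..d}) \<and> (i \<notin> {1..n} \<longrightarrow> f i = 0)}"
  proof (intro image_subsetI CollectI allI conjI impI)
    show "Poly_Mapping.lookup t i \<in> {..d}" if "t \<in> monomials n d" for t i
      using lookup(1)[OF that] by simp
    show "Poly_Mapping.lookup t i = 0" if "t \<in> monomials n d" "i \<notin> {1..n}" for t i
      by (rule lookup(2)[OF that])
  qed
  moreover have "finite {f. \<forall>i. (i \<in> {1..n} \<longrightarrow> f i \<in> {..d}) \<and> (i \<notin> {1..n} \<longrightarrow> f i = (0::nat))}"
    by (rule finite_set_of_finite_funs) auto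
  ultimately have "finite (Poly_Mapping.lookup ` monomials n d)"
    using finite_subset by blast
  then show ?thesis
    by (rule finite_imageD) (auto intro!: inj_onI poly_mapping_eqI)
qed

lemma monomials_keys: "t \<in> monomials n d \<Longrightarrow> Poly_Mapping.keys t \<subseteq> {1..n}"
  by (simp add: monomials_def)

lemma single_in_monomials: "i \<in> {1..n} \<Longrightarrow> Poly_Mapping.single i d \<in> monomials n d"
  by (simp add: monomials_def)

type_synonym coeff_var = "nat \<times> (nat \<Rightarrow>\<^sub>0 nat)"

definition form_value :: "nat \<Rightarrow> nat \<Rightarrow> (coeff_var \<Rightarrow> 'a::comm_ring_1) \<Rightarrow> nat \<Rightarrow> (nat \<Rightarrow> 'a) \<Rightarrow> 'a" where
  "form_value n d x i z = (\<Sum>t\<in>monomials n d. x (i, t) * mono_eval z t)"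

definition zero_systems :: "nat \<Rightarrow> nat \<Rightarrow> (coeff_var \<Rightarrow> complex) set" where
  "zero_systems n d = {x. \<exists>z. (\<exists>i\<in>{1..n}. z i \<noteq> 0) \<and> (\<forall>i\<in>{1..n}. form_value n d x i z = 0)}"

text \<open>A polynomial map from an affine space onto the systems with a nontrivial zero. A point of the
  affine space consists of a form h with coefficients y (0, t), a point z with coordinates
  y (1, single j 1), and a system F with coefficients y (i + 2, t); it is sent to the system
  h(z) F - F(z) h, which vanishes at z. If F(z) = 0 and h(z) = 1, the value is F.\<close>

definition generic_point :: "(coeff_var \<Rightarrow> 'a) \<Rightarrow> nat \<Rightarrow> 'a" where
  "generic_point y j = y (1, Poly_Mapping.single j 1)"

definition generic_system :: "nat \<Rightarrow> nat \<Rightarrow> (coeff_var \<Rightarrow> 'a::comm_ring_1) \<Rightarrow> coeff_var \<Rightarrow> 'a" where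
  "generic_system n d y = (\<lambda>(i, t).
     if i \<in> {1..n} \<and> t \<in> monomials n d
     then y (i + 2, t) * form_value n d y 0 (generic_point y) -
       form_value n d y (i + 2) (generic_point y) * y (0, t)
     else y (i + 2, t))"

lemma form_value_generic_system:
  assumes "i \<in> {1..n}"
  shows "form_value n d (generic_system n d y) i (generic_point y) = 0"
proof -
  have "form_value n d (generic_system n d y) i (generic_point y) =
      (\<Sum>t\<in>monomials n d. (y (i + 2, t) * mono_eval (generic_point y) t) * form_value n d y 0 (generic_point y) -
        form_value n d y (i + 2) (generic_point y) * (y (0, t) * mono_eval (generic_point y) t))"
    unfolding form_value_def[of n d "generic_system n d y"]
    by (rule sum.cong) (use assms in \<open>auto simp: generic_system_def algebra_simps\<close>)
  also have "\<dots> = 0"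
    by (simp add: sum_subtractf form_value_def flip: sum_distrib_left sum_distrib_right)
  finally show ?thesis .
qed

lemma generic_system_mem:
  assumes "n \<ge> 1" "\<And>v. y v \<noteq> 0"
  shows "generic_system n d y \<in> zero_systems n d"
  unfolding zero_systems_def mem_Collect_eq
  by (rule exI[of _ "generic_point y"])
    (use assms form_value_generic_system[of _ n d y] in \<open>auto simp: generic_point_def intro!: bexI[of _ 1]\<close>)

lemma zero_systems_param:
  assumes "x \<in> zero_systems n d"
  obtains y where "generic_system n d y = x"
proof -
  obtain z k where z: "k \<in> {1..n}" "z k \<noteq> 0" "\<And>i. i \<in> {1..n} \<Longrightarrow> form_value n d x i z = 0"
    using assms unfolding zero_systems_def by blast
  \<comment> \<open>The form h is \<open>x\<^sub>k ^ d\<close> divided by \<open>z k ^ d\<close>, so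
    h(z) = 1 and the construction leaves the system unscaled. Since x vanishes at z, nothing is
    subtracted either. \<open>the_elem\<close> recovers j from the exponent
    \<open>Poly_Mapping.single j 1\<close>.\<close>
  define y where "y = (\<lambda>(i, t).
    if i = 0 then (if t = Poly_Mapping.single k d then inverse (z k ^ d) else 0)
    else if i = 1 then z (the_elem (Poly_Mapping.keys t)) else x (i - 2, t))"
  have y: "y (0, t) = (if t = Poly_Mapping.single k d then inverse (z k ^ d) else 0)"
    "y (i + 2, t) = x (i, t)" for i t
    by (simp_all add: y_def)
  have pt: "generic_point y = z"
    by (rule ext) (simp add: generic_point_def y_def)
  have h: "form_value n d y 0 z = 1"
  proof -
    have "form_value n d y 0 z = (\<Sum>t\<in>monomials n d.
        if t = Poly_Mapping.single k d then inverse (z k ^ d) * mono_eval z t else 0)"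
      unfolding form_value_def by (rule sum.cong) (auto simp: y)
    then show ?thesis
      using z single_in_monomials[OF z(1)] by simp
  qed
  have F: "form_value n d y (i + 2) z = form_value n d x i z" for i
    by (simp only: form_value_def y)
  have "generic_system n d y (i, t) = x (i, t)" for i t
    unfolding generic_system_def split_conv pt h F y by (simp add: z)
  then show thesis
    using that by (metis surj_pair ext)
qed

lemma (in ring_morphism) hom_form_value:
  "c (form_value n d x i z) = form_value n d (\<lambda>v. c (x v)) i (\<lambda>j. c (z j))"
  by (simp add: form_value_def hom_sum hom_mult hom_mono_eval)

lemma (in ring_morphism) hom_generic_system:
  "c (generic_system n d y v) = generic_system n d (\<lambda>v. c (y v)) v"
  by (cases v) (simp add: generic_system_def hom_diff hom_mult hom_form_value generic_point_def[abs_def])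

lemma ring_morphism_eval_Const: "ring_morphism (eval_mpoly (Const :: complex \<Rightarrow> ('v, complex) mpoly) x)"
  by (rule ring_morphism.ring_morphism_eval_mpoly[OF ring_morphism_single])

lemma ev_eval_Const: "ev y (eval_mpoly Const x f) = ev (\<lambda>v. ev y (x v)) f"
proof -
  have "(\<lambda>z. ev y (Const z)) = id"
    by (rule ext) simp
  then show ?thesis
    using eval_mpoly_comp[OF ev.ring_morphism_axioms, of y Const x f] by simp
qed

definition vanishing :: "nat \<Rightarrow> nat \<Rightarrow> (coeff_var, complex) mpoly \<Rightarrow> bool" where
  "vanishing n d f \<longleftrightarrow> (\<forall>x\<in>zero_systems n d. ev x f = 0)"

text \<open>Exhibits the vanishing ideal as the kernel of the substitution of the generic system, a
  ring homomorphism into an integral domain. This gives primality, and it makes the generic system a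
  generic point in the field of fractions.\<close>

lemma vanishing_iff_generic:
  assumes "n \<ge> 1"
  shows "vanishing n d f \<longleftrightarrow> eval_mpoly Const (generic_system n d Var) f = 0"
proof -
  have eq: "ev y (eval_mpoly Const (generic_system n d Var) f) = ev (generic_system n d y) f" for y
    by (simp add: ev_eval_Const ev.hom_generic_system)
  show ?thesis
  proof
    assume "vanishing n d f"
    then show "eval_mpoly Const (generic_system n d Var) f = 0"
      by (intro mpoly_eq_0I_torus) (simp add: eq vanishing_def generic_system_mem[OF assms])
  next
    assume "eval_mpoly Const (generic_system n d Var) f = 0"
    then have "ev (generic_system n d y) f = 0" for y
      by (simp flip: eq)
    then show "vanishing n d f"
      unfolding vanishing_def by (metis zero_systems_param)
  qed
qed

lemma vanishing_prime:
  assumes "n \<ge> 1" "vanishing n d (f * g)"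
  shows "vanishing n d f \<or> vanishing n d g"
  using assms(2) by (simp add: vanishing_iff_generic[OF assms(1)]
      ring_morphism.hom_mult[OF ring_morphism_eval_Const])

lemma ring_morphism_fract: "ring_morphism (to_fract :: 'a::idom \<Rightarrow> 'a fract)"
  by unfold_locales simp_all

lemma Var_neq_0: "(Var v :: ('v, complex) mpoly) \<noteq> 0"
proof
  assume "(Var v :: ('v, complex) mpoly) = 0"
  then have "ev (\<lambda>_. 1) (Var v) = ev (\<lambda>_. 1) (0 :: ('v, complex) mpoly)" by (simp only:)
  then show False by simp
qed

text \<open>A place of the field of rational functions that extends the evaluation at x specializes the
  generic zero, suitably scaled, to a zero of the system x.\<close>

theorem zero_systems_closed:
  assumes n: "n \<ge> 1" and x: "\<And>f. vanishing n d f \<Longrightarrow> ev x f = 0"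
  shows "x \<in> zero_systems n d"
proof -
  define \<iota> :: "(coeff_var, complex) mpoly \<Rightarrow> (coeff_var, complex) mpoly fract"
    where "\<iota> = to_fract"
  interpret \<iota>: ring_morphism \<iota>
    unfolding \<iota>_def by (rule ring_morphism_fract)
  have inj: "\<iota> a = 0 \<longleftrightarrow> a = 0" for a
    by (simp add: \<iota>_def)
  define c where "c = (\<lambda>z. \<iota> (Const z))"
  interpret c: ring_morphism c
    unfolding c_def by (rule ring_morphism_comp[OF ring_morphism_single \<iota>.ring_morphism_axioms])
  define Y where "Y = (\<lambda>v. \<iota> (Var v))"
  define \<xi> where "\<xi> = generic_system n d Y"
  have eval: "eval_mpoly c \<xi> f = \<iota> (eval_mpoly Const (generic_system n d Var) f)" for f
    unfolding eval_mpoly_comp[OF \<iota>.ring_morphism_axioms] \<iota>.hom_generic_system \<xi>_def Y_def c_def ..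
  \<comment> \<open>The evaluation at x, on the subring generated by the coefficients of the generic
    system. It is well defined because a polynomial that is 0 at the generic system is
    \<open>vanishing\<close>, and these are 0 at x by assumption.\<close>
  define G0 where "G0 = {(eval_mpoly c \<xi> f, ev x f) |f. True}"
  have "partial_hom c G0"
  proof unfold_locales
    fix z
    have "(eval_mpoly c \<xi> (Const z), ev x (Const z)) \<in> G0"
      unfolding G0_def by blast
    then show "(c z, z) \<in> G0" by simp
  next
    fix a v b w assume "(a, v) \<in> G0" "(b, w) \<in> G0"
    then obtain f g where fg: "a = eval_mpoly c \<xi> f" "v = ev x f" "b = eval_mpoly c \<xi> g" "w = ev x g"
      unfolding G0_def by blast
    have "(eval_mpoly c \<xi> (f + g), ev x (f + g)) \<in> G0" "(eval_mpoly c \<xi> (f * g), ev x (f * g)) \<in> G0"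
      unfolding G0_def by blast+
    then show "(a + b, v + w) \<in> G0" "(a * b, v * w) \<in> G0"
      by (simp_all add: fg c.eval_mpoly_add c.eval_mpoly_mult ev.hom_add ev.hom_mult)
  next
    show "(0, 1) \<notin> G0"
    proof
      assume "(0, 1) \<in> G0"
      then obtain f where f: "eval_mpoly c \<xi> f = 0" "ev x f = 1"
        unfolding G0_def by force
      then have "vanishing n d f"
        by (simp add: eval inj vanishing_iff_generic[OF n])
      then show False using x f by simp
    qed
  qed
  then obtain G where "partial_hom c G" "G0 \<subseteq> G"
    and valuation: "\<And>y. y \<noteq> 0 \<Longrightarrow> (\<exists>w. (y, w) \<in> G) \<or> (\<exists>w. (inverse y, w) \<in> G)"
    by (rule chevalley_extension) (rule that)
  interpret partial_hom c G by fact
  have \<xi>_mem: "(\<xi> v, x v) \<in> G" for v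
  proof -
    have "(eval_mpoly c \<xi> (Var v), ev x (Var v)) \<in> G0"
      unfolding G0_def by blast
    then show ?thesis using \<open>G0 \<subseteq> G\<close> by auto
  qed
  define Z where "Z = generic_point Y"
  have Z_nz: "Z j \<noteq> 0" for j
    by (simp add: Z_def generic_point_def Y_def inj Var_neq_0)
  \<comment> \<open>The generic zero Z need not have values under G, but the proportional point Z /
    Z k has. Its k-th coordinate has value 1, so the specialized point is nontrivial, and
    homogeneity keeps it a zero.\<close>
  obtain k where k: "k \<in> {1..n}" "\<And>j. j \<in> {1..n} \<Longrightarrow> \<exists>w. (Z j / Z k, w) \<in> G"
    using dominating_element[OF valuation, of "Z ` {1..n}"] n Z_nz by fastforce
  then obtain z where z: "\<And>j. j \<in> {1..n} \<Longrightarrow> (Z j / Z k, z j) \<in> G"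
    by metis
  have "z k = 1"
    using z[OF k(1)] Z_nz value_unique[OF _ one_mem] by simp
  moreover have "form_value n d x i z = 0" if i: "i \<in> {1..n}" for i
  proof -
    have scale: "mono_eval (\<lambda>j. Z j / Z k) t = mono_eval Z t / Z k ^ d" if "t \<in> monomials n d" for t
      using that by (simp add: mono_eval_def power_divide prod_dividef monomials_def flip: power_sum)
    have "form_value n d \<xi> i (\<lambda>j. Z j / Z k) = form_value n d \<xi> i Z / Z k ^ d"
      by (simp add: form_value_def scale sum_divide_distrib)
    also have "\<dots> = 0"
      by (simp add: \<xi>_def Z_def form_value_generic_system[OF i])
    finally have "form_value n d \<xi> i (\<lambda>j. Z j / Z k) = 0" .
    moreover have "(form_value n d \<xi> i (\<lambda>j. Z j / Z k), form_value n d x i z) \<in> G"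
      unfolding form_value_def
      by (intro sum_mem mult_mem \<xi>_mem mono_eval_mem z) (use monomials_keys in blast)
    ultimately show ?thesis
      using zero_memD by simp
  qed
  ultimately show ?thesis
    using k(1) unfolding zero_systems_def by (auto intro!: exI[of _ z] bexI[of _ k])
qed

section \<open>Shifts by multiples of the unit system\<close>

definition unit_system :: "nat \<Rightarrow> nat \<Rightarrow> coeff_var \<Rightarrow> 'a::comm_ring_1" where
  "unit_system n d = (\<lambda>(i, t). if i \<in> {1..n} \<and> t = Poly_Mapping.single i d then 1 else 0)"

lemma form_value_add_unit:
  assumes "i \<in> {1..n}"
  shows "form_value n d (\<lambda>v. x v + s * unit_system n d v) i z = form_value n d x i z + s * z i ^ d"
proof -
  have "form_value n d (\<lambda>v. x v + s * unit_system n d v) i z =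
      form_value n d x i z + (\<Sum>t\<in>monomials n d. if t = Poly_Mapping.single i d then s * mono_eval z t else 0)"
    unfolding form_value_def sum.distrib[symmetric]
    by (rule sum.cong) (use assms in \<open>auto simp: unit_system_def algebra_simps\<close>)
  then show ?thesis
    using single_in_monomials[OF assms] by simp
qed

lemma form_value_remove:
  assumes "i \<in> {1..n}"
  shows "form_value n d x i z = x (i, Poly_Mapping.single i d) * z i ^ d +
    (\<Sum>t\<in>monomials n d - {Poly_Mapping.single i d}. x (i, t) * mono_eval z t)"
  unfolding form_value_def
  by (subst sum.remove[OF finite_monomials single_in_monomials[OF assms]]) simp

lemma norm_mono_eval_le:
  fixes z :: "nat \<Rightarrow> 'a::{real_normed_field}"
  assumes "t \<in> monomials n d" "\<And>j. j \<in> {1..n} \<Longrightarrow> norm (z j) \<le> r"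
  shows "norm (mono_eval z t) \<le> r ^ d"
proof -
  have "norm (mono_eval z t) = (\<Prod>j\<in>Poly_Mapping.keys t. norm (z j) ^ Poly_Mapping.lookup t j)"
    by (simp add: mono_eval_def norm_power flip: prod_norm)
  also have "\<dots> \<le> (\<Prod>j\<in>Poly_Mapping.keys t. r ^ Poly_Mapping.lookup t j)"
    by (rule prod_mono) (use assms monomials_keys[OF assms(1)] in \<open>auto intro!: power_mono\<close>)
  also have "\<dots> = r ^ d"
    using assms(1) by (simp add: monomials_def flip: power_sum)
  finally show ?thesis .
qed

text \<open>Gershgorin's argument: at a coordinate i of maximal modulus, s \<open>z i ^ d\<close> is
  the negative of the i-th form of x at z, and every monomial there is at most the d-th power of
  that modulus, which then cancels.\<close>

lemma zero_systems_shift_bound: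
  assumes "(\<lambda>v. x v + s * unit_system n d v) \<in> zero_systems n d"
  shows "norm s \<le> (\<Sum>v\<in>{1..n} \<times> monomials n d. norm (x v))"
proof -
  obtain z k where z: "k \<in> {1..n}" "z k \<noteq> 0"
    "\<And>i. i \<in> {1..n} \<Longrightarrow> form_value n d (\<lambda>v. x v + s * unit_system n d v) i z = 0"
    using assms unfolding zero_systems_def by blast
  have "Max ((\<lambda>j. norm (z j)) ` {1..n}) \<in> (\<lambda>j. norm (z j)) ` {1..n}"
    using z(1) by (intro Max_in) auto
  then obtain i where i: "i \<in> {1..n}" and Max: "Max ((\<lambda>j. norm (z j)) ` {1..n}) = norm (z i)"
    by auto
  have max: "norm (z j) \<le> norm (z i)" if "j \<in> {1..n}" for j
    unfolding Max[symmetric] using that by (intro Max_ge) auto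
  then have pos: "norm (z i) > 0"
    using z(2) max[OF z(1)] by (meson less_le_trans zero_less_norm_iff)
  have "s * z i ^ d = - form_value n d x i z"
    using z(3)[OF i] by (simp add: form_value_add_unit[OF i] eq_neg_iff_add_eq_0 add.commute)
  then have "norm s * norm (z i) ^ d = norm (form_value n d x i z)"
    by (metis norm_minus_cancel norm_mult norm_power)
  also have "\<dots> \<le> (\<Sum>t\<in>monomials n d. norm (x (i, t)) * norm (z i) ^ d)"
    unfolding form_value_def
    by (rule sum_norm_le) (auto simp: norm_mult intro!: mult_left_mono norm_mono_eval_le max)
  finally have "norm s * norm (z i) ^ d \<le> (\<Sum>t\<in>monomials n d. norm (x (i, t))) * norm (z i) ^ d"
    by (simp add: sum_distrib_right)
  then have "norm s \<le> (\<Sum>t\<in>monomials n d. norm (x (i, t)))"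
    using pos by simp
  also have "\<dots> = (\<Sum>v\<in>{i} \<times> monomials n d. norm (x v))"
    by (subst sum.cartesian_product') simp
  also have "\<dots> \<le> (\<Sum>v\<in>{1..n} \<times> monomials n d. norm (x v))"
    using i by (intro sum_mono2) auto
  finally show ?thesis .
qed

lemma mono_eval_first_axis:
  fixes z :: "nat \<Rightarrow> complex"
  assumes "t \<in> monomials n d" "z 1 = 1" "\<And>j. j \<in> {1..n} \<Longrightarrow> j \<noteq> 1 \<Longrightarrow> z j = 0"
  shows "mono_eval z t = of_bool (t = Poly_Mapping.single 1 d)"
proof (cases "Poly_Mapping.keys t \<subseteq> {1}")
  case True
  have "(\<Sum>v\<in>{1}. Poly_Mapping.lookup t v) = (\<Sum>v\<in>Poly_Mapping.keys t. Poly_Mapping.lookup t v)"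
    by (rule sum.mono_neutral_right) (use True in \<open>auto simp: in_keys_iff\<close>)
  also have "\<dots> = d"
    using assms(1) by (simp add: monomials_def)
  finally have t1: "Poly_Mapping.lookup t 1 = d"
    by simp
  have "t = Poly_Mapping.single 1 d"
  proof (rule poly_mapping_eqI)
    fix k
    have "Poly_Mapping.lookup t k = 0" if "k \<noteq> 1"
      using that True by (meson in_keys_iff singletonD subsetD)
    then show "Poly_Mapping.lookup t k = Poly_Mapping.lookup (Poly_Mapping.single 1 d) k"
      using t1 by (cases "k = 1") (simp_all add: lookup_single when_def)
  qed
  then show ?thesis
    using assms(2) by simp
next
  case False
  then obtain j where j: "j \<in> Poly_Mapping.keys t" "j \<noteq> 1" by blast
  then have "z j = 0"
    using assms(3) monomials_keys[OF assms(1)] by blast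
  then have "mono_eval z t = 0"
    using j by (auto simp: mono_eval_def in_keys_iff intro!: bexI[of _ j])
  moreover have "t \<noteq> Poly_Mapping.single 1 d"
    using False by (auto split: if_splits)
  ultimately show ?thesis by simp
qed

text \<open>Systems with a zero near the first coordinate point have arbitrary coefficients, except that
  the diagonal coefficients of the forms \<open>2, \<dots>, n\<close> tend to infinity in an arbitrary direction. So the
  part of f of highest degree in these vanishes.\<close>

lemma shifted_zero_systems_dense:
  assumes n: "n \<ge> 1" and d: "d \<ge> 1"
    and f: "\<And>x s. (\<lambda>v. x v + s * unit_system n d v) \<in> zero_systems n d \<Longrightarrow> ev x f = 0"
  shows "f = 0"
proof (rule ccontr)
  assume "f \<noteq> 0"
  define e1 where "e1 = (Poly_Mapping.single 1 d :: nat \<Rightarrow>\<^sub>0 nat)"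
  \<comment> \<open>D holds the diagonal variables that tend to infinity, e is the degree of f in
    them, and T collects the monomials of f of that degree. The contradiction will be that the
    T-part of f vanishes at a point \<gamma> chosen to avoid its zeros.\<close>
  define D where "D = (\<lambda>i. (i, Poly_Mapping.single i d)) ` {2..n}"
  define deg where "deg = (\<lambda>t :: coeff_var \<Rightarrow>\<^sub>0 nat. \<Sum>v\<in>Poly_Mapping.keys t. if v \<in> D then Poly_Mapping.lookup t v else 0)"
  define e where "e = Max (deg ` Poly_Mapping.keys f)"
  define T where "T = {t \<in> Poly_Mapping.keys f. deg t = e}"
  have deg_le: "deg t \<le> e" if "t \<in> Poly_Mapping.keys f" for t
    unfolding e_def using that by (intro Max_ge) auto
  have "e \<in> deg ` Poly_Mapping.keys f"
    unfolding e_def using \<open>f \<noteq> 0\<close> by (intro Max_in) auto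
  then obtain t0 where t0: "t0 \<in> T"
    by (auto simp: T_def)
  have "finite T"
    by (simp add: T_def)
  from t0 have "\<not> (\<forall>t\<in>T. Poly_Mapping.lookup f t = 0)"
    by (auto simp: T_def in_keys_iff)
  with monomials_independent[OF \<open>finite T\<close>, of "Poly_Mapping.lookup f"]
  obtain \<gamma> where \<gamma>: "\<And>v. \<gamma> v \<noteq> 0" and nz: "(\<Sum>t\<in>T. Poly_Mapping.lookup f t * mono_eval \<gamma> t) \<noteq> 0"
    by blast
  have "\<exists>y. y ^ d = - \<gamma> (j, e1) / \<gamma> (j, Poly_Mapping.single j d)" for j
  proof -
    have "degree (monom 1 d + [:- (- \<gamma> (j, e1) / \<gamma> (j, Poly_Mapping.single j d)):] :: complex poly) = d"
      using d by (subst degree_add_eq_left) (simp_all add: degree_monom_eq)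
    then have "\<not> constant (poly (monom 1 d + [:- (- \<gamma> (j, e1) / \<gamma> (j, Poly_Mapping.single j d)):] :: complex poly))"
      using d by (simp add: constant_degree)
    then obtain y where "poly (monom 1 d + [:- (- \<gamma> (j, e1) / \<gamma> (j, Poly_Mapping.single j d)):]) y = 0"
      using fundamental_theorem_of_algebra by blast
    then show ?thesis
      by (intro exI[of _ y]) (simp add: poly_monom eq_neg_iff_add_eq_0)
  qed
  \<comment> \<open>Near the first axis, form j is governed by its coefficient at \<open>e1\<close>
    and its diagonal term. Balancing the two with diagonal coefficient \<gamma> (j, x_j^d) /
    \<tau>^d at the coordinate \<tau> y j requires this value of \<open>y j ^ d\<close>.\<close>
  then obtain y where y: "\<And>j. y j ^ d = - \<gamma> (j, e1) / \<gamma> (j, Poly_Mapping.single j d)"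
    by metis
  have y_nz: "y j \<noteq> 0" for j
    using y[of j] \<gamma> d by (auto simp: zero_power)
  \<comment> \<open>The zero tends to (1, 0, ..., 0) as \<tau> tends to 0. The first equation, where
    the first coordinate is 1, dictates s; each remaining equation is then solved for its diagonal
    coefficient, which defines x.\<close>
  define z where "z = (\<lambda>\<tau> j. if j = 1 then 1 else \<tau> * y j)"
  define s where "s = (\<lambda>\<tau>. - form_value n d \<gamma> 1 (z \<tau>))"
  define r where "r = (\<lambda>\<tau> i. \<Sum>t\<in>monomials n d - {Poly_Mapping.single i d}. \<gamma> (i, t) * mono_eval (z \<tau>) t)"
  define x where "x = (\<lambda>\<tau> v. if v \<in> D then - s \<tau> - r \<tau> (fst v) / (\<tau> * y (fst v)) ^ d else \<gamma> v)"
  \<comment> \<open>This is x with the variables of D multiplied by \<open>\<tau> ^ d\<close>,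
    written without negative powers of \<tau>. Unlike x, it has a limit at 0, namely
    \<gamma>.\<close>
  define b where "b = (\<lambda>\<tau> v. if v \<in> D then - (\<tau> ^ d * s \<tau>) - r \<tau> (fst v) / y (fst v) ^ d else \<gamma> v)"
  have mem: "(\<lambda>v. x \<tau> v + s \<tau> * unit_system n d v) \<in> zero_systems n d" if \<tau>: "\<tau> \<noteq> 0" for \<tau>
    unfolding zero_systems_def mem_Collect_eq
  proof (intro exI[of _ "z \<tau>"] conjI ballI)
    show "\<exists>i\<in>{1..n}. z \<tau> i \<noteq> 0"
      using n by (intro bexI[of _ 1]) (auto simp: z_def)
    fix i assume i: "i \<in> {1..n}"
    have "form_value n d (x \<tau>) i (z \<tau>) + s \<tau> * z \<tau> i ^ d = 0"
    proof (cases "i = 1")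
      case True
      have "form_value n d (x \<tau>) 1 (z \<tau>) = form_value n d \<gamma> 1 (z \<tau>)"
        unfolding form_value_def by (rule sum.cong) (auto simp: x_def D_def)
      then show ?thesis
        using True by (simp add: s_def z_def)
    next
      case False
      then have iD: "(i, Poly_Mapping.single i d) \<in> D"
        using i by (auto simp: D_def)
      have zi: "z \<tau> i = \<tau> * y i" using False by (simp add: z_def)
      have "(\<Sum>t\<in>monomials n d - {Poly_Mapping.single i d}. x \<tau> (i, t) * mono_eval (z \<tau>) t) = r \<tau> i"
        unfolding r_def by (rule sum.cong) (auto simp: x_def D_def)
      then have "form_value n d (x \<tau>) i (z \<tau>) =
          (- s \<tau> - r \<tau> i / (\<tau> * y i) ^ d) * (\<tau> * y i) ^ d + r \<tau> i"
        unfolding form_value_remove[OF i] zi using iD by (simp add: x_def)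
      then show ?thesis
        using \<tau> y_nz[of i] zi by (simp add: field_simps)
    qed
    then show "form_value n d (\<lambda>v. x \<tau> v + s \<tau> * unit_system n d v) i (z \<tau>) = 0"
      by (simp add: form_value_add_unit[OF i])
  qed
  have b_x: "b \<tau> v = (if v \<in> D then \<tau> ^ d else 1) * x \<tau> v" if "\<tau> \<noteq> 0" for \<tau> v
    using that y_nz by (simp add: b_def x_def power_mult_distrib field_simps)
  have mono_b: "mono_eval (b \<tau>) t = \<tau> ^ (d * deg t) * mono_eval (x \<tau>) t" if "\<tau> \<noteq> 0" for \<tau> t
  proof -
    have "mono_eval (b \<tau>) t = mono_eval (\<lambda>v. if v \<in> D then \<tau> ^ d else 1) t * mono_eval (x \<tau>) t"
      unfolding mono_eval_times[symmetric] by (rule arg_cong[of _ _ "\<lambda>x. mono_eval x t"]) (rule ext, rule b_x[OF that])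
    also have "mono_eval (\<lambda>v. if v \<in> D then \<tau> ^ d else 1) t =
        (\<Prod>v\<in>Poly_Mapping.keys t. \<tau> ^ (d * (if v \<in> D then Poly_Mapping.lookup t v else 0)))"
      unfolding mono_eval_def by (rule prod.cong) (auto simp: power_mult)
    also have "\<dots> = \<tau> ^ (d * deg t)"
      by (simp add: deg_def sum_distrib_left flip: power_sum)
    finally show ?thesis .
  qed
  \<comment> \<open>Multiplication by \<open>\<tau> ^ (d * e)\<close> replaces x by b and leaves
    surplus powers of \<tau>, which are trivial exactly on T, as d > 0. So only the T-part survives
    in the limit.\<close>
  have zero: "(\<Sum>t\<in>Poly_Mapping.keys f. Poly_Mapping.lookup f t * (\<tau> ^ (d * (e - deg t)) * mono_eval (b \<tau>) t)) = 0"
    if \<tau>: "\<tau> \<noteq> 0" for \<tau>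
  proof -
    have "Poly_Mapping.lookup f t * (\<tau> ^ (d * (e - deg t)) * mono_eval (b \<tau>) t) =
        \<tau> ^ (d * e) * (Poly_Mapping.lookup f t * mono_eval (x \<tau>) t)"
      if "t \<in> Poly_Mapping.keys f" for t
    proof -
      have "d * e = d * (e - deg t) + d * deg t"
        using deg_le[OF that] by (simp flip: distrib_left)
      then show ?thesis
        by (simp add: mono_b[OF \<tau>] power_add)
    qed
    then have "(\<Sum>t\<in>Poly_Mapping.keys f. Poly_Mapping.lookup f t * (\<tau> ^ (d * (e - deg t)) * mono_eval (b \<tau>) t)) =
        \<tau> ^ (d * e) * ev (x \<tau>) f"
      unfolding eval_mpoly_mono_eval sum_distrib_left id_apply by (rule sum.cong[OF refl])
    then show ?thesis
      using f[OF mem[OF \<tau>]] by simp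
  qed
  have z_lim: "((\<lambda>\<tau>. z \<tau> j) \<longlongrightarrow> of_bool (j = 1)) (at 0)" for j
  proof (cases "j = 1")
    case False
    have "((\<lambda>\<tau>. \<tau> * y j) \<longlongrightarrow> 0 * y j) (at 0)"
      by (intro tendsto_intros)
    then show ?thesis using False by (simp add: z_def)
  qed (simp add: z_def)
  have mono_z_lim: "((\<lambda>\<tau>. mono_eval (z \<tau>) t) \<longlongrightarrow> of_bool (t = e1)) (at 0)"
    if "t \<in> monomials n d" for t
  proof -
    have "((\<lambda>\<tau>. mono_eval (z \<tau>) t) \<longlongrightarrow> mono_eval (\<lambda>j. of_bool (j = 1)) t) (at 0)"
      unfolding mono_eval_def by (intro tendsto_prod tendsto_power z_lim)
    then show ?thesis
      unfolding e1_def by (subst (asm) mono_eval_first_axis[OF that]) auto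
  qed
  have s_lim: "((\<lambda>\<tau>. s \<tau>) \<longlongrightarrow> - (\<Sum>t\<in>monomials n d. \<gamma> (1, t) * of_bool (t = e1))) (at 0)"
    unfolding s_def form_value_def by (intro tendsto_intros mono_z_lim)
  have b_lim: "((\<lambda>\<tau>. b \<tau> v) \<longlongrightarrow> \<gamma> v) (at 0)" for v
  proof (cases "v \<in> D")
    case True
    then obtain i where i: "i \<in> {2..n}" "v = (i, Poly_Mapping.single i d)"
      by (auto simp: D_def)
    have e1: "e1 \<in> monomials n d - {Poly_Mapping.single i d}"
    proof -
      have "Poly_Mapping.lookup e1 1 \<noteq> Poly_Mapping.lookup (Poly_Mapping.single i d) 1"
        using i d by (simp add: e1_def lookup_single when_def)
      then have "e1 \<noteq> Poly_Mapping.single i d" by metis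
      moreover have "e1 \<in> monomials n d"
        unfolding e1_def using n by (intro single_in_monomials) auto
      ultimately show ?thesis by simp
    qed
    have "((\<lambda>\<tau>. r \<tau> i) \<longlongrightarrow> (\<Sum>t\<in>monomials n d - {Poly_Mapping.single i d}. \<gamma> (i, t) * of_bool (t = e1))) (at 0)"
      unfolding r_def by (intro tendsto_intros mono_z_lim) auto
    also have "(\<Sum>t\<in>monomials n d - {Poly_Mapping.single i d}. \<gamma> (i, t) * of_bool (t = e1)) =
        (\<Sum>t\<in>monomials n d - {Poly_Mapping.single i d}. if t = e1 then \<gamma> (i, t) else 0)"
      by (rule sum.cong) auto
    also have "\<dots> = \<gamma> (i, e1)"
      using e1 by (subst sum.delta) auto
    finally have "((\<lambda>\<tau>. - (\<tau> ^ d * s \<tau>) - r \<tau> i / y i ^ d) \<longlongrightarrow>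
        - (0 ^ d * - (\<Sum>t\<in>monomials n d. \<gamma> (1, t) * of_bool (t = e1))) - \<gamma> (i, e1) / y i ^ d) (at 0)"
      using y_nz by (intro tendsto_intros s_lim) auto
    moreover have "- (0 ^ d * - (\<Sum>t\<in>monomials n d. \<gamma> (1, t) * of_bool (t = e1))) - \<gamma> (i, e1) / y i ^ d = \<gamma> v"
      using d \<gamma> by (simp add: zero_power y i)
    ultimately show ?thesis
      using True i by (simp add: b_def)
  qed (simp add: b_def)
  have "((\<lambda>\<tau>. \<Sum>t\<in>Poly_Mapping.keys f. Poly_Mapping.lookup f t * (\<tau> ^ (d * (e - deg t)) * mono_eval (b \<tau>) t))
      \<longlongrightarrow> (\<Sum>t\<in>Poly_Mapping.keys f. Poly_Mapping.lookup f t * (0 ^ (d * (e - deg t)) * mono_eval \<gamma> t))) (at 0)"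
    unfolding mono_eval_def by (intro tendsto_intros b_lim)
  moreover have "((\<lambda>\<tau>. \<Sum>t\<in>Poly_Mapping.keys f. Poly_Mapping.lookup f t * (\<tau> ^ (d * (e - deg t)) * mono_eval (b \<tau>) t))
      \<longlongrightarrow> 0) (at 0)"
    by (rule tendsto_eventually) (auto simp: eventually_at_filter zero)
  ultimately have "(\<Sum>t\<in>Poly_Mapping.keys f. Poly_Mapping.lookup f t * (0 ^ (d * (e - deg t)) * mono_eval \<gamma> t)) = 0"
    using tendsto_unique[of "at (0::complex)"] by force
  also have "(\<Sum>t\<in>Poly_Mapping.keys f. Poly_Mapping.lookup f t * (0 ^ (d * (e - deg t)) * mono_eval \<gamma> t)) =
      (\<Sum>t\<in>T. Poly_Mapping.lookup f t * mono_eval \<gamma> t)"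
  proof (rule sum.mono_neutral_cong_right)
    show "\<forall>t\<in>Poly_Mapping.keys f - T. Poly_Mapping.lookup f t * (0 ^ (d * (e - deg t)) * mono_eval \<gamma> t) = 0"
      using deg_le d unfolding T_def by (fastforce simp: zero_power)
  qed (auto simp: T_def)
  finally show False
    using nz by simp
qed

subsection \<open>Divisibility by growth and monic generators\<close>

text \<open>After cancelling a common divisor g of maximal degree, a root a of the cofactor of p
  would, by the bound near a and continuity, also be a root of the cofactor of q. Then g (X - a)
  would be a larger common divisor. So the cofactor of p has no root and is constant.\<close>

lemma poly_dvd_of_locally_bounded:
  fixes p q :: "complex poly"
  assumes "p \<noteq> 0"
    and bound: "\<And>r. \<exists>C. \<forall>\<tau>. norm \<tau> \<le> r \<longrightarrow> poly p \<tau> \<noteq> 0 \<longrightarrow> norm (poly q \<tau>) \<le> C * norm (poly p \<tau>)"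
  shows "p dvd q"
proof -
  have "\<exists>g. (g dvd p \<and> g dvd q) \<and> (\<forall>h. h dvd p \<and> h dvd q \<longrightarrow> degree h \<le> degree g)"
    by (rule ex_has_greatest_nat[of _ 1 _ "Suc (degree p)"])
      (auto dest: dvd_imp_degree_le[OF _ assms(1)])
  then obtain g where g: "g dvd p" "g dvd q"
    and max: "\<And>h. h dvd p \<Longrightarrow> h dvd q \<Longrightarrow> degree h \<le> degree g"
    by blast
  obtain p' q' where p': "p = g * p'" and q': "q = g * q'"
    using g by (metis dvdE)
  have "g \<noteq> 0" using p' assms(1) by auto
  have "p' \<noteq> 0" using p' assms(1) by auto
  have "poly p' a \<noteq> 0" for a
  proof
    assume a: "poly p' a = 0"
    obtain C where C: "\<And>\<tau>. norm \<tau> \<le> norm a + 1 \<Longrightarrow> poly p \<tau> \<noteq> 0 \<Longrightarrow> norm (poly q \<tau>) \<le> C * norm (poly p \<tau>)"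
      using bound by blast
    have "finite {\<tau>. poly p \<tau> = 0}"
      using assms(1) by (rule poly_roots_finite)
    then have "open (- ({\<tau>. poly p \<tau> = 0} - {a}))"
      by (intro open_Compl finite_imp_closed finite_Diff)
    then have "\<forall>\<^sub>F \<tau> in at a. poly p \<tau> \<noteq> 0"
      unfolding eventually_at_topological by (intro exI[of _ "- ({\<tau>. poly p \<tau> = 0} - {a})"]) auto
    moreover have "\<forall>\<^sub>F \<tau> in at a. norm \<tau> \<le> norm a + 1"
      using order_tendstoD(2)[OF tendsto_norm[OF tendsto_ident_at], of a "norm a + 1" UNIV]
      by (auto elim: eventually_mono)
    ultimately have "\<forall>\<^sub>F \<tau> in at a. norm (poly q' \<tau>) \<le> C * norm (poly p' \<tau>)"
    proof eventually_elim
      case (elim \<tau>)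
      then have "norm (poly g \<tau>) * norm (poly q' \<tau>) \<le> norm (poly g \<tau>) * (C * norm (poly p' \<tau>))"
        using C[of \<tau>] by (simp add: p' q' norm_mult mult_ac)
      moreover have "norm (poly g \<tau>) > 0"
        using elim by (simp add: p')
      ultimately show ?case by simp
    qed
    moreover have "((\<lambda>\<tau>. norm (poly q' \<tau>)) \<longlongrightarrow> norm (poly q' a)) (at a)"
      "((\<lambda>\<tau>. C * norm (poly p' \<tau>)) \<longlongrightarrow> C * norm (poly p' a)) (at a)"
      by (intro tendsto_intros isContD[OF poly_isCont])+
    ultimately have "norm (poly q' a) \<le> C * norm (poly p' a)"
      by (intro tendsto_le[OF at_neq_bot]) auto
    then have "poly q' a = 0" using a by simp
    then have "[:- a, 1:] dvd p'" "[:- a, 1:] dvd q'"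
      using a by (simp_all add: poly_eq_0_iff_dvd)
    then have "degree (g * [:- a, 1:]) \<le> degree g"
      unfolding p' q' by (intro max[unfolded p' q'] mult_dvd_mono) auto
    then show False
      using \<open>g \<noteq> 0\<close> by (subst (asm) degree_mult_eq) auto
  qed
  then have "degree p' = 0"
    using fundamental_theorem_of_algebra[of p'] constant_degree[of p'] by metis
  then have "p' dvd q'"
    using \<open>p' \<noteq> 0\<close> by (metis is_unit_iff_degree unit_imp_dvd)
  then show ?thesis
    by (simp add: p' q')
qed

text \<open>Splitting off a root a turns the coefficients of the quotient into differences
  \<open>q\<^sub>k\<^sub>-\<^sub>1 - a * q\<^sub>k\<close>, so each root costs at most a factor 1 +
  B.\<close>

lemma poly_coeff_bound_of_roots:
  fixes p :: "complex poly"
  assumes "\<And>z. poly p z = 0 \<Longrightarrow> norm z \<le> B" "B \<ge> 0"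
  shows "norm (coeff p k) \<le> norm (lead_coeff p) * (1 + B) ^ degree p"
  using assms(1)
proof (induction "degree p" arbitrary: p k)
  case 0
  then obtain z where "p = [:z:]" by (metis degree_eq_zeroE)
  then show ?case by (cases k) auto
next
  case (Suc n)
  then obtain a where a: "poly p a = 0"
    using fundamental_theorem_of_algebra[of p] constant_degree[of p] by (metis nat.distinct(1))
  then obtain q where q: "p = [:- a, 1:] * q"
    by (metis dvdE poly_eq_0_iff_dvd)
  have "q \<noteq> 0" using Suc.hyps(2) q by auto
  then have deg: "degree q = n"
    using Suc.hyps(2) unfolding q by (subst (asm) degree_mult_eq) auto
  have lead: "lead_coeff p = lead_coeff q"
    by (simp only: q lead_coeff_mult) simp
  have "norm a \<le> B" using Suc.prems a by blast
  have IH: "norm (coeff q j) \<le> norm (lead_coeff q) * (1 + B) ^ n" for j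
    using Suc.hyps(1)[of q j] Suc.prems deg by (simp add: q)
  let ?K = "norm (lead_coeff q) * (1 + B) ^ n"
  have "?K \<ge> 0" using assms(2) by simp
  have pK: "norm (case k of 0 \<Rightarrow> 0 | Suc j \<Rightarrow> coeff q j) \<le> ?K"
    using IH \<open>?K \<ge> 0\<close> by (simp split: nat.split)
  have "coeff p k = (case k of 0 \<Rightarrow> 0 | Suc j \<Rightarrow> coeff q j) - a * coeff q k"
    by (simp add: q coeff_pCons split: nat.split)
  then have "norm (coeff p k) \<le> norm (case k of 0 \<Rightarrow> 0 | Suc j \<Rightarrow> coeff q j) + norm a * norm (coeff q k)"
    by (metis norm_mult norm_triangle_ineq4)
  also have "\<dots> \<le> ?K + B * ?K"
    by (intro add_mono mult_mono pK IH \<open>norm a \<le> B\<close> assms(2)) simp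
  also have "\<dots> = norm (lead_coeff p) * (1 + B) ^ degree p"
    unfolding lead by (simp add: algebra_simps flip: Suc.hyps(2))
  finally show ?case .
qed

section \<open>Division of multivariate polynomials along lines\<close>

lemma (in ring_morphism) degree_map_poly_le: "degree (map_poly c p) \<le> degree p"
  by (rule degree_le) (simp add: coeff_map_poly coeff_eq_0)

lemma ring_morphism_map_poly:
  assumes "ring_morphism c"
  shows "ring_morphism (map_poly c)"
proof -
  interpret ring_morphism c by fact
  show ?thesis
    by unfold_locales
      (auto intro!: poly_eqI simp: coeff_map_poly coeff_mult hom_add hom_mult hom_sum coeff_1)
qed

text \<open>The expansion f(X + T w) as a polynomial in T, whose coefficients are polynomials in the
  variables X.\<close>

definition along :: "('v \<Rightarrow> complex) \<Rightarrow> ('v, complex) mpoly \<Rightarrow> ('v, complex) mpoly poly" where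
  "along w f = eval_mpoly (\<lambda>z. [:Const z:]) (\<lambda>v. [:Var v, Const (w v):]) f"

lemma poly_along_0: "poly (along w f) 0 = f"
proof -
  have "poly (along w f) 0 = eval_mpoly Const (\<lambda>v. Var v) f"
    unfolding along_def by (subst eval_mpoly_comp[OF ring_morphism_poly]) simp
  then show ?thesis by simp
qed

lemma poly_map_poly_along: "poly (map_poly (ev x) (along w f)) \<tau> = ev (\<lambda>v. x v + \<tau> * w v) f"
proof -
  have hom: "ring_morphism (\<lambda>p. poly (map_poly (ev x) p) \<tau>)"
    by (rule ring_morphism_comp[OF ring_morphism_map_poly[OF ev.ring_morphism_axioms] ring_morphism_poly])
  have "(\<lambda>z. poly (map_poly (ev x) [:Const z:]) \<tau>) = id"
    by (rule ext) (simp add: map_poly_pCons)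
  then show ?thesis
    using eval_mpoly_comp[OF hom, of "\<lambda>z. [:Const z:]" "\<lambda>v. [:Var v, Const (w v):]" f]
    by (simp add: along_def map_poly_pCons)
qed

text \<open>As in Noether normalization: the coefficient of T^e, with e the total degree of f, is
  the top homogeneous part of f evaluated at w, and w is chosen outside its zeros. The linear order
  on the variables serves to make the polynomial ring an integral domain, so that degrees of
  products add.\<close>

lemma along_lead_coeff:
  fixes f :: "('v::linorder, complex) mpoly"
  assumes "f \<noteq> 0"
  obtains w u where "u \<noteq> 0" "lead_coeff (along w f) = Const u"
proof -
  define deg where "deg = (\<lambda>t :: 'v \<Rightarrow>\<^sub>0 nat. \<Sum>v\<in>Poly_Mapping.keys t. Poly_Mapping.lookup t v)"
  define e where "e = Max (deg ` Poly_Mapping.keys f)"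
  define T where "T = {t \<in> Poly_Mapping.keys f. deg t = e}"
  have deg_le: "deg t \<le> e" if "t \<in> Poly_Mapping.keys f" for t
    unfolding e_def using that by (intro Max_ge) auto
  have "e \<in> deg ` Poly_Mapping.keys f"
    unfolding e_def using assms by (intro Max_in) auto
  then have "\<not> (\<forall>t\<in>T. Poly_Mapping.lookup f t = 0)"
    by (auto simp: T_def in_keys_iff)
  with monomials_independent[of T "Poly_Mapping.lookup f"]
  obtain w where w: "\<And>v. w v \<noteq> 0" and nz: "(\<Sum>t\<in>T. Poly_Mapping.lookup f t * mono_eval w t) \<noteq> 0"
    by (auto simp: T_def)
  let ?m = "\<lambda>t. mono_eval (\<lambda>v. [:Var v, Const (w v):] :: ('v, complex) mpoly poly) t"
  have Const_nz: "Const (w v) \<noteq> (0 :: ('v, complex) mpoly)" for v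
    using w by (metis lookup_single_eq lookup_zero)
  have deg_m: "degree (?m t) = deg t" for t
    unfolding mono_eval_def deg_def
    by (subst degree_prod_eq_sum_degree) (auto simp: degree_power_eq Const_nz)
  interpret C: ring_morphism "Const :: complex \<Rightarrow> ('v, complex) mpoly"
    by (rule ring_morphism_single)
  have lead_m: "coeff (?m t) (deg t) = Const (mono_eval w t)" for t
  proof -
    have "lead_coeff (?m t) = Const (mono_eval w t)"
      by (simp add: mono_eval_def lead_coeff_prod lead_coeff_power Const_nz C.hom_prod C.hom_power)
    then show ?thesis by (simp add: deg_m)
  qed
  have along: "along w f = (\<Sum>t\<in>Poly_Mapping.keys f. smult (Const (Poly_Mapping.lookup f t)) (?m t))"
    by (simp add: along_def eval_mpoly_mono_eval)
  have "coeff (along w f) e = (\<Sum>t\<in>Poly_Mapping.keys f. Const (Poly_Mapping.lookup f t) * coeff (?m t) e)"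
    by (simp add: along coeff_sum)
  also have "\<dots> = (\<Sum>t\<in>T. Const (Poly_Mapping.lookup f t * mono_eval w t))"
  proof (rule sum.mono_neutral_cong_right)
    show "\<forall>t\<in>Poly_Mapping.keys f - T. Const (Poly_Mapping.lookup f t) * coeff (?m t) e = 0"
    proof
      fix t assume "t \<in> Poly_Mapping.keys f - T"
      then have "degree (?m t) < e"
        using deg_le[of t] unfolding deg_m T_def by auto
      then show "Const (Poly_Mapping.lookup f t) * coeff (?m t) e = 0"
        by (simp add: coeff_eq_0)
    qed
    show "Const (Poly_Mapping.lookup f t) * coeff (?m t) e = Const (Poly_Mapping.lookup f t * mono_eval w t)"
      if "t \<in> T" for t
      using that lead_m[of t] unfolding C.hom_mult by (simp add: T_def)
  qed (auto simp: T_def)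
  also have "\<dots> = Const (\<Sum>t\<in>T. Poly_Mapping.lookup f t * mono_eval w t)"
    by (simp add: C.hom_sum)
  finally have coeff: "coeff (along w f) e = Const (\<Sum>t\<in>T. Poly_Mapping.lookup f t * mono_eval w t)" .
  moreover have "degree (along w f) = e"
  proof (rule antisym)
    show "degree (along w f) \<le> e"
      unfolding along by (rule degree_sum_le) (auto intro: order_trans[OF degree_smult_le] simp: deg_m deg_le)
    show "e \<le> degree (along w f)"
      by (rule le_degree) (use coeff nz in \<open>metis lookup_single_eq lookup_zero\<close>)
  qed
  ultimately show thesis
    using that nz by metis
qed

lemma monic_division:
  fixes f g :: "'a::comm_ring_1 poly"
  assumes "lead_coeff g = 1"
  obtains q r where "f = g * q + r" "r = 0 \<or> degree r < degree g"
proof -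
  have "g \<noteq> 0" using assms by auto
  obtain q r where qr: "pseudo_divmod f g = (q, r)" by fastforce
  show thesis
    using pseudo_divmod[OF \<open>g \<noteq> 0\<close> qr] assms that by simp
qed

text \<open>Along lines in a suitable direction, a is a polynomial of constant degree with constant leading
  coefficient, so b can be divided by a with remainder. On every such line the remainder is 0.\<close>

lemma mpoly_dvd_of_locally_bounded:
  fixes a b :: "('v::linorder, complex) mpoly"
  assumes "a \<noteq> 0"
    and bound: "\<And>x w r. \<exists>C. \<forall>\<tau>. norm \<tau> \<le> r \<longrightarrow> ev (\<lambda>v. x v + \<tau> * w v) a \<noteq> 0 \<longrightarrow>
      norm (ev (\<lambda>v. x v + \<tau> * w v) b) \<le> C * norm (ev (\<lambda>v. x v + \<tau> * w v) a)"
  shows "a dvd b"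
proof -
  obtain w u where u: "u \<noteq> 0" "lead_coeff (along w a) = Const u"
    using along_lead_coeff[OF assms(1)] by metis
  define A where "A = smult (Const (inverse u)) (along w a)"
  have unit: "Const (inverse u) * Const u = (1 :: ('v, complex) mpoly)"
    using u by (simp add: mult_single)
  have "coeff A (degree (along w a)) = 1"
    by (simp add: A_def u unit)
  moreover from this have "degree A = degree (along w a)"
    by (metis A_def antisym degree_smult_le le_degree one_neq_zero)
  ultimately have monic: "lead_coeff A = 1" by simp
  obtain Q r where Q: "along w b = A * Q + r" "r = 0 \<or> degree r < degree A"
    using monic_division[OF monic] by metis
  have "r = 0"
  proof (rule ccontr)
    assume "r \<noteq> 0"
    have "coeff r k = 0" for k
    proof (rule mpoly_eq_0I)
      fix x :: "'v \<Rightarrow> complex"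
      interpret m: ring_morphism "map_poly (ev x)"
        by (rule ring_morphism_map_poly) (rule ev.ring_morphism_axioms)
      let ?m = "map_poly (ev x)"
      have lead: "coeff (?m A) (degree A) = 1"
        by (simp add: coeff_map_poly monic)
      have "degree (?m A) = degree A"
        by (rule antisym[OF ev.degree_map_poly_le le_degree]) (simp add: lead)
      have "?m A \<noteq> 0" using lead by force
      have A: "poly (?m A) \<tau> = inverse u * ev (\<lambda>v. x v + \<tau> * w v) a" for \<tau>
      proof -
        have "?m A = ?m [:Const (inverse u):] * ?m (along w a)"
          by (simp add: A_def flip: m.hom_mult)
        then show ?thesis
          by (simp add: map_poly_pCons poly_map_poly_along)
      qed
      \<comment> \<open>At a fixed x the question concerns one variable, where growth decides
        divisibility. As A is monic, specialization keeps its degree, so the specialized r is still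
        a remainder, and a remainder divisible by the divisor is 0.\<close>
      have "?m A dvd ?m (along w b)"
      proof (rule poly_dvd_of_locally_bounded[OF \<open>?m A \<noteq> 0\<close>])
        fix \<rho> :: real
        obtain C where C: "\<And>\<tau>. norm \<tau> \<le> \<rho> \<Longrightarrow> ev (\<lambda>v. x v + \<tau> * w v) a \<noteq> 0 \<Longrightarrow>
            norm (ev (\<lambda>v. x v + \<tau> * w v) b) \<le> C * norm (ev (\<lambda>v. x v + \<tau> * w v) a)"
          using bound by blast
        have eq: "C * norm u * norm (poly (?m A) \<tau>) = C * norm (ev (\<lambda>v. x v + \<tau> * w v) a)" for \<tau>
          using u(1) by (simp add: A norm_mult norm_inverse)
        show "\<exists>C. \<forall>\<tau>. norm \<tau> \<le> \<rho> \<longrightarrow> poly (?m A) \<tau> \<noteq> 0 \<longrightarrow>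
            norm (poly (?m (along w b)) \<tau>) \<le> C * norm (poly (?m A) \<tau>)"
          unfolding poly_map_poly_along
        proof (intro exI[of _ "C * norm u"] allI impI)
          fix \<tau> assume "norm \<tau> \<le> \<rho>" "poly (?m A) \<tau> \<noteq> 0"
          then show "norm (ev (\<lambda>v. x v + \<tau> * w v) b) \<le> C * norm u * norm (poly (?m A) \<tau>)"
            unfolding eq by (intro C) (auto simp: A)
        qed
      qed
      then have "?m A dvd ?m r"
        unfolding Q m.hom_add m.hom_mult by (simp add: dvd_add_right_iff)
      moreover have "?m r = 0 \<or> degree (?m r) < degree (?m A)"
        using Q(2) \<open>r \<noteq> 0\<close> \<open>degree (?m A) = degree A\<close> ev.degree_map_poly_le[of x r] by auto
      ultimately have "?m r = 0"
        by (meson dvd_imp_degree_le not_le)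
      then have "coeff (?m r) k = 0" by simp
      then show "ev x (coeff r k) = 0"
        by (simp add: coeff_map_poly)
    qed
    then show False
      using \<open>r \<noteq> 0\<close> by (simp add: poly_eq_iff)
  qed
  \<comment> \<open>At line parameter 0 the expansions along w become a and b themselves.\<close>
  then have "poly (along w b) 0 = poly A 0 * poly Q 0"
    using Q by simp
  then have "b = a * (Const (inverse u) * poly Q 0)"
    by (simp add: A_def poly_along_0 mult_ac)
  then show ?thesis by simp
qed

text \<open>Later s is the amount of the shift along the unit system, and x the system before the
  shift.\<close>

definition pev :: "('v \<Rightarrow> complex) \<Rightarrow> complex \<Rightarrow> ('v, complex) mpoly poly \<Rightarrow> complex" where
  "pev x s p = poly (map_poly (ev x) p) s"

lemma ring_morphism_pev: "ring_morphism (pev x s)"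
  unfolding pev_def
  by (rule ring_morphism_comp[OF ring_morphism_map_poly[OF ev.ring_morphism_axioms] ring_morphism_poly])

interpretation pev: ring_morphism "pev x s" for x :: "'v \<Rightarrow> complex" and s
  by (rule ring_morphism_pev)

lemma pev_const [simp]: "pev x s [:f:] = ev x f"
  by (simp add: pev_def map_poly_pCons)

lemma pev_smult: "pev x s (smult f p) = ev x f * pev x s p"
  using pev.hom_mult[of x s "[:f:]" p] by simp

text \<open>Let R0 be an element of minimal degree of the vanishing ideal, and a its leading coefficient.
  Where a does not vanish, all roots of R0 belong to N, so they are bounded, and so are the quotients
  of the other coefficients by a. Hence a divides R0.\<close>

lemma monic_generator:
  fixes N :: "(('v::linorder \<Rightarrow> complex) \<times> complex) set"
  defines "van p \<equiv> \<forall>(x, s)\<in>N. pev x s p = 0"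
  assumes nz: "p0 \<noteq> 0" "van p0"
    and closed: "\<And>x s. (\<And>p. van p \<Longrightarrow> pev x s p = 0) \<Longrightarrow> (x, s) \<in> N"
    and const: "\<And>f. van [:f:] \<Longrightarrow> f = 0"
    and bounded: "\<And>x s. (x, s) \<in> N \<Longrightarrow> norm s \<le> (\<Sum>v\<in>V. norm (x v))"
    and cancel: "\<And>f p. van (smult f p) \<Longrightarrow> f = 0 \<or> van p"
  obtains R where "lead_coeff R = 1" "van R" "\<And>p. van p \<Longrightarrow> R dvd p"
proof -
  have vanD: "pev x s p = 0" if "van p" "(x, s) \<in> N" for p x s
    using that by (auto simp: van_def)
  have vanI: "van p" if "\<And>x s. (x, s) \<in> N \<Longrightarrow> pev x s p = 0" for p
    using that by (auto simp: van_def)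
  have van_add: "van (p + q)" if "van p" "van q" for p q
    by (rule vanI) (simp add: pev.hom_add vanD that)
  have van_mult: "van (p * q)" if "van p" for p q
    by (rule vanI) (simp add: pev.hom_mult vanD that)
  have van_smult: "van (smult f p)" if "van p" for f p
    by (rule vanI) (simp add: pev_smult vanD that)
  from arg_min_nat_lemma[of "\<lambda>p. van p \<and> p \<noteq> 0" p0 degree] nz
  obtain R0 where R0: "van R0" "R0 \<noteq> 0"
    and min: "\<And>q. van q \<Longrightarrow> q \<noteq> 0 \<Longrightarrow> degree R0 \<le> degree q"
    by blast
  define a where "a = lead_coeff R0"
  have "a \<noteq> 0" using R0 by (simp add: a_def)
  have root_mem: "(x, s) \<in> N" if "ev x a \<noteq> 0" "pev x s R0 = 0" for x s
  proof (rule closed)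
    fix p assume "van p"
    \<comment> \<open>The pseudo-remainder lies in the ideal and has smaller degree than R0, so it
      is 0. Hence a power of a times p is a multiple of R0, and that power can be cancelled wherever
      a does not vanish.\<close>
    obtain q r where qr: "pseudo_divmod p R0 = (q, r)" by fastforce
    from pseudo_divmod[OF R0(2) qr] obtain k
      where k: "smult (a ^ k) p = R0 * q + r" and r: "r = 0 \<or> degree r < degree R0"
      unfolding a_def by blast
    have "r = smult (a ^ k) p + R0 * - q"
      using k by simp
    then have "van r"
      using van_add[OF van_smult[OF \<open>van p\<close>] van_mult[OF R0(1)]] by metis
    then have "r = 0"
      using r min[OF \<open>van r\<close>] by (meson leD)
    then have "ev x a ^ k * pev x s p = 0"
      using k that(2) by (metis add.right_neutral ev.hom_power mult_zero_left pev.hom_mult pev_smult)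
    then show "pev x s p = 0"
      using that(1) by simp
  qed
  define B where "B = (\<lambda>x :: 'v \<Rightarrow> complex. \<Sum>v\<in>V. norm (x v))"
  have coeff_bound: "norm (ev x (coeff R0 k)) \<le> (1 + B x) ^ degree R0 * norm (ev x a)" if "ev x a \<noteq> 0" for x k
  proof -
    have lead: "coeff (map_poly (ev x) R0) (degree R0) = ev x a"
      by (simp add: coeff_map_poly a_def)
    have deg: "degree (map_poly (ev x) R0) = degree R0"
      by (rule antisym[OF ev.degree_map_poly_le le_degree]) (simp add: lead that)
    have "norm (coeff (map_poly (ev x) R0) k) \<le>
        norm (lead_coeff (map_poly (ev x) R0)) * (1 + B x) ^ degree (map_poly (ev x) R0)"
    proof (rule poly_coeff_bound_of_roots)
      fix z assume "poly (map_poly (ev x) R0) z = 0"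
      then show "norm z \<le> B x"
        using bounded[OF root_mem[OF that, of z]] by (simp add: pev_def B_def)
    qed (simp add: B_def sum_nonneg)
    then show ?thesis
      by (simp add: deg lead coeff_map_poly mult.commute)
  qed
  have "a dvd coeff R0 k" for k
  proof (rule mpoly_dvd_of_locally_bounded[OF \<open>a \<noteq> 0\<close>])
    fix x w :: "'v \<Rightarrow> complex" and \<rho> :: real
    \<comment> \<open>The root bound depends on x; along a line it is at most its linear majorant at
      parameter modulus \<rho>, which gives one constant for the whole disc.\<close>
    define C where "C = (1 + (\<Sum>v\<in>V. norm (x v) + \<rho> * norm (w v))) ^ degree R0"
    have "norm (ev (\<lambda>v. x v + \<tau> * w v) (coeff R0 k)) \<le> C * norm (ev (\<lambda>v. x v + \<tau> * w v) a)"
      if "norm \<tau> \<le> \<rho>" "ev (\<lambda>v. x v + \<tau> * w v) a \<noteq> 0" for \<tau>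
    proof -
      have "norm (x v + \<tau> * w v) \<le> norm (x v) + \<rho> * norm (w v)" for v
        using norm_triangle_ineq[of "x v" "\<tau> * w v"] mult_right_mono[OF that(1), of "norm (w v)"]
        by (simp add: norm_mult)
      then have "B (\<lambda>v. x v + \<tau> * w v) \<le> (\<Sum>v\<in>V. norm (x v) + \<rho> * norm (w v))"
        unfolding B_def by (intro sum_mono)
      moreover have "B (\<lambda>v. x v + \<tau> * w v) \<ge> 0"
        by (simp add: B_def sum_nonneg)
      ultimately have "(1 + B (\<lambda>v. x v + \<tau> * w v)) ^ degree R0 \<le> C"
        unfolding C_def by (intro power_mono) auto
      then show ?thesis
        using coeff_bound[OF that(2), of k] by (meson mult_right_mono norm_ge_zero order_trans)
    qed
    then show "\<exists>C. \<forall>\<tau>. norm \<tau> \<le> \<rho> \<longrightarrow> ev (\<lambda>v. x v + \<tau> * w v) a \<noteq> 0 \<longrightarrow>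
        norm (ev (\<lambda>v. x v + \<tau> * w v) (coeff R0 k)) \<le> C * norm (ev (\<lambda>v. x v + \<tau> * w v) a)"
      by blast
  qed
  then have "[:a:] dvd R0"
    by (simp add: const_poly_dvd_iff)
  then obtain R where "R0 = [:a:] * R" by (rule dvdE)
  then have R: "R0 = smult a R" by simp
  have lead: "lead_coeff R = 1"
    using \<open>a \<noteq> 0\<close> a_def unfolding R by (simp add: lead_coeff_smult)
  \<comment> \<open>Dividing out the leading coefficient leaves the ideal only if a itself belongs
    to the zero divisors modulo it, which \<open>cancel\<close> excludes. With R monic, division
    becomes genuine and R generates.\<close>
  have "van R"
    using cancel[of a R] R0 \<open>a \<noteq> 0\<close> R by simp
  have deg: "degree R = degree R0"
    using \<open>a \<noteq> 0\<close> R by simp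
  have "R dvd p" if "van p" for p
  proof -
    obtain q r where qr: "p = R * q + r" "r = 0 \<or> degree r < degree R"
      using monic_division[OF lead] by metis
    then have "r = p + R * - q" by simp
    then have "van r"
      using van_add[OF that van_mult[OF \<open>van R\<close>]] by metis
    then have "r = 0"
      using qr(2) min[OF \<open>van r\<close>] unfolding deg by (meson leD)
    then show ?thesis using qr by simp
  qed
  with lead \<open>van R\<close> show thesis by (rule that)
qed

subsection \<open>The resultant\<close>

lemma (in ring_morphism) hom_poly: "c (poly p a) = poly (map_poly c p) (c a)"
  by (induction p) (simp_all add: hom_add hom_mult map_poly_pCons)

lemma unit_system_not_mem:
  "unit_system n d \<notin> zero_systems n d"
proof
  assume "unit_system n d \<in> zero_systems n d"
  then obtain z :: "nat \<Rightarrow> complex" and k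
    where "k \<in> {1..n}" "z k \<noteq> 0" "form_value n d (unit_system n d) k z = 0"
    unfolding zero_systems_def by blast
  then show False
    using form_value_add_unit[of k n d "\<lambda>_. 0" 1 z] by (simp add: form_value_def)
qed

lemma zero_mem_zero_systems: "n \<ge> 1 \<Longrightarrow> (\<lambda>_. 0) \<in> zero_systems n d"
  unfolding zero_systems_def form_value_def by (auto intro!: exI[of _ "\<lambda>_. 1"] bexI[of _ 1])

text \<open>Pairs of a system and a shift are parametrized like the systems themselves: take a
  generic system, a free s, and subtract s times the unit system. The two substituted polynomials
  have product 0 in an integral domain.\<close>

lemma shifted_vanishing_cancel:
  assumes n: "n \<ge> 1"
    and zero: "\<And>x s. (\<lambda>v. x v + s * unit_system n d v) \<in> zero_systems n d \<Longrightarrow> ev x f * pev x s p = 0"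
  shows "(\<forall>x s. (\<lambda>v. x v + s * unit_system n d v) \<in> zero_systems n d \<longrightarrow> ev x f = 0) \<or>
    (\<forall>x s. (\<lambda>v. x v + s * unit_system n d v) \<in> zero_systems n d \<longrightarrow> pev x s p = 0)"
proof -
  \<comment> \<open>The shift needs a parameter of its own. The variable (1, 0) is free: the generic
    point uses only exponents \<open>Poly_Mapping.single j 1\<close> with first component 1, and the
    forms use the first components 0 and at least 2.\<close>
  let ?s = "(1, 0) :: coeff_var"
  define X :: "coeff_var \<Rightarrow> (coeff_var, complex) mpoly"
    where "X = (\<lambda>v. generic_system n d Var v - Const (unit_system n d v) * Var ?s)"
  define x where "x = (\<lambda>(y :: coeff_var \<Rightarrow> complex) v. generic_system n d y v - unit_system n d v * y ?s)"
  have X: "(\<lambda>v. ev y (X v)) = x y" for y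
    by (simp add: X_def x_def ev.hom_diff ev.hom_mult ev.hom_generic_system)
  define F where "F = eval_mpoly Const X f"
  define P where "P = poly (map_poly (eval_mpoly Const X) p) (Var ?s)"
  have F: "ev y F = ev (x y) f" for y
    by (simp add: F_def ev_eval_Const X)
  have P: "ev y P = pev (x y) (y ?s) p" for y
  proof -
    have "map_poly (ev y) (map_poly (eval_mpoly Const X) p) = map_poly (ev (x y)) p"
      by (rule poly_eqI)
        (simp add: coeff_map_poly ring_morphism.hom_zero[OF ring_morphism_eval_Const] ev_eval_Const X)
    then show ?thesis
      by (simp add: P_def ev.hom_poly pev_def)
  qed
  have "F * P = 0"
  proof (rule mpoly_eq_0I_torus)
    fix y :: "coeff_var \<Rightarrow> complex" assume "\<And>v. y v \<noteq> 0"
    then have "generic_system n d y \<in> zero_systems n d"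
      by (rule generic_system_mem[OF n])
    then have "ev (x y) f * pev (x y) (y ?s) p = 0"
      by (intro zero) (simp add: x_def mult.commute)
    then show "ev y (F * P) = 0"
      by (simp add: ev.hom_mult F P)
  qed
  have param: "\<exists>y. a = x y \<and> s = y ?s"
    if mem: "(\<lambda>v. a v + s * unit_system n d v) \<in> zero_systems n d" for a s
  proof -
    obtain y where y: "generic_system n d y = (\<lambda>v. a v + s * unit_system n d v)"
      using zero_systems_param[OF mem] .
    have "generic_system n d (y(?s := s)) = generic_system n d y"
    proof -
      have "generic_point (y(?s := s)) = generic_point y"
        by (rule ext) (auto simp: generic_point_def dest: arg_cong[of _ _ Poly_Mapping.keys])
      then have "generic_system n d (y(?s := s)) (i, t) = generic_system n d y (i, t)" for i t
        by (simp add: generic_system_def form_value_def)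
      then show ?thesis by (auto intro!: ext)
    qed
    then have "a = x (y(?s := s)) \<and> s = (y(?s := s)) ?s"
      by (simp add: x_def y fun_eq_iff)
    then show ?thesis by blast
  qed
  from \<open>F * P = 0\<close> consider "F = 0" | "P = 0" by auto
  then show ?thesis
  proof cases
    case 1
    then have "ev (x y) f = 0" for y
      using F[of y] by simp
    then show ?thesis using param by metis
  next
    case 2
    then have "pev (x y) (y ?s) p = 0" for y
      using P[of y] by simp
    then show ?thesis using param by metis
  qed
qed

text \<open>A polynomial f vanishes at the systems with a nontrivial zero if and only if f(x + s E),
  with E the unit system, vanishes at all pairs (x, s) of N. The ideal of N has a monic generator in
  s; putting s = 0 in the resulting divisibilities returns to the original ideal.\<close>

theorem vanishing_principal:
  assumes n: "n \<ge> 1" and d: "d \<ge> 1"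
  obtains R where "\<And>f. vanishing n d f \<Longrightarrow> R dvd f" "\<And>x. ev x R = 0 \<longleftrightarrow> x \<in> zero_systems n d"
proof -
  let ?E = "unit_system n d :: coeff_var \<Rightarrow> complex"
  define N where "N = {(x, s). (\<lambda>v. x v + s * ?E v) \<in> zero_systems n d}"
  have van: "(\<forall>(x, s)\<in>N. pev x s p = 0) \<longleftrightarrow>
      (\<forall>x s. (\<lambda>v. x v + s * ?E v) \<in> zero_systems n d \<longrightarrow> pev x s p = 0)" for p
    by (auto simp: N_def)
  have pev_along: "pev x s (along ?E f) = ev (\<lambda>v. x v + s * ?E v) f" for x s f
    by (simp add: pev_def poly_map_poly_along)
  have van_along: "\<forall>(x, s)\<in>N. pev x s (along ?E f) = 0" if "vanishing n d f" for f
    using that by (auto simp: pev_along vanishing_def N_def)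
  have closed: "(x, s) \<in> N" if "\<And>p. \<forall>(x, s)\<in>N. pev x s p = 0 \<Longrightarrow> pev x s p = 0" for x s
    unfolding N_def mem_Collect_eq split_conv
  proof (rule zero_systems_closed[OF n])
    fix f assume "vanishing n d f"
    then show "ev (\<lambda>v. x v + s * ?E v) f = 0"
      using that[OF van_along] by (simp add: pev_along)
  qed
  \<comment> \<open>Closedness applied to the unit system, which has only the trivial zero, yields a
    vanishing polynomial that is nonzero there. Its expansion is a nonzero element of the ideal of
    N.\<close>
  obtain f0 where f0: "vanishing n d f0" "ev ?E f0 \<noteq> 0"
    using zero_systems_closed[OF n] unit_system_not_mem by blast
  have nz: "along ?E f0 \<noteq> 0"
    using f0(2) poly_along_0[of ?E f0] by force
  have const: "f = 0" if "\<forall>(x, s)\<in>N. pev x s [:f:] = 0" for f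
    by (rule shifted_zero_systems_dense[OF n d]) (use that in \<open>auto simp: N_def\<close>)
  have bounded: "norm s \<le> (\<Sum>v\<in>{1..n} \<times> monomials n d. norm (x v))" if "(x, s) \<in> N" for x s
    using that zero_systems_shift_bound by (simp add: N_def)
  have cancel: "f = 0 \<or> (\<forall>(x, s)\<in>N. pev x s p = 0)"
    if "\<forall>(x, s)\<in>N. pev x s (smult f p) = 0" for f p
  proof -
    have "(\<forall>x s. (\<lambda>v. x v + s * ?E v) \<in> zero_systems n d \<longrightarrow> ev x f = 0) \<or>
        (\<forall>x s. (\<lambda>v. x v + s * ?E v) \<in> zero_systems n d \<longrightarrow> pev x s p = 0)"
      by (rule shifted_vanishing_cancel[OF n]) (use that[unfolded van] in \<open>simp add: pev_smult\<close>)
    then show ?thesis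
    proof
      assume "\<forall>x s. (\<lambda>v. x v + s * ?E v) \<in> zero_systems n d \<longrightarrow> ev x f = 0"
      then have "\<forall>x s. (\<lambda>v. x v + s * ?E v) \<in> zero_systems n d \<longrightarrow> pev x s [:f:] = 0"
        by simp
      then have "\<forall>(x, s)\<in>N. pev x s [:f:] = 0"
        by (rule van[THEN iffD2])
      then show ?thesis
        using const by blast
    next
      assume "\<forall>x s. (\<lambda>v. x v + s * ?E v) \<in> zero_systems n d \<longrightarrow> pev x s p = 0"
      then show ?thesis
        by (intro disjI2 van[THEN iffD2])
    qed
  qed
  obtain R where R: "\<forall>(x, s)\<in>N. pev x s R = 0"
    "\<And>p. \<forall>(x, s)\<in>N. pev x s p = 0 \<Longrightarrow> R dvd p"
  proof (rule monic_generator[OF nz van_along[OF f0(1)] closed const bounded cancel])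
    fix R
    assume "\<forall>(x, s)\<in>N. pev x s R = 0" "\<And>p. \<forall>(x, s)\<in>N. pev x s p = 0 \<Longrightarrow> R dvd p"
    then show thesis by (rule that)
  qed
  have pev0: "pev x 0 p = ev x (poly p 0)" for x p
    by (simp add: pev_def ev.hom_poly)
  show thesis
  proof (rule that[of "poly R 0"])
    fix f assume "vanishing n d f"
    then have "R dvd along ?E f"
      by (intro R(2) van_along)
    then obtain q where "along ?E f = R * q" by (rule dvdE)
    then have "poly (along ?E f) 0 = poly R 0 * poly q 0" by simp
    then show "poly R 0 dvd f"
      by (simp add: poly_along_0)
  next
    fix x
    have "ev x (poly R 0) = 0 \<longleftrightarrow> (x, 0) \<in> N"
    proof
      assume "ev x (poly R 0) = 0"
      then have "pev x 0 R = 0" by (simp add: pev0)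
      show "(x, 0) \<in> N"
      proof (rule closed)
        fix p assume "\<forall>(x, s)\<in>N. pev x s p = 0"
        then have "R dvd p" by (rule R(2))
        then obtain q where "p = R * q" by (rule dvdE)
        then show "pev x 0 p = 0"
          using \<open>pev x 0 R = 0\<close> by (simp add: pev.hom_mult)
      qed
    next
      assume "(x, 0) \<in> N"
      then show "ev x (poly R 0) = 0"
        using bspec[OF R(1), of "(x, 0)"] by (simp add: pev0)
    qed
    then show "ev x (poly R 0) = 0 \<longleftrightarrow> x \<in> zero_systems n d"
      by (simp add: N_def)
  qed
qed

section \<open>Coefficient vectors and systems of forms\<close>

lemma zero_systems_cong:
  assumes "\<And>v. v \<in> {1..n} \<times> monomials n d \<Longrightarrow> x v = y v"
  shows "x \<in> zero_systems n d \<longleftrightarrow> y \<in> zero_systems n d"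
proof -
  have "form_value n d x i z = form_value n d y i z" if "i \<in> {1..n}" for i z
    unfolding form_value_def by (rule sum.cong) (use assms that in auto)
  then show ?thesis by (simp add: zero_systems_def)
qed

text \<open>Deleting all monomials with a variable outside V has the same effect on values as
  setting these variables to 0, and values determine a polynomial.\<close>

lemma mpoly_keys_subset:
  fixes f :: "('v, complex) mpoly"
  assumes "\<And>x. ev (\<lambda>v. if v \<in> V then x v else 0) f = ev x f"
  shows "(\<Union>t\<in>Poly_Mapping.keys f. Poly_Mapping.keys t) \<subseteq> V"
proof -
  define g where "g = (\<Sum>t\<in>{t \<in> Poly_Mapping.keys f. Poly_Mapping.keys t \<subseteq> V}.
    Poly_Mapping.single t (Poly_Mapping.lookup f t))"
  have mono: "mono_eval (\<lambda>v. if v \<in> V then x v else 0) t =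
      (if Poly_Mapping.keys t \<subseteq> V then mono_eval x t else 0)" for x :: "'v \<Rightarrow> complex" and t
  proof (cases "Poly_Mapping.keys t \<subseteq> V")
    case True
    then show ?thesis by (auto intro!: mono_eval_cong)
  next
    case False
    then show ?thesis by (auto simp: mono_eval_def in_keys_iff intro!: bexI)
  qed
  have "f = g"
  proof (rule mpoly_eqI)
    fix x
    have "ev x f = ev (\<lambda>v. if v \<in> V then x v else 0) f"
      by (simp add: assms)
    also have "\<dots> = ev x g"
      unfolding eval_mpoly_mono_eval[of _ _ f] mono g_def ev.hom_sum ev_single
      by (rule sum.mono_neutral_cong_right) auto
    finally show "ev x f = ev x g" .
  qed
  moreover have "Poly_Mapping.keys g \<subseteq> {t. Poly_Mapping.keys t \<subseteq> V}"
    unfolding g_def by (rule order_trans[OF keys_sum]) (auto split: if_splits)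
  ultimately show ?thesis by auto
qed

lemma ev_cong:
  assumes "\<And>v. v \<in> (\<Union>t\<in>Poly_Mapping.keys f. Poly_Mapping.keys t) \<Longrightarrow> x v = y v"
  shows "ev x f = ev y f"
  unfolding eval_mpoly_mono_eval
  by (rule sum.cong[OF refl]) (use assms in \<open>auto intro!: mono_eval_cong\<close>)

definition coeffs_of :: "(nat \<Rightarrow> (nat, 'a::zero) mpoly) \<Rightarrow> coeff_var \<Rightarrow> 'a" where
  "coeffs_of F = (\<lambda>(i, t). Poly_Mapping.lookup (F i) t)"

lemma subst_coeffs_coeffs_of: "subst_coeffs c R F = eval_mpoly c (coeffs_of F) R"
  by (simp add: subst_coeffs_def coeffs_of_def)

lemma eval_form:
  assumes "F i \<in> forms n d"
  shows "eval_mpoly id z (F i) = form_value n d (coeffs_of F) i z"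
  unfolding form_value_def coeffs_of_def using assms
  by (subst ring_morphism.eval_mpoly_superset[OF ring_morphism_id finite_monomials[of n d]])
    (auto simp: forms_def)

lemma nontrivial_common_zero_iff:
  assumes "\<And>i. i \<in> {1..n} \<Longrightarrow> F i \<in> forms n d"
  shows "nontrivial_common_zero n F \<longleftrightarrow> coeffs_of F \<in> zero_systems n d"
proof -
  have "eval_mpoly id z (F i) = form_value n d (coeffs_of F) i z" if "i \<in> {1..n}" for i z
    by (rule eval_form) (rule assms[OF that])
  then show ?thesis
    unfolding nontrivial_common_zero_def zero_systems_def mem_Collect_eq
    by (simp only: cong: ball_cong)
qed

text \<open>Passes from systems of forms to arbitrary coefficient vectors. Such a vector may have
  entries at positions that belong to no form; the condition on the variables makes R insensitive to
  them.\<close>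

lemma is_resultant_iff:
  "is_resultant n d R \<longleftrightarrow>
     (\<Union>t\<in>Poly_Mapping.keys R. Poly_Mapping.keys t) \<subseteq> {1..n} \<times> monomials n d \<and>
     irreducible R \<and> (\<forall>x. ev x R = 0 \<longleftrightarrow> x \<in> zero_systems n d) \<and> ev (unit_system n d) R = 1"
  (is "_ \<longleftrightarrow> ?rhs")
proof (cases "(\<Union>t\<in>Poly_Mapping.keys R. Poly_Mapping.keys t) \<subseteq> {1..n} \<times> monomials n d")
  case vars: True
  have cong: "ev x R = ev y R" if "\<And>v. v \<in> {1..n} \<times> monomials n d \<Longrightarrow> x v = y v" for x y
    by (rule ev_cong) (use vars that in blast)
  have "(\<forall>F. (\<forall>i\<in>{1..n}. F i \<in> forms n d) \<longrightarrow>
      (subst_coeffs id R F = 0 \<longleftrightarrow> nontrivial_common_zero n F)) \<longleftrightarrow>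
    (\<forall>x. ev x R = 0 \<longleftrightarrow> x \<in> zero_systems n d)"
  proof (rule iffI; intro allI impI)
    fix x :: "coeff_var \<Rightarrow> complex" assume R: "\<forall>F. (\<forall>i\<in>{1..n}. F i \<in> forms n d) \<longrightarrow>
      (subst_coeffs id R F = 0 \<longleftrightarrow> nontrivial_common_zero n F)"
    define F where "F = (\<lambda>i :: nat. \<Sum>t\<in>monomials n d. Poly_Mapping.single t (x (i, t)))"
    have F: "F i \<in> forms n d" for i
      unfolding F_def forms_def mem_Collect_eq by (rule order_trans[OF keys_sum]) auto
    have x: "coeffs_of F v = x v" if "v \<in> {1..n} \<times> monomials n d" for v
      using that by (auto simp: coeffs_of_def F_def lookup_sum lookup_single when_def sum.delta)
    show "ev x R = 0 \<longleftrightarrow> x \<in> zero_systems n d"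
    proof -
      have "ev (coeffs_of F) R = ev x R"
        by (rule cong) (rule x)
      moreover have "coeffs_of F \<in> zero_systems n d \<longleftrightarrow> x \<in> zero_systems n d"
        by (rule zero_systems_cong) (rule x)
      moreover have "subst_coeffs id R F = 0 \<longleftrightarrow> nontrivial_common_zero n F"
        by (rule R[rule_format]) (rule F)
      ultimately show ?thesis
        using nontrivial_common_zero_iff[where F = F and n = n and d = d] F by (simp add: subst_coeffs_coeffs_of)
    qed
  next
    fix F :: "nat \<Rightarrow> (nat, complex) mpoly"
    assume "\<forall>x. ev x R = 0 \<longleftrightarrow> x \<in> zero_systems n d" "\<forall>i\<in>{1..n}. F i \<in> forms n d"
    then show "subst_coeffs id R F = 0 \<longleftrightarrow> nontrivial_common_zero n F"
      by (subst nontrivial_common_zero_iff) (simp_all add: subst_coeffs_coeffs_of)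
  qed
  moreover have "subst_coeffs id R (\<lambda>i. Poly_Mapping.single (Poly_Mapping.single i d) 1) = ev (unit_system n d) R"
    unfolding subst_coeffs_coeffs_of
    by (rule cong) (auto simp: coeffs_of_def unit_system_def lookup_single when_def)
  ultimately show ?thesis
    by (simp add: is_resultant_def)
qed (simp add: is_resultant_def)

text \<open>The generator of the vanishing ideal, normalized at the unit system, is the resultant. A
  factorization of it has a factor in the prime ideal, which the generator divides in turn, so the
  other factor is a unit.\<close>

theorem resultant_mpoly:
  assumes n: "n \<ge> 1" and d: "d \<ge> 1"
  shows ev_resultant_mpoly_eq_0_iff: "ev x (resultant_mpoly n d) = 0 \<longleftrightarrow> x \<in> zero_systems n d"
    and resultant_mpoly_dvd: "vanishing n d f \<Longrightarrow> resultant_mpoly n d dvd f"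
    and is_resultant_resultant_mpoly: "is_resultant n d (resultant_mpoly n d)"
proof -
  let ?E = "unit_system n d :: coeff_var \<Rightarrow> complex"
  let ?V = "{1..n} \<times> monomials n d"
  obtain R0 where R0: "\<And>f. vanishing n d f \<Longrightarrow> R0 dvd f"
    "\<And>x. ev x R0 = 0 \<longleftrightarrow> x \<in> zero_systems n d"
    using vanishing_principal[OF n d] by metis
  define u where "u = ev ?E R0"
  have u: "u \<noteq> 0"
    by (simp add: u_def R0 unit_system_not_mem)
  define R where "R = Const (inverse u) * R0"
  have ev_R: "ev x R = inverse u * ev x R0" for x
    by (simp add: R_def ev.hom_mult)
  have zero: "ev x R = 0 \<longleftrightarrow> x \<in> zero_systems n d" for x
    using u by (simp add: ev_R R0)
  have "R0 = Const u * R"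
    using u by (simp add: R_def mult_single flip: mult.assoc)
  have dvd: "R dvd f" if "vanishing n d f" for f
  proof -
    have "R0 dvd f" by (rule R0(1)) (rule that)
    then obtain g where "f = R0 * g" by (rule dvdE)
    then have "f = R * (Const u * g)"
      using \<open>R0 = Const u * R\<close> by (simp add: mult_ac)
    then show ?thesis by simp
  qed
  have unit: "ev ?E R = 1"
    using u by (simp add: ev_R flip: u_def)
  have vanishing_R: "vanishing n d R"
    by (simp add: vanishing_def zero)
  have not_unit: "\<not> R dvd 1"
  proof
    assume "R dvd 1"
    then obtain z where "z \<noteq> 0" "R = Const z"
      using mpoly_unit_const by (metis dvdE)
    then show False
      using zero[of "\<lambda>_. 0"] zero_mem_zero_systems[OF n] by simp
  qed
  have "R \<noteq> 0" using unit by auto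
  have "irreducible R"
  proof (rule irreducibleI)
    fix a b assume R: "R = a * b"
    then have "vanishing n d a \<or> vanishing n d b"
      using vanishing_prime[OF n, of d a b] vanishing_R by metis
    then have "R dvd a \<or> R dvd b"
      using dvd by blast
    then show "a dvd 1 \<or> b dvd 1"
    proof
      assume "R dvd a"
      then obtain q where q: "a = R * q" by (rule dvdE)
      have "R * 1 = (R * q) * b"
        unfolding q[symmetric] R[symmetric] by simp
      then have "1 = q * b"
        using \<open>R \<noteq> 0\<close> mult_left_cancel by (metis mult.assoc)
      then show ?thesis by (metis dvd_triv_right)
    next
      assume "R dvd b"
      then obtain q where q: "b = R * q" by (rule dvdE)
      have "R * 1 = a * (R * q)"
        unfolding q[symmetric] R[symmetric] by simp
      then have "1 = a * q"
        using \<open>R \<noteq> 0\<close> mult_left_cancel by (metis mult.left_commute)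
      then show ?thesis by (metis dvd_triv_left)
    qed
  qed (use \<open>R \<noteq> 0\<close> not_unit in auto)
  moreover have "(\<Union>t\<in>Poly_Mapping.keys R. Poly_Mapping.keys t) \<subseteq> ?V"
  proof (rule mpoly_keys_subset)
    fix x :: "coeff_var \<Rightarrow> complex"
    let ?y = "\<lambda>v. if v \<in> ?V then x v else 0"
    \<comment> \<open>Changing coordinates at positions outside the forms does not affect
      membership. So on the line from x to its truncation R vanishes everywhere or nowhere, and in
      the latter case it is constant there.\<close>
    have line: "(\<lambda>v. x v + \<tau> * (?y v - x v)) \<in> zero_systems n d \<longleftrightarrow> x \<in> zero_systems n d" for \<tau>
      by (rule zero_systems_cong) simp
    obtain h where h: "\<And>\<tau>. poly h \<tau> = ev (\<lambda>v. x v + \<tau> * (?y v - x v)) R"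
      using ev_line[of x "\<lambda>v. ?y v - x v" R] by blast
    show "ev ?y R = ev x R"
    proof (cases "x \<in> zero_systems n d")
      case True
      then have "ev ?y R = 0"
        using line[of 1] by (intro zero[THEN iffD2]) simp
      moreover have "ev x R = 0"
        using True by (rule zero[THEN iffD2])
      ultimately show ?thesis by (rule trans[OF _ sym])
    next
      case False
      then have "poly h \<tau> \<noteq> 0" for \<tau>
        unfolding h zero line .
      then have "poly h 0 = poly h 1"
        by (rule nonvanishing_poly_const)
      then show ?thesis by (simp add: h)
    qed
  qed
  ultimately have is_res: "is_resultant n d R"
    by (simp add: is_resultant_iff zero unit)
  \<comment> \<open>S lies in the ideal, so it is a multiple of R. As S is irreducible and R is no
    unit, the quotient is a constant, which the normalization at the unit system fixes to 1.\<close>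
  have "S = R" if "is_resultant n d S" for S
  proof -
    have S: "irreducible S" "\<And>x. ev x S = 0 \<longleftrightarrow> x \<in> zero_systems n d" "ev ?E S = 1"
      using that by (auto simp: is_resultant_iff)
    then have "R dvd S" by (intro dvd) (simp add: vanishing_def)
    then obtain q where q: "S = R * q" by (rule dvdE)
    then have "q dvd 1"
      using S(1) not_unit irreducibleD by blast
    then obtain z where z: "q = Const z"
      using mpoly_unit_const by (metis dvdE)
    have "z = 1"
      using S(3) unit by (simp add: q z ev.hom_mult)
    then show "S = R" by (simp add: q z)
  qed
  then have "resultant_mpoly n d = R"
    unfolding resultant_mpoly_def using is_res by (rule the_equality[rotated])
  then show "ev x (resultant_mpoly n d) = 0 \<longleftrightarrow> x \<in> zero_systems n d"
    "vanishing n d f \<Longrightarrow> resultant_mpoly n d dvd f"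
    "is_resultant n d (resultant_mpoly n d)"
    by (simp_all add: zero dvd is_res)
qed

lemma resultant_mpoly_neq_0:
  assumes "n \<ge> 1" "d \<ge> 1"
  shows "resultant_mpoly n d \<noteq> 0"
proof
  assume "resultant_mpoly n d = 0"
  then show False
    using ev_resultant_mpoly_eq_0_iff[OF assms, of "unit_system n d"] unit_system_not_mem by simp
qed

text \<open>Rescaling the coefficients maps the generator of a principal ideal to a generator.\<close>

theorem ev_resultant_mpoly_scale:
  assumes n: "n \<ge> 1" and d: "d \<ge> 1" and s: "\<And>v. s v \<noteq> 0"
    and invariant: "\<And>x. (\<lambda>v. s v * x v) \<in> zero_systems n d \<longleftrightarrow> x \<in> zero_systems n d"
  obtains c where "c \<noteq> 0" "\<And>x. ev (\<lambda>v. s v * x v) (resultant_mpoly n d) = c * ev x (resultant_mpoly n d)"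
proof -
  let ?R = "resultant_mpoly n d"
  define scale where "scale = (\<lambda>s. eval_mpoly Const (\<lambda>v. Const (s v) * Var v :: (coeff_var, complex) mpoly))"
  have ev_scale: "ev x (scale s f) = ev (\<lambda>v. s v * x v) f" for x s f
    by (simp add: scale_def ev_eval_Const ev.hom_mult)
  let ?r = "\<lambda>v. inverse (s v)"
  have cancel [simp]: "s v * (inverse (s v) * z) = z" "inverse (s v) * (s v * z) = z" for v z
    using s[of v] by simp_all
  have invariant': "(\<lambda>v. ?r v * x v) \<in> zero_systems n d \<longleftrightarrow> x \<in> zero_systems n d" for x
    using invariant[of "\<lambda>v. ?r v * x v"] by simp
  have "vanishing n d (scale s ?R)" "vanishing n d (scale ?r ?R)"
    by (simp_all add: vanishing_def ev_scale ev_resultant_mpoly_eq_0_iff[OF n d] invariant invariant')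
  then obtain q q' where q: "scale s ?R = ?R * q" and q': "scale ?r ?R = ?R * q'"
    using resultant_mpoly_dvd[OF n d] by (metis dvdE)
  have ev_q: "ev (\<lambda>v. s v * x v) ?R = ev x ?R * ev x q" for x
    using arg_cong[OF q, of "ev x"] by (simp add: ev_scale ev.hom_mult)
  have ev_q': "ev (\<lambda>v. ?r v * x v) ?R = ev x ?R * ev x q'" for x
    using arg_cong[OF q', of "ev x"] by (simp add: ev_scale ev.hom_mult)
  \<comment> \<open>Rescaling forth and back expresses R as R times the product of the two
    quotients, one of them rescaled. So this product is 1, and q is a unit up to rescaling, hence
    constant.\<close>
  have "?R * 1 = ?R * (scale ?r q * q')"
  proof (rule mpoly_eqI)
    fix x
    have "ev x ?R = ev x ?R * ev x q' * ev (\<lambda>v. ?r v * x v) q"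
      using ev_q[of "\<lambda>v. ?r v * x v"] unfolding ev_q' by simp
    then show "ev x (?R * 1) = ev x (?R * (scale ?r q * q'))"
      by (simp add: ev.hom_mult ev_scale mult_ac)
  qed
  then have "scale ?r q * q' = 1"
    using resultant_mpoly_neq_0[OF n d] mult_left_cancel by metis
  then obtain z where z: "z \<noteq> 0" "scale ?r q = Const z"
    by (rule mpoly_unit_const)
  have "ev x q = z" for x
    using ev_scale[of "\<lambda>v. s v * x v" ?r q] by (simp add: z)
  then show thesis
    using that[OF z(1)] ev_q by (simp add: mult.commute)
qed

subsection \<open>The characteristic polynomial of a tensor\<close>

lemma finite_tensor_indices [simp]: "finite (tensor_indices n m)"
  by (simp add: tensor_indices_def finite_lists_length_eq)

lemma Cons_in_tensor_indices:
  "j # js \<in> tensor_indices n m \<longleftrightarrow> j \<in> {1..n} \<and> js \<in> tensor_indices n (m - 1) \<and> m \<noteq> 0"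
  by (auto simp: tensor_indices_def)

definition list_monomial :: "nat list \<Rightarrow> nat \<Rightarrow>\<^sub>0 nat" where
  "list_monomial js = (\<Sum>j\<leftarrow>js. Poly_Mapping.single j 1)"

lemma mono_eval_list_monomial: "mono_eval z (list_monomial js) = (\<Prod>j\<leftarrow>js. z j)"
  by (induction js) (simp_all add: list_monomial_def mono_eval_add)

lemma monomials_iff_sum:
  assumes "Poly_Mapping.keys t \<subseteq> {1..n}"
  shows "t \<in> monomials n d \<longleftrightarrow> (\<Sum>v\<in>{1..n}. Poly_Mapping.lookup t v) = d"
proof -
  have "(\<Sum>v\<in>Poly_Mapping.keys t. Poly_Mapping.lookup t v) = (\<Sum>v\<in>{1..n}. Poly_Mapping.lookup t v)"
    by (rule sum.mono_neutral_left) (use assms in \<open>auto simp: in_keys_iff\<close>)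
  then show ?thesis
    using assms by (simp add: monomials_def)
qed

lemma list_monomial_in_monomials:
  assumes "js \<in> tensor_indices n d"
  shows "list_monomial js \<in> monomials n d"
proof -
  have keys: "Poly_Mapping.keys (list_monomial js) \<subseteq> set js"
  proof (induction js)
    case (Cons j js)
    have "Poly_Mapping.keys (list_monomial (j # js)) \<subseteq>
        Poly_Mapping.keys (Poly_Mapping.single j (1::nat)) \<union> Poly_Mapping.keys (list_monomial js)"
      unfolding list_monomial_def list.map sum_list.Cons by (rule keys_add)
    then show ?case using Cons by auto
  qed (simp add: list_monomial_def)
  have "set js \<subseteq> {1..n} \<Longrightarrow> (\<Sum>v\<in>{1..n}. Poly_Mapping.lookup (list_monomial js) v) = length js"
  proof (induction js)
    case (Cons j js)
    have "(\<Sum>v\<in>{1..n}. Poly_Mapping.lookup (Poly_Mapping.single j (1::nat)) v) = 1"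
      using Cons.prems by (simp add: lookup_single when_def sum.delta)
    then show ?case
      using Cons by (simp add: list_monomial_def lookup_add sum.distrib)
  qed (simp add: list_monomial_def)
  then show ?thesis
    using keys assms by (subst monomials_iff_sum) (auto simp: tensor_indices_def)
qed

definition tensor_apply :: "nat \<Rightarrow> nat \<Rightarrow> (nat list \<Rightarrow> 'a::comm_semiring_1) \<Rightarrow> (nat \<Rightarrow> 'a) \<Rightarrow> nat \<Rightarrow> 'a" where
  "tensor_apply n m B z i = (\<Sum>js\<in>tensor_indices n (m - 1). B (i # js) * (\<Prod>j\<leftarrow>js. z j))"

definition tensor_coeffs :: "nat \<Rightarrow> nat \<Rightarrow> (nat list \<Rightarrow> 'a::comm_monoid_add) \<Rightarrow> coeff_var \<Rightarrow> 'a" where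
  "tensor_coeffs n m B = coeffs_of (tensor_form n m B)"

lemma tensor_coeffs_eq:
  "tensor_coeffs n m B (i, t) = (\<Sum>js\<in>tensor_indices n (m - 1). B (i # js) when list_monomial js = t)"
  by (simp add: tensor_coeffs_def coeffs_of_def tensor_form_def lookup_sum lookup_single list_monomial_def)

lemma form_value_tensor_coeffs:
  "form_value n (m - 1) (tensor_coeffs n m B) i z = tensor_apply n m B z i"
proof -
  have "form_value n (m - 1) (tensor_coeffs n m B) i z =
      (\<Sum>js\<in>tensor_indices n (m - 1). \<Sum>t\<in>monomials n (m - 1).
        (B (i # js) when list_monomial js = t) * mono_eval z t)"
    unfolding form_value_def tensor_coeffs_eq sum_distrib_right by (rule sum.swap)
  also have "\<dots> = tensor_apply n m B z i"
    unfolding tensor_apply_def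
  proof (rule sum.cong[OF refl])
    fix js assume "js \<in> tensor_indices n (m - 1)"
    then have "list_monomial js \<in> monomials n (m - 1)"
      by (rule list_monomial_in_monomials)
    moreover have "(\<Sum>t\<in>monomials n (m - 1). (B (i # js) when list_monomial js = t) * mono_eval z t) =
        (\<Sum>t\<in>monomials n (m - 1). if list_monomial js = t then B (i # js) * mono_eval z t else 0)"
      by (rule sum.cong) auto
    ultimately show "(\<Sum>t\<in>monomials n (m - 1). (B (i # js) when list_monomial js = t) * mono_eval z t) =
        B (i # js) * (\<Prod>j\<leftarrow>js. z j)"
      by (simp add: mono_eval_list_monomial)
  qed
  finally show ?thesis .
qed

lemma identity_tensor_Cons:
  assumes "js \<in> tensor_indices n k"
  shows "identity_tensor (i # js) = (if js = replicate k i then 1 else 0)"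
proof -
  have "(\<forall>a\<in>set (i # js). \<forall>b\<in>set (i # js). a = b) \<longleftrightarrow> js = replicate k i"
  proof
    assume "\<forall>a\<in>set (i # js). \<forall>b\<in>set (i # js). a = b"
    then show "js = replicate k i"
      using assms by (intro replicate_eqI) (auto simp: tensor_indices_def)
  qed auto
  then show ?thesis by (simp add: identity_tensor_def)
qed

lemma tensor_apply_characteristic:
  fixes \<mu> :: "'a::comm_ring_1"
  assumes "i \<in> {1..n}"
  shows "tensor_apply n m (\<lambda>js. \<mu> * identity_tensor js - A js) z i =
    \<mu> * z i ^ (m - 1) - tensor_apply n m A z i"
proof -
  have "tensor_apply n m (\<lambda>js. \<mu> * identity_tensor js - A js) z i =
      (\<Sum>js\<in>tensor_indices n (m - 1). if js = replicate (m - 1) i then \<mu> * (\<Prod>j\<leftarrow>js. z j) else 0) -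
      tensor_apply n m A z i"
    unfolding tensor_apply_def sum_subtractf[symmetric]
    by (rule sum.cong[OF refl]) (auto simp: identity_tensor_Cons algebra_simps)
  moreover have "replicate (m - 1) i \<in> tensor_indices n (m - 1)"
    using assms by (auto simp: tensor_indices_def)
  ultimately show ?thesis
    by (simp add: prod_list_replicate map_replicate)
qed

definition characteristic_coeffs :: "nat \<Rightarrow> nat \<Rightarrow> (nat list \<Rightarrow> complex) \<Rightarrow> complex \<Rightarrow> coeff_var \<Rightarrow> complex" where
  "characteristic_coeffs n m A \<mu> = tensor_coeffs n m (\<lambda>js. \<mu> * identity_tensor js - A js)"

text \<open>Evaluation at \<mu> is a ring homomorphism and so commutes with substitution into the
  resultant. This moves questions from coefficients in \<complex>[\<lambda>] to complex
  systems.\<close>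

lemma poly_tensor_charpoly:
  "poly (tensor_charpoly n m A) \<mu> = ev (characteristic_coeffs n m A \<mu>) (resultant_mpoly n (m - 1))"
proof -
  let ?B = "\<lambda>js. [:0, 1:] * identity_tensor js - [:A js:]"
  have "poly (tensor_charpoly n m A) \<mu> =
      eval_mpoly (\<lambda>z. poly [:z:] \<mu>) (\<lambda>v. poly (tensor_coeffs n m ?B v) \<mu>) (resultant_mpoly n (m - 1))"
    unfolding tensor_charpoly_def tensor_det_def subst_coeffs_coeffs_of tensor_coeffs_def
    by (rule eval_mpoly_comp[OF ring_morphism_poly])
  moreover have "poly (tensor_coeffs n m ?B v) \<mu> = characteristic_coeffs n m A \<mu> v" for v
    by (cases v) (auto simp: tensor_coeffs_eq characteristic_coeffs_def poly_sum when_def identity_tensor_def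
        intro!: sum.cong)
  ultimately show ?thesis
    by (simp add: id_def)
qed

lemma poly_tensor_charpoly_eq_0_iff:
  assumes "m \<ge> 2" "n \<ge> 1"
  shows "poly (tensor_charpoly n m A) \<mu> = 0 \<longleftrightarrow>
    (\<exists>z. (\<exists>i\<in>{1..n}. z i \<noteq> 0) \<and> (\<forall>i\<in>{1..n}. tensor_apply n m A z i = \<mu> * z i ^ (m - 1)))"
proof -
  have "poly (tensor_charpoly n m A) \<mu> = 0 \<longleftrightarrow> characteristic_coeffs n m A \<mu> \<in> zero_systems n (m - 1)"
    unfolding poly_tensor_charpoly using assms by (intro ev_resultant_mpoly_eq_0_iff) auto
  moreover have "form_value n (m - 1) (characteristic_coeffs n m A \<mu>) i z = 0 \<longleftrightarrow>
      tensor_apply n m A z i = \<mu> * z i ^ (m - 1)" if "i \<in> {1..n}" for i z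
    unfolding characteristic_coeffs_def form_value_tensor_coeffs tensor_apply_characteristic[OF that]
    by auto
  ultimately show ?thesis
    unfolding zero_systems_def mem_Collect_eq by (simp only: cong: ball_cong)
qed

text \<open>The characteristic system at \<mu> is the shift of the negated tensor by \<mu> times the
  unit system, so eigenvalues obey the shift bound b, and b + 1 is not a root.\<close>

lemma tensor_charpoly_neq_0:
  assumes "m \<ge> 2" "n \<ge> 1"
  shows "tensor_charpoly n m A \<noteq> 0"
proof
  assume zero: "tensor_charpoly n m A = 0"
  define x where "x = (\<lambda>v. - tensor_coeffs n m A v)"
  define b where "b = (\<Sum>v\<in>{1..n} \<times> monomials n (m - 1). norm (x v))"
  have "poly (tensor_charpoly n m A) (complex_of_real (b + 1)) = 0"
    by (simp add: zero)
  then obtain z where z: "\<exists>i\<in>{1..n}. z i \<noteq> 0"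
    "\<forall>i\<in>{1..n}. tensor_apply n m A z i = complex_of_real (b + 1) * z i ^ (m - 1)"
    unfolding poly_tensor_charpoly_eq_0_iff[OF assms] by blast
  have "form_value n (m - 1) x i z = - tensor_apply n m A z i" for i
    by (simp add: form_value_def x_def sum_negf flip: form_value_tensor_coeffs)
  then have "(\<lambda>v. x v + complex_of_real (b + 1) * unit_system n (m - 1) v) \<in> zero_systems n (m - 1)"
    unfolding zero_systems_def mem_Collect_eq
    using z(2) by (intro exI[of _ z] conjI z(1) ballI) (simp add: form_value_add_unit)
  then have "norm (complex_of_real (b + 1)) \<le> b"
    unfolding b_def by (rule zero_systems_shift_bound)
  then show False
    using norm_ge_zero[of "complex_of_real (b + 1)"] by (simp only: norm_of_real)
qed

section \<open>Multiplicities under rotation of the spectrum\<close>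

lemma order_pcompose_scale:
  fixes p :: "'a::field poly"
  assumes "p \<noteq> 0" "c \<noteq> 0"
  shows "order x (p \<circ>\<^sub>p [:0, c:]) = order (c * x) p"
proof -
  obtain q where q: "p = [:- (c * x), 1:] ^ order (c * x) p * q" "\<not> [:- (c * x), 1:] dvd q"
    using order_decomp[OF assms(1), of "c * x"] by blast
  have pow: "f ^ k \<circ>\<^sub>p g = (f \<circ>\<^sub>p g) ^ k" for f g :: "'a poly" and k
    by (induction k) (simp_all add: pcompose_mult pcompose_1)
  have linear: "[:- (c * x), 1:] \<circ>\<^sub>p [:0, c:] = smult c [:- x, 1:]"
    by (simp add: pcompose_pCons)
  have eq: "p \<circ>\<^sub>p [:0, c:] =
      smult (c ^ order (c * x) p) ([:- x, 1:] ^ order (c * x) p) * (q \<circ>\<^sub>p [:0, c:])"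
    by (subst q(1)) (simp only: pcompose_mult pow linear smult_power)
  have nz: "poly (q \<circ>\<^sub>p [:0, c:]) x \<noteq> 0"
    using q(2) by (simp add: poly_pcompose poly_eq_0_iff_dvd mult.commute)
  then have "q \<circ>\<^sub>p [:0, c:] \<noteq> 0" by force
  then show ?thesis
    unfolding eq using assms(2) nz
    by (subst order_mult) (simp_all add: order_smult order_power_n_n order_0I)
qed

lemma proots_scale_invariant:
  fixes p :: "'a::field_char_0 poly"
  assumes "p \<noteq> 0" "\<zeta> \<noteq> 0" "c \<noteq> 0" and scale: "\<And>x. poly p x = c * poly p (\<zeta> * x)"
  shows "proots p = image_mset (\<lambda>x. \<zeta> * x) (proots p)"
proof (rule multiset_eqI)
  fix y
  define x where "x = y / \<zeta>"
  have y: "y = \<zeta> * x" using assms(2) by (simp add: x_def)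
  have "(\<lambda>x. \<zeta> * x) -` {y} = {x}"
    using assms(2) by (auto simp: y)
  then have "count (image_mset (\<lambda>x. \<zeta> * x) (proots p)) y = count (proots p) x"
    using assms(1) by (cases "order x p = 0") (simp_all add: count_image_mset order_root)
  also have "\<dots> = order x p"
    using assms(1) by simp
  also have "\<dots> = order x (smult c (p \<circ>\<^sub>p [:0, \<zeta>:]))"
  proof -
    have "p = smult c (p \<circ>\<^sub>p [:0, \<zeta>:])"
    proof (rule poly_ext)
      show "poly p x = poly (smult c (p \<circ>\<^sub>p [:0, \<zeta>:])) x" for x
        unfolding poly_smult poly_pcompose using scale[of x] by (simp add: mult.commute)
    qed
    then show ?thesis by (rule arg_cong)
  qed
  also have "\<dots> = order y p"
    using assms(1-3) by (simp add: order_smult order_pcompose_scale y)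
  finally show "count (proots p) y = count (image_mset (\<lambda>x. \<zeta> * x) (proots p)) y"
    using assms(1) by simp
qed

text \<open>The factor \<open>mono_eval D t\<close> amounts to substituting D j z j for z j, a
  bijection on nontrivial points, and \<open>u * D i\<close> merely multiplies the i-th equation by
  a nonzero number.\<close>

lemma zero_systems_diagonal_scale:
  assumes "u \<noteq> 0" "\<And>j. D j \<noteq> (0 :: complex)"
  shows "(\<lambda>v. u * D (fst v) * mono_eval D (snd v) * x v) \<in> zero_systems n d \<longleftrightarrow> x \<in> zero_systems n d"
proof -
  have eq: "form_value n d (\<lambda>v. u * D (fst v) * mono_eval D (snd v) * x v) i z =
      u * D i * form_value n d x i (\<lambda>j. D j * z j)" for i z
    unfolding form_value_def sum_distrib_left by (rule sum.cong) (auto simp: mono_eval_times mult_ac)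
  show ?thesis
  proof
    assume "(\<lambda>v. u * D (fst v) * mono_eval D (snd v) * x v) \<in> zero_systems n d"
    then obtain z where z: "\<exists>i\<in>{1..n}. z i \<noteq> 0" "\<forall>i\<in>{1..n}. u * D i * form_value n d x i (\<lambda>j. D j * z j) = 0"
      unfolding zero_systems_def mem_Collect_eq eq by blast
    then show "x \<in> zero_systems n d"
      unfolding zero_systems_def mem_Collect_eq using assms by (intro exI[of _ "\<lambda>j. D j * z j"]) auto
  next
    assume "x \<in> zero_systems n d"
    then obtain z where z: "\<exists>i\<in>{1..n}. z i \<noteq> 0" "\<forall>i\<in>{1..n}. form_value n d x i z = 0"
      unfolding zero_systems_def by blast
    have "D j * (z j / D j) = z j" for j
      using assms(2)[of j] by simp
    then show "(\<lambda>v. u * D (fst v) * mono_eval D (snd v) * x v) \<in> zero_systems n d"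
      unfolding zero_systems_def mem_Collect_eq eq using assms z
      by (intro exI[of _ "\<lambda>j. z j / D j"]) auto
  qed
qed

text \<open>The diagonal matrix D makes A similar to \<zeta> A while fixing the identity tensor. The
  rescaling property of the resultant then gives p(\<mu>) = c p(\<zeta> \<mu>) for the
  characteristic polynomial p, which transports multiplicities too.\<close>

lemma spectral_symmetric_of_diagonal_similarity:
  fixes A :: "nat list \<Rightarrow> complex"
  assumes m: "m \<ge> 2" and n: "n \<ge> 1"
    and D: "\<And>j. D j ^ m = 1" "\<And>js. js \<in> tensor_indices n m \<Longrightarrow> A js \<noteq> 0 \<Longrightarrow> (\<Prod>j\<leftarrow>js. D j) = cis (2 * pi / real l)"
  shows "spectral_symmetric n m l A"
proof -
  define \<zeta> where "\<zeta> = cis (2 * pi / real l)"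
  have \<zeta>: "\<zeta> \<noteq> 0" by (simp add: \<zeta>_def)
  have D_nz: "D j \<noteq> 0" for j
    using D(1)[of j] m by (auto simp: power_0_left)
  let ?s = "\<lambda>v. inverse \<zeta> * D (fst v) * mono_eval D (snd v)"
  have d: "m - 1 \<ge> 1" using m by simp
  have s_nz: "?s v \<noteq> 0" for v
    using D_nz \<zeta> by (simp add: mono_eval_def)
  obtain c where c: "c \<noteq> 0"
    "\<And>x. ev (\<lambda>v. ?s v * x v) (resultant_mpoly n (m - 1)) = c * ev x (resultant_mpoly n (m - 1))"
  proof (rule ev_resultant_mpoly_scale[OF n d, of ?s])
    show "?s v \<noteq> 0" for v by (rule s_nz)
    show "(\<lambda>v. ?s v * x v) \<in> zero_systems n (m - 1) \<longleftrightarrow> x \<in> zero_systems n (m - 1)" for x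
      by (rule zero_systems_diagonal_scale) (use \<zeta> D_nz in simp_all)
    fix c :: complex
    assume "c \<noteq> 0" "\<And>x. ev (\<lambda>v. ?s v * x v) (resultant_mpoly n (m - 1)) = c * ev x (resultant_mpoly n (m - 1))"
    then show thesis by (rule that)
  qed
  \<comment> \<open>On the diagonal the product of the D's is \<open>D i ^ m\<close> = 1, so
    \<open>inverse \<zeta>\<close> turns \<zeta> \<mu> into \<mu>. At a nonzero entry of A the
    product is \<zeta>, which \<open>inverse \<zeta>\<close> cancels.\<close>
  have coeffs: "?s (i, t) * characteristic_coeffs n m A (\<zeta> * \<mu>) (i, t) = characteristic_coeffs n m A \<mu> (i, t)"
    if i: "i \<in> {1..n}" for i t \<mu>
  proof -
    have "inverse \<zeta> * D i * (\<Prod>j\<leftarrow>js. D j) * (\<zeta> * \<mu> * identity_tensor (i # js) - A (i # js)) =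
        \<mu> * identity_tensor (i # js) - A (i # js)" if js: "js \<in> tensor_indices n (m - 1)" for js
    proof -
      let ?P = "D i * (\<Prod>j\<leftarrow>js. D j)"
      have I: "?P * identity_tensor (i # js) = identity_tensor (i # js)"
        using js m D(1)[of i]
        by (auto simp: identity_tensor_Cons map_replicate prod_list_replicate simp flip: power_Suc)
      have A: "?P * A (i # js) = \<zeta> * A (i # js)"
        using D(2)[of "i # js"] js i m by (auto simp: Cons_in_tensor_indices \<zeta>_def)
      have "inverse \<zeta> * D i * (\<Prod>j\<leftarrow>js. D j) * (\<zeta> * \<mu> * identity_tensor (i # js) - A (i # js)) =
          inverse \<zeta> * (\<zeta> * \<mu> * (?P * identity_tensor (i # js)) - ?P * A (i # js))"
        by (simp add: algebra_simps)
      also have "\<dots> = inverse \<zeta> * \<zeta> * (\<mu> * identity_tensor (i # js) - A (i # js))"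
        unfolding I A by (simp add: algebra_simps)
      finally show ?thesis
        using \<zeta> by simp
    qed
    then show ?thesis
      unfolding characteristic_coeffs_def tensor_coeffs_eq sum_distrib_left fst_conv snd_conv
      by (intro sum.cong) (auto simp: when_def mono_eval_list_monomial)
  qed
  have vars: "(\<Union>t\<in>Poly_Mapping.keys (resultant_mpoly n (m - 1)). Poly_Mapping.keys t) \<subseteq> {1..n} \<times> monomials n (m - 1)"
    using is_resultant_resultant_mpoly[OF n d] by (simp add: is_resultant_iff)
  have "poly (tensor_charpoly n m A) \<mu> = c * poly (tensor_charpoly n m A) (\<zeta> * \<mu>)" for \<mu>
  proof -
    have "ev (\<lambda>v. ?s v * characteristic_coeffs n m A (\<zeta> * \<mu>) v) (resultant_mpoly n (m - 1)) =
        ev (characteristic_coeffs n m A \<mu>) (resultant_mpoly n (m - 1))"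
    proof (rule ev_cong)
      fix v assume "v \<in> (\<Union>t\<in>Poly_Mapping.keys (resultant_mpoly n (m - 1)). Poly_Mapping.keys t)"
      then have "fst v \<in> {1..n}" using vars by auto
      then show "?s v * characteristic_coeffs n m A (\<zeta> * \<mu>) v = characteristic_coeffs n m A \<mu> v"
        using coeffs[of "fst v" "snd v"] by simp
    qed
    then show ?thesis
      by (simp only: poly_tensor_charpoly c(2))
  qed
  then show ?thesis
    unfolding spectral_symmetric_def Spec_def \<zeta>_def[symmetric]
    by (intro proots_scale_invariant[OF tensor_charpoly_neq_0[OF m n] \<zeta> c(1)])
qed

section \<open>Roots of unity and colors\<close>

lemma cis_fraction_mod:
  assumes "m > 0"
  shows "cis (2 * pi * real (a mod m) / real m) = cis (2 * pi * real a / real m)"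
proof -
  have "cis (2 * pi * real a / real m) = cis (2 * pi * real (a mod m) / real m + 2 * pi * real (a div m))"
  proof (rule arg_cong[of _ _ cis])
    have "real a = real (a mod m) + real m * real (a div m)"
      by (metis add.commute mod_mult_div_eq of_nat_add of_nat_mult)
    then show "2 * pi * real a / real m = 2 * pi * real (a mod m) / real m + 2 * pi * real (a div m)"
      using assms by (simp add: field_simps)
  qed
  also have "\<dots> = cis (2 * pi * real (a mod m) / real m) * cis (2 * pi * real (a div m))"
    by (simp only: cis_mult)
  also have "cis (2 * pi * real (a div m)) = 1"
    by (intro cis_multiple_2pi) auto
  finally show ?thesis
    by (simp only: mult_1_right)
qed

lemma cis_fraction_eq_iff:
  assumes "m > 0"
  shows "cis (2 * pi * real a / real m) = cis (2 * pi * real b / real m) \<longleftrightarrow> [a = b] (mod m)"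
proof -
  have inj: "inj_on (\<lambda>k. cis (2 * pi * real k / real m)) {..<m}"
    using bij_betw_roots_unity[OF assms] by (simp add: bij_betw_def)
  have "cis (2 * pi * real a / real m) = cis (2 * pi * real b / real m) \<longleftrightarrow>
      cis (2 * pi * real (a mod m) / real m) = cis (2 * pi * real (b mod m) / real m)"
    by (simp only: cis_fraction_mod[OF assms])
  also have "\<dots> \<longleftrightarrow> a mod m = b mod m"
    using inj_on_eq_iff[OF inj] assms by simp
  finally show ?thesis by (simp add: cong_def)
qed

lemma prod_list_cis: "(\<Prod>j\<leftarrow>js. cis (c * real (f j))) = cis (c * real (\<Sum>j\<leftarrow>js. f j))"
  by (induction js) (simp_all add: cis_mult algebra_simps)

lemma cis_div:
  assumes "l dvd m" "m > 0"
  shows "cis (2 * pi * real (m div l) / real m) = cis (2 * pi / real l)"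
  using assms by (auto elim!: dvdE)

text \<open>The color \<phi> j becomes the m-th root of unity with exponent \<phi> j. The color sum
  m / l on nonzero entries says that the product of these roots is
  \<open>cis (2 * pi / l)\<close>.\<close>

lemma colorable_imp_spectral_symmetric:
  fixes A :: "nat list \<Rightarrow> complex"
  assumes m: "m \<ge> 2" and n: "n \<ge> 1" and "colorable n m l A"
  shows "spectral_symmetric n m l A"
proof -
  from assms(3) obtain \<phi> where dvd: "l dvd m"
    and \<phi>: "\<And>js. js \<in> tensor_indices n m \<Longrightarrow> A js \<noteq> 0 \<Longrightarrow> [(\<Sum>i\<leftarrow>js. \<phi> i) = m div l] (mod m)"
    unfolding colorable_def by blast
  have "m > 0" using m by simp
  show ?thesis
  proof (rule spectral_symmetric_of_diagonal_similarity[OF m n])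
    show "cis (2 * pi / real m * real (\<phi> j)) ^ m = 1" for j
    proof -
      have "cis (2 * pi / real m * real (\<phi> j)) ^ m = cis (2 * pi * real (\<phi> j))"
        using \<open>m > 0\<close> by (simp add: DeMoivre field_simps)
      then show ?thesis
        by (simp add: cis_multiple_2pi)
    qed
    fix js assume "js \<in> tensor_indices n m" "A js \<noteq> 0"
    then have "[(\<Sum>i\<leftarrow>js. \<phi> i) = m div l] (mod m)" by (rule \<phi>)
    then have "cis (2 * pi * real (\<Sum>i\<leftarrow>js. \<phi> i) / real m) = cis (2 * pi * real (m div l) / real m)"
      by (simp only: cis_fraction_eq_iff[OF \<open>m > 0\<close>])
    then show "(\<Prod>j\<leftarrow>js. cis (2 * pi / real m * real (\<phi> j))) = cis (2 * pi / real l)"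
      unfolding prod_list_cis cis_div[OF dvd \<open>m > 0\<close>] by simp
  qed
qed

subsection \<open>The maximum of a nonnegative symmetric tensor\<close>

text \<open>Bolzano-Weierstrass one coordinate at a time: a bounded sequence has a convergent
  monotone subsequence, and thinning out further preserves the convergence already achieved.\<close>

lemma convergent_subsequence_coordinates:
  fixes X :: "nat \<Rightarrow> 'a \<Rightarrow> real"
  assumes "finite J" "\<And>k j. j \<in> J \<Longrightarrow> \<bar>X k j\<bar> \<le> B"
  obtains r where "strict_mono r" "\<And>j. j \<in> J \<Longrightarrow> convergent (\<lambda>k. X (r k) j)"
proof -
  have "\<exists>r :: nat \<Rightarrow> nat. strict_mono r \<and> (\<forall>j\<in>J. convergent (\<lambda>k. X (r k) j))"
    using assms
  proof (induction J rule: finite_induct)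
    case empty
    show ?case by (intro exI[of _ id]) (simp add: strict_mono_def)
  next
    case (insert i J)
    then obtain r :: "nat \<Rightarrow> nat" where r: "strict_mono r" "\<forall>j\<in>J. convergent (\<lambda>k. X (r k) j)"
      by auto
    obtain f where f: "strict_mono f" "monoseq (\<lambda>k. X (r (f k)) i)"
      using seq_monosub[of "\<lambda>k. X (r k) i"] by blast
    have "Bseq (\<lambda>k. X (r (f k)) i)"
      using insert.prems by (intro BseqI'[of _ B]) simp
    then have "convergent (\<lambda>k. X (r (f k)) i)"
      using f(2) by (rule Bseq_monoseq_convergent)
    moreover have "convergent (\<lambda>k. X (r (f k)) j)" if "j \<in> J" for j
      using convergent_subseq_convergent[OF r(2)[rule_format, OF that] f(1)] by (simp add: o_def)
    ultimately show ?case
      using strict_mono_o[OF r(1) f(1)] by (intro exI[of _ "\<lambda>k. r (f k)"]) (auto simp: o_def)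
  qed
  then show thesis using that by blast
qed

definition tensor_value :: "nat \<Rightarrow> nat \<Rightarrow> (nat list \<Rightarrow> real) \<Rightarrow> (nat \<Rightarrow> real) \<Rightarrow> real" where
  "tensor_value n m A x = (\<Sum>js\<in>tensor_indices n m. A js * (\<Prod>j\<leftarrow>js. x j))"

lemma tensor_indices_set: "js \<in> tensor_indices n m \<Longrightarrow> j \<in> set js \<Longrightarrow> j \<in> {1..n}"
  by (auto simp: tensor_indices_def)

text \<open>Isolates the index at position k. Position 0 gives Euler's identity for the form; all
  positions together give its derivative.\<close>

lemma sum_tensor_indices_split:
  assumes "k < m"
  shows "(\<Sum>js\<in>tensor_indices n m. f (js ! k) (take k js @ drop (Suc k) js)) =
    (\<Sum>i\<in>{1..n}. \<Sum>js\<in>tensor_indices n (m - 1). f i js)"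
  unfolding sum.cartesian_product
proof (rule sum.reindex_bij_witness[of _ "\<lambda>(i, js). take k js @ i # drop k js"
      "\<lambda>js. (js ! k, take k js @ drop (Suc k) js)"])
  fix js assume js: "js \<in> tensor_indices n m"
  then have len: "length js = m" by (simp add: tensor_indices_def)
  show "(case (js ! k, take k js @ drop (Suc k) js) of (i, js) \<Rightarrow> take k js @ i # drop k js) = js"
    using len assms by (simp add: min_def id_take_nth_drop[symmetric])
  have "set (take k js @ drop (Suc k) js) \<subseteq> set js"
    by (auto dest: in_set_takeD in_set_dropD)
  moreover have "js ! k \<in> {1..n}"
    by (rule tensor_indices_set[OF js]) (use len assms in simp)
  ultimately show "(js ! k, take k js @ drop (Suc k) js) \<in> {1..n} \<times> tensor_indices n (m - 1)"
    using js len assms by (auto simp: tensor_indices_def)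
  show "(case (js ! k, take k js @ drop (Suc k) js) of (i, js) \<Rightarrow> f i js) =
      f (js ! k) (take k js @ drop (Suc k) js)"
    by simp
next
  fix p assume "p \<in> {1..n} \<times> tensor_indices n (m - 1)"
  then obtain i js where p: "p = (i, js)" "i \<in> {1..n}" "set js \<subseteq> {1..n}" "length js = m - 1"
    by (auto simp: tensor_indices_def)
  show "((case p of (i, js) \<Rightarrow> take k js @ i # drop k js) ! k,
      take k (case p of (i, js) \<Rightarrow> take k js @ i # drop k js) @
      drop (Suc k) (case p of (i, js) \<Rightarrow> take k js @ i # drop k js)) = p"
    using p assms by (simp add: nth_append min_def)
  show "(case p of (i, js) \<Rightarrow> take k js @ i # drop k js) \<in> tensor_indices n m"
    using p assms by (auto simp: tensor_indices_def dest: in_set_takeD in_set_dropD)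
qed

lemma tensor_value_eq_sum_apply:
  assumes "m \<ge> 1"
  shows "tensor_value n m A x = (\<Sum>i\<in>{1..n}. x i * tensor_apply n m A x i)"
proof -
  have "tensor_value n m A x =
      (\<Sum>js\<in>tensor_indices n m. (\<lambda>i js. x i * (A (i # js) * (\<Prod>j\<leftarrow>js. x j))) (js ! 0) (take 0 js @ drop (Suc 0) js))"
    unfolding tensor_value_def
  proof (rule sum.cong[OF refl])
    fix js assume "js \<in> tensor_indices n m"
    then obtain i ks where "js = i # ks"
      using assms by (cases js) (auto simp: tensor_indices_def)
    then show "A js * (\<Prod>j\<leftarrow>js. x j) =
        (\<lambda>i js. x i * (A (i # js) * (\<Prod>j\<leftarrow>js. x j))) (js ! 0) (take 0 js @ drop (Suc 0) js)"
      by (simp add: mult_ac)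
  qed
  also have "\<dots> = (\<Sum>i\<in>{1..n}. \<Sum>js\<in>tensor_indices n (m - 1). x i * (A (i # js) * (\<Prod>j\<leftarrow>js. x j)))"
    by (rule sum_tensor_indices_split) (use assms in simp)
  finally show ?thesis
    by (simp add: tensor_apply_def sum_distrib_left)
qed

lemma prod_list_map_mult:
  fixes x y :: "'a \<Rightarrow> 'b::comm_monoid_mult"
  shows "(\<Prod>j\<leftarrow>js. x j * y j) = (\<Prod>j\<leftarrow>js. x j) * (\<Prod>j\<leftarrow>js. y j)"
  by (induction js) (simp_all add: mult_ac)

lemma prod_list_nonneg_real:
  fixes x :: "'a \<Rightarrow> real"
  shows "(\<And>j. j \<in> set js \<Longrightarrow> 0 \<le> x j) \<Longrightarrow> 0 \<le> (\<Prod>j\<leftarrow>js. x j)"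
  by (induction js) auto

lemma prod_list_mono_real:
  fixes x y :: "'a \<Rightarrow> real"
  shows "(\<And>j. j \<in> set js \<Longrightarrow> 0 \<le> x j \<and> x j \<le> y j) \<Longrightarrow> (\<Prod>j\<leftarrow>js. x j) \<le> (\<Prod>j\<leftarrow>js. y j)"
proof (induction js)
  case (Cons i js)
  then show ?case
    using prod_list_nonneg_real[of js x] by (auto intro!: mult_mono intro: order_trans)
qed simp

lemma tendsto_prod_list_map:
  fixes f :: "'c \<Rightarrow> 'a \<Rightarrow> real"
  assumes "\<And>j. j \<in> set js \<Longrightarrow> ((\<lambda>k. f k j) \<longlongrightarrow> z j) F"
  shows "((\<lambda>k. \<Prod>j\<leftarrow>js. f k j) \<longlongrightarrow> (\<Prod>j\<leftarrow>js. z j)) F"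
  using assms by (induction js) (auto intro!: tendsto_mult)

lemma tensor_value_maximizer:
  assumes "m \<ge> 1" "n \<ge> 1" "nonnegative_tensor n m A"
  obtains x where "\<And>j. x j \<ge> 0" "(\<Sum>j\<in>{1..n}. x j ^ m) = 1"
    "\<And>y. (\<And>j. y j \<ge> 0) \<Longrightarrow> (\<Sum>j\<in>{1..n}. y j ^ m) = 1 \<Longrightarrow> tensor_value n m A y \<le> tensor_value n m A x"
proof -
  define S where "S = {x. (\<forall>j. x j \<ge> (0::real)) \<and> (\<Sum>j\<in>{1..n}. x j ^ m) = 1}"
  have le_1: "x j \<le> 1" if "x \<in> S" "j \<in> {1..n}" for x j
  proof -
    have "x j ^ m \<le> (\<Sum>j\<in>{1..n}. x j ^ m)"
      using that by (intro member_le_sum) (auto simp: S_def)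
    then have "x j ^ m \<le> 1 ^ m"
      using that by (simp add: S_def)
    then show ?thesis
      using power_mono_iff[of "x j" 1 m] that assms(1) by (simp add: S_def)
  qed
  have bdd: "bdd_above (tensor_value n m A ` S)"
  proof (intro bdd_aboveI2)
    fix x assume x: "x \<in> S"
    show "tensor_value n m A x \<le> (\<Sum>js\<in>tensor_indices n m. A js)"
      unfolding tensor_value_def
    proof (rule sum_mono)
      fix js assume js: "js \<in> tensor_indices n m"
      have "(\<Prod>j\<leftarrow>js. x j) \<le> (\<Prod>j\<leftarrow>js. 1)"
        by (rule prod_list_mono_real) (use x le_1[OF x] tensor_indices_set[OF js] in \<open>auto simp: S_def\<close>)
      then have "(\<Prod>j\<leftarrow>js. x j) \<le> 1"
        by (simp add: map_replicate_const prod_list_replicate)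
      then show "A js * (\<Prod>j\<leftarrow>js. x j) \<le> A js"
        using assms(3) js by (simp add: nonnegative_tensor_def mult_left_le)
    qed
  qed
  have "(\<lambda>j. if j = 1 then 1 else 0) \<in> S"
  proof -
    have "(\<Sum>j\<in>{1..n}. (if j = 1 then 1 else 0 :: real) ^ m) = (\<Sum>j\<in>{1..n}. if j = 1 then 1 else 0)"
      using assms(1) by (intro sum.cong) auto
    then show ?thesis using assms(2) by (simp add: S_def)
  qed
  then have ne: "tensor_value n m A ` S \<noteq> {}" by blast
  define M where "M = Sup (tensor_value n m A ` S)"
  have "\<exists>x\<in>S. M - inverse (real (Suc k)) < tensor_value n m A x" for k
  proof -
    have "M - inverse (real (Suc k)) < M" by simp
    then show ?thesis
      unfolding M_def less_cSup_iff[OF ne bdd] by blast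
  qed
  then obtain X where X: "\<And>k. X k \<in> S" "\<And>k. M - inverse (real (Suc k)) < tensor_value n m A (X k)"
    by metis
  have "\<bar>X k j\<bar> \<le> 1" if "j \<in> {1..n}" for k j
    using le_1[OF X(1) that] X(1)[of k] by (simp add: S_def)
  then obtain r where r: "strict_mono r" "\<And>j. j \<in> {1..n} \<Longrightarrow> convergent (\<lambda>k. X (r k) j)"
    using convergent_subsequence_coordinates[of "{1..n}" X 1] by blast
  \<comment> \<open>The subsequence converges only at the coordinates in {1..n}. The value 0
    elsewhere keeps z nonnegative everywhere, as the constraint demands.\<close>
  define z where "z = (\<lambda>j. if j \<in> {1..n} then lim (\<lambda>k. X (r k) j) else 0)"
  have z: "(\<lambda>k. X (r k) j) \<longlonglongrightarrow> z j" if "j \<in> {1..n}" for j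
    using r(2)[OF that] that by (simp add: z_def convergent_LIMSEQ_iff)
  have "z j \<ge> 0" for j
  proof (cases "j \<in> {1..n}")
    case True
    then show ?thesis
      by (intro LIMSEQ_le_const[OF z]) (use X(1) in \<open>auto simp: S_def\<close>)
  next
    case False
    then show ?thesis by (auto simp: z_def)
  qed
  moreover have "(\<Sum>j\<in>{1..n}. z j ^ m) = 1"
  proof (rule LIMSEQ_unique)
    show "(\<lambda>k. \<Sum>j\<in>{1..n}. X (r k) j ^ m) \<longlonglongrightarrow> (\<Sum>j\<in>{1..n}. z j ^ m)"
      by (intro tendsto_sum tendsto_power z)
    show "(\<lambda>k. \<Sum>j\<in>{1..n}. X (r k) j ^ m) \<longlonglongrightarrow> 1"
      using X(1) by (simp add: S_def)
  qed
  moreover have "tensor_value n m A y \<le> tensor_value n m A z"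
    if "\<And>j. y j \<ge> 0" "(\<Sum>j\<in>{1..n}. y j ^ m) = 1" for y
  proof -
    have "tensor_value n m A y \<le> M"
      unfolding M_def using that by (intro cSup_upper bdd) (auto simp: S_def)
    also have "M \<le> tensor_value n m A z"
    proof (rule LIMSEQ_le)
      have "(\<lambda>k. M - inverse (real (Suc (r k)))) \<longlonglongrightarrow> M - 0"
        using LIMSEQ_subseq_LIMSEQ[OF LIMSEQ_inverse_real_of_nat r(1)]
        by (intro tendsto_diff tendsto_const) (simp add: o_def)
      then show "(\<lambda>k. M - inverse (real (Suc (r k)))) \<longlonglongrightarrow> M" by simp
      show "(\<lambda>k. tensor_value n m A (X (r k))) \<longlonglongrightarrow> tensor_value n m A z"
        unfolding tensor_value_def
        by (intro tendsto_sum tendsto_mult tendsto_const tendsto_prod_list_map z) (rule tensor_indices_set)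
      show "\<exists>N. \<forall>k\<ge>N. M - inverse (real (Suc (r k))) \<le> tensor_value n m A (X (r k))"
        using X(2) less_imp_le by blast
    qed
    finally show ?thesis .
  qed
  ultimately show thesis by (rule that)
qed

lemma tensor_value_scale:
  "tensor_value n m A (\<lambda>j. c * x j) = c ^ m * tensor_value n m A x"
  unfolding tensor_value_def sum_distrib_left
proof (rule sum.cong[OF refl])
  fix js assume "js \<in> tensor_indices n m"
  then have "(\<Prod>j\<leftarrow>js. c) = c ^ m"
    by (simp add: map_replicate_const prod_list_replicate tensor_indices_def)
  then show "A js * (\<Prod>j\<leftarrow>js. c * x j) = c ^ m * (A js * (\<Prod>j\<leftarrow>js. x j))"
    by (simp add: prod_list_map_mult)
qed

text \<open>Both sides are homogeneous of degree m, so y is scaled to the unit sphere by the inverse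
  m-th root of its power sum. If that sum is 0, every product is 0 because index lists are
  nonempty.\<close>

lemma tensor_value_le:
  assumes "m \<ge> 1" and max: "\<And>y. (\<And>j. y j \<ge> 0) \<Longrightarrow> (\<Sum>j\<in>{1..n}. y j ^ m) = 1 \<Longrightarrow> tensor_value n m A y \<le> \<rho>"
    and "\<And>j. y j \<ge> 0"
  shows "tensor_value n m A y \<le> \<rho> * (\<Sum>j\<in>{1..n}. y j ^ m)"
proof (cases "(\<Sum>j\<in>{1..n}. y j ^ m) = 0")
  case True
  then have "\<forall>j\<in>{1..n}. y j ^ m = 0"
    by (subst (asm) sum_nonneg_eq_0_iff) (auto simp: assms)
  then have y: "y j = 0" if "j \<in> {1..n}" for j
    using that by simp
  have "(\<Prod>j\<leftarrow>js. y j) = 0" if "js \<in> tensor_indices n m" for js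
    using that assms(1) by (cases js) (auto simp: tensor_indices_def y)
  then show ?thesis
    using True by (simp add: tensor_value_def)
next
  case False
  define s where "s = (\<Sum>j\<in>{1..n}. y j ^ m)"
  have "s > 0"
    using False sum_nonneg[of "{1..n}" "\<lambda>j. y j ^ m"] assms(3) unfolding s_def by fastforce
  define c where "c = inverse (root m s)"
  have c: "c ^ m * s = 1" "c \<ge> 0"
    using \<open>s > 0\<close> assms(1) by (simp_all add: c_def power_inverse)
  have "tensor_value n m A (\<lambda>j. c * y j) \<le> \<rho>"
    using c assms(3) by (intro max) (simp_all add: power_mult_distrib s_def flip: sum_distrib_left)
  then have "s * (c ^ m * tensor_value n m A y) \<le> s * \<rho>"
    using \<open>s > 0\<close> unfolding tensor_value_scale by (intro mult_left_mono) simp_all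
  also have "s * (c ^ m * tensor_value n m A y) = tensor_value n m A y"
    using c(1) by (simp add: mult.commute flip: mult.assoc)
  finally show ?thesis
    by (simp add: s_def mult.commute)
qed

lemma trancl_crossing:
  assumes "(p, q) \<in> r\<^sup>+" "P p" "\<not> P q"
  obtains u v where "(u, v) \<in> r" "P u" "\<not> P v"
proof -
  have "P q \<or> (\<exists>u v. (u, v) \<in> r \<and> P u \<and> \<not> P v)"
    using assms(1)
  proof (induction rule: trancl_induct)
    case (base y)
    then show ?case using assms(2) by blast
  next
    case (step y z)
    then show ?case by blast
  qed
  then show thesis using assms(3) that by blast
qed

text \<open>If x vanishes somewhere, some nonzero entry involves both zero and nonzero coordinates of x.
  Raising the zero coordinates to \<open>\<epsilon>\<close> increases the value by order at most m - 1 in \<open>\<epsilon>\<close>, but the sum of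
  the m-th powers only by order m.\<close>

lemma tensor_value_maximizer_pos:
  assumes m: "m \<ge> 2" and nonneg: "nonnegative_tensor n m A" and irr: "weakly_irreducible n m A"
    and le: "\<And>y. (\<And>j. y j \<ge> 0) \<Longrightarrow> tensor_value n m A y \<le> \<rho> * (\<Sum>j\<in>{1..n}. y j ^ m)"
    and "\<rho> \<ge> 0"
    and x: "\<And>j. x j \<ge> 0" and eq: "tensor_value n m A x = \<rho> * (\<Sum>j\<in>{1..n}. x j ^ m)"
    and p: "p \<in> {1..n}" "x p > 0" and q: "q \<in> {1..n}"
  shows "x q > 0"
proof (rule ccontr)
  assume "\<not> x q > 0"
  have "(p, q) \<in> (tensor_arcs n m A)\<^sup>+"
    using irr p(1) q by (simp add: weakly_irreducible_def)
  \<comment> \<open>A walk from p to q leaves the support of x along some arc. The corresponding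
    entry contributes nothing at x, because of v, but contains the positive coordinate u.\<close>
  then obtain u v where uv: "(u, v) \<in> tensor_arcs n m A" "x u > 0" "\<not> x v > 0"
    using p(2) \<open>\<not> x q > 0\<close> by (rule trancl_crossing)
  then have xv: "x v = 0" using x[of v] by simp
  obtain ks where ks: "u # ks \<in> tensor_indices n m" "A (u # ks) \<noteq> 0" "v \<in> set ks"
    using uv(1) by (auto simp: tensor_arcs_def)
  define a where "a = A (u # ks)"
  have "a > 0"
    using ks nonneg by (simp add: a_def nonnegative_tensor_def less_le)
  \<comment> \<open>A lower bound for all positive coordinates of x, capped at 1 so that \<delta>
    \<epsilon> is also a lower bound for the coordinates raised to \<epsilon>.\<close>
  define \<delta> where "\<delta> = min 1 (Min ((\<lambda>j. if x j = 0 then 1 else x j) ` {1..n}))"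
  have ne: "(\<lambda>j. if x j = 0 then 1 else x j) ` {1..n} \<noteq> {}"
    using q by blast
  have "0 < Min ((\<lambda>j. if x j = 0 then 1 else x j) ` {1..n})"
    unfolding Min_gr_iff[OF finite_imageI[OF finite_atLeastAtMost] ne] using x by (auto simp: less_le)
  then have "\<delta> > 0"
    by (simp add: \<delta>_def)
  have "\<delta> \<le> 1" by (simp add: \<delta>_def)
  have \<delta>_le: "\<delta> \<le> x j" if "j \<in> {1..n}" "x j \<noteq> 0" for j
  proof -
    have "Min ((\<lambda>j. if x j = 0 then 1 else x j) ` {1..n}) \<le> (if x j = 0 then 1 else x j)"
      using that(1) by (intro Min_le) auto
    then show ?thesis using that(2) by (simp add: \<delta>_def)
  qed
  have key: "a * \<delta> ^ m \<le> \<rho> * real n * \<epsilon>" if \<epsilon>: "0 < \<epsilon>" "\<epsilon> \<le> 1" for \<epsilon>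
  proof -
    define y where "y = (\<lambda>j. if x j = 0 then \<epsilon> else x j)"
    have y: "x j \<le> y j" "y j \<ge> 0" for j
      using x[of j] \<epsilon> by (simp_all add: y_def)
    \<comment> \<open>The index u contributes \<delta> without a factor \<epsilon>; only the other m
      - 1 indices can contribute one.\<close>
    have "\<delta> * (\<delta> * \<epsilon>) ^ (m - 1) \<le> y u * (\<Prod>j\<leftarrow>ks. y j)"
    proof (rule mult_mono)
      show "\<delta> \<le> y u"
        using \<delta>_le[of u] uv(2) ks(1) by (auto simp: y_def tensor_indices_def)
      have "(\<Prod>j\<leftarrow>ks. \<delta> * \<epsilon>) \<le> (\<Prod>j\<leftarrow>ks. y j)"
      proof (rule prod_list_mono_real)
        fix j assume "j \<in> set ks"
        then have j: "j \<in> {1..n}" using ks(1) by (auto simp: tensor_indices_def)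
        have "\<delta> * \<epsilon> \<le> y j"
        proof (cases "x j = 0")
          case True
          then show ?thesis
            using \<open>\<delta> \<le> 1\<close> \<epsilon> by (simp add: y_def mult_left_le_one_le \<open>\<delta> > 0\<close> less_imp_le)
        next
          case False
          then show ?thesis
            using \<delta>_le[OF j False] order_trans[of "\<delta> * \<epsilon>" \<delta> "x j"] \<epsilon> \<open>\<delta> > 0\<close> by (simp add: y_def)
        qed
        then show "0 \<le> \<delta> * \<epsilon> \<and> \<delta> * \<epsilon> \<le> y j"
          using \<open>\<delta> > 0\<close> \<epsilon> by simp
      qed
      moreover have "length ks = m - 1"
        using ks(1) by (auto simp: tensor_indices_def)
      ultimately show "(\<delta> * \<epsilon>) ^ (m - 1) \<le> (\<Prod>j\<leftarrow>ks. y j)"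
        by (simp add: map_replicate_const prod_list_replicate)
    qed (use y \<open>\<delta> > 0\<close> \<epsilon> in auto)
    then have prod_y: "\<delta> * (\<delta> * \<epsilon>) ^ (m - 1) \<le> (\<Prod>j\<leftarrow>u # ks. y j)"
      by simp
    have prod_x: "(\<Prod>j\<leftarrow>u # ks. x j) = 0"
      using ks(3) xv by (force simp: prod_list_zero_iff)
    have "a * (\<delta> * (\<delta> * \<epsilon>) ^ (m - 1)) \<le> A (u # ks) * ((\<Prod>j\<leftarrow>u # ks. y j) - (\<Prod>j\<leftarrow>u # ks. x j))"
      unfolding prod_x a_def[symmetric] using prod_y \<open>a > 0\<close> by (intro mult_left_mono) simp_all
    also have "\<dots> \<le> (\<Sum>js\<in>tensor_indices n m. A js * ((\<Prod>j\<leftarrow>js. y j) - (\<Prod>j\<leftarrow>js. x j)))"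
    proof (rule member_le_sum[OF ks(1)])
      fix js assume "js \<in> tensor_indices n m - {u # ks}"
      moreover have "(\<Prod>j\<leftarrow>js. x j) \<le> (\<Prod>j\<leftarrow>js. y j)"
        by (rule prod_list_mono_real) (use x y in auto)
      ultimately show "0 \<le> A js * ((\<Prod>j\<leftarrow>js. y j) - (\<Prod>j\<leftarrow>js. x j))"
        using nonneg by (simp add: nonnegative_tensor_def)
    qed simp
    also have "\<dots> = tensor_value n m A y - tensor_value n m A x"
      by (simp add: tensor_value_def right_diff_distrib sum_subtractf)
    also have "\<dots> \<le> \<rho> * (\<Sum>j\<in>{1..n}. y j ^ m) - \<rho> * (\<Sum>j\<in>{1..n}. x j ^ m)"
      using le[of y] y eq by simp
    also have "\<dots> = \<rho> * (\<Sum>j\<in>{1..n}. y j ^ m - x j ^ m)"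
      by (simp add: right_diff_distrib sum_subtractf)
    also have "\<dots> \<le> \<rho> * (\<Sum>j\<in>{1..n}. \<epsilon> ^ m)"
      using \<epsilon> m by (intro mult_left_mono sum_mono \<open>\<rho> \<ge> 0\<close>) (simp add: y_def)
    finally have "a * (\<delta> * (\<delta> * \<epsilon>) ^ (m - 1)) \<le> \<rho> * real n * \<epsilon> ^ m"
      by simp
    moreover have "m = Suc (m - 1)" using m by simp
    then have "\<epsilon> ^ m = \<epsilon> * \<epsilon> ^ (m - 1)" "\<delta> ^ m = \<delta> * \<delta> ^ (m - 1)"
      by (metis power_Suc)+
    ultimately have "(a * \<delta> ^ m) * \<epsilon> ^ (m - 1) \<le> (\<rho> * real n * \<epsilon>) * \<epsilon> ^ (m - 1)"
      by (simp add: power_mult_distrib mult_ac)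
    then show ?thesis
      using \<epsilon> by simp
  qed
  define c where "c = a * \<delta> ^ m"
  have "c > 0" using \<open>a > 0\<close> \<open>\<delta> > 0\<close> by (simp add: c_def)
  \<comment> \<open>With c the left side of \<open>key\<close>, this \<epsilon> makes the right side
    at most c / 2. The summand 1 keeps the denominator positive.\<close>
  define \<epsilon> where "\<epsilon> = min 1 (c / (2 * (\<rho> * real n + 1)))"
  have pos: "\<rho> * real n + 1 > 0" using \<open>\<rho> \<ge> 0\<close> by (simp add: add_nonneg_pos)
  then have "0 < \<epsilon>" "\<epsilon> \<le> 1"
    using \<open>c > 0\<close> by (simp_all add: \<epsilon>_def)
  then have "c \<le> \<rho> * real n * \<epsilon>"
    unfolding c_def by (rule key)
  also have "\<dots> \<le> (\<rho> * real n + 1) * (c / (2 * (\<rho> * real n + 1)))"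
    using \<open>\<rho> \<ge> 0\<close> \<open>0 < \<epsilon>\<close> by (intro mult_mono) (simp_all add: \<epsilon>_def)
  also have "\<dots> = c / 2"
    using pos by (simp add: field_simps)
  finally show False
    using \<open>c > 0\<close> by simp
qed

section \<open>First-order condition at the maximum\<close>

lemma has_derivative_prod_list:
  fixes x h :: "'a \<Rightarrow> real"
  shows "((\<lambda>t. \<Prod>j\<leftarrow>js. x j + t * h j) has_real_derivative
    (\<Sum>k<length js. h (js ! k) * (\<Prod>j\<leftarrow>take k js @ drop (Suc k) js. x j))) (at 0)"
proof (induction js)
  case (Cons i js)
  have "((\<lambda>t. (x i + t * h i) * (\<Prod>j\<leftarrow>js. x j + t * h j)) has_real_derivative
      h i * (\<Prod>j\<leftarrow>js. x j) + x i * (\<Sum>k<length js. h (js ! k) * (\<Prod>j\<leftarrow>take k js @ drop (Suc k) js. x j))) (at 0)"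
    by (rule derivative_eq_intros Cons refl | simp)+
  then show ?case
    by (simp add: sum.lessThan_Suc_shift sum_distrib_left mult_ac del: sum.lessThan_Suc)
qed simp

text \<open>By the product rule, each of the m positions contributes a sum over the entries with i
  at that position. Symmetry moves this index to the front, so all m contributions equal the i-th
  component of A x^(m-1).\<close>

lemma has_derivative_tensor_value:
  assumes "symmetric_tensor n m A" "i \<in> {1..n}"
  shows "((\<lambda>t. tensor_value n m A (\<lambda>j. x j + t * of_bool (j = i))) has_real_derivative
    real m * tensor_apply n m A x i) (at 0)"
proof -
  let ?h = "\<lambda>j. of_bool (j = i) :: real"
  have "((\<lambda>t. tensor_value n m A (\<lambda>j. x j + t * ?h j)) has_real_derivative
      (\<Sum>js\<in>tensor_indices n m. A js * (\<Sum>k<length js. ?h (js ! k) * (\<Prod>j\<leftarrow>take k js @ drop (Suc k) js. x j)))) (at 0)"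
    unfolding tensor_value_def
    by (intro DERIV_sum DERIV_cmult has_derivative_prod_list)
  also have "(\<Sum>js\<in>tensor_indices n m. A js * (\<Sum>k<length js. ?h (js ! k) * (\<Prod>j\<leftarrow>take k js @ drop (Suc k) js. x j))) =
      (\<Sum>js\<in>tensor_indices n m. \<Sum>k<m. A js * (?h (js ! k) * (\<Prod>j\<leftarrow>take k js @ drop (Suc k) js. x j)))"
  proof (rule sum.cong[OF refl])
    fix js assume "js \<in> tensor_indices n m"
    then have "length js = m" by (simp add: tensor_indices_def)
    then show "A js * (\<Sum>k<length js. ?h (js ! k) * (\<Prod>j\<leftarrow>take k js @ drop (Suc k) js. x j)) =
        (\<Sum>k<m. A js * (?h (js ! k) * (\<Prod>j\<leftarrow>take k js @ drop (Suc k) js. x j)))"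
      by (simp only: sum_distrib_left)
  qed
  also have "\<dots> = (\<Sum>k<m. \<Sum>js\<in>tensor_indices n m. A js * (?h (js ! k) * (\<Prod>j\<leftarrow>take k js @ drop (Suc k) js. x j)))"
    by (rule sum.swap)
  also have "\<dots> = (\<Sum>k<m. tensor_apply n m A x i)"
  proof (rule sum.cong[OF refl])
    fix k assume "k \<in> {..<m}"
    then have k: "k < m" by simp
    have "(\<Sum>js\<in>tensor_indices n m. A js * (?h (js ! k) * (\<Prod>j\<leftarrow>take k js @ drop (Suc k) js. x j))) =
        (\<Sum>js\<in>tensor_indices n m. (\<lambda>a ks. A (a # ks) * (?h a * (\<Prod>j\<leftarrow>ks. x j)))
          (js ! k) (take k js @ drop (Suc k) js))"
    proof (rule sum.cong[OF refl])
      fix js assume js: "js \<in> tensor_indices n m"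
      let ?ks = "js ! k # take k js @ drop (Suc k) js"
      have len: "length js = m" using js by (simp add: tensor_indices_def)
      have "mset (take k js @ js ! k # drop (Suc k) js) = mset ?ks"
        by simp
      then have mset: "mset js = mset ?ks"
        using len k by (simp only: id_take_nth_drop[symmetric])
      then have "set ?ks = set js"
        by (metis set_mset_mset)
      moreover have "length ?ks = m"
        using len k by simp
      ultimately have "?ks \<in> tensor_indices n m"
        using js by (simp add: tensor_indices_def)
      then have "A js = A ?ks"
        using assms(1) js mset unfolding symmetric_tensor_def by blast
      then show "A js * (?h (js ! k) * (\<Prod>j\<leftarrow>take k js @ drop (Suc k) js. x j)) =
          (\<lambda>a ks. A (a # ks) * (?h a * (\<Prod>j\<leftarrow>ks. x j))) (js ! k) (take k js @ drop (Suc k) js)"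
        by simp
    qed
    also have "\<dots> = (\<Sum>a\<in>{1..n}. \<Sum>ks\<in>tensor_indices n (m - 1). A (a # ks) * (?h a * (\<Prod>j\<leftarrow>ks. x j)))"
      by (rule sum_tensor_indices_split[OF k])
    also have "\<dots> = (\<Sum>a\<in>{1..n}. if a = i then tensor_apply n m A x i else 0)"
      by (rule sum.cong) (auto simp: tensor_apply_def)
    also have "\<dots> = tensor_apply n m A x i"
      using assms(2) by simp
    finally show "(\<Sum>js\<in>tensor_indices n m. A js * (?h (js ! k) * (\<Prod>j\<leftarrow>take k js @ drop (Suc k) js. x j))) =
        tensor_apply n m A x i" .
  qed
  finally show ?thesis by simp
qed

text \<open>The difference of the two sides of \<open>le\<close> is at most 0 and equals 0 at x.
  Along the i-th axis it has a local maximum there, two-sided because x i > 0, and the vanishing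
  derivative is the eigenvalue equation.\<close>

lemma maximizer_eigenvector:
  assumes m: "m \<ge> 1" and sym: "symmetric_tensor n m A"
    and le: "\<And>y. (\<And>j. y j \<ge> 0) \<Longrightarrow> tensor_value n m A y \<le> \<rho> * (\<Sum>j\<in>{1..n}. y j ^ m)"
    and x: "\<And>j. x j \<ge> 0" and eq: "tensor_value n m A x = \<rho> * (\<Sum>j\<in>{1..n}. x j ^ m)"
    and i: "i \<in> {1..n}" "x i > 0"
  shows "tensor_apply n m A x i = \<rho> * x i ^ (m - 1)"
proof -
  define g where "g = (\<lambda>t. tensor_value n m A (\<lambda>j. x j + t * of_bool (j = i)) -
    \<rho> * (\<Sum>j\<in>{1..n}. (x j + t * of_bool (j = i)) ^ m))"
  have "((\<lambda>t. \<Sum>j\<in>{1..n}. (x j + t * of_bool (j = i)) ^ m) has_real_derivative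
      (\<Sum>j\<in>{1..n}. real m * (x j + 0 * of_bool (j = i)) ^ (m - 1) * of_bool (j = i))) (at 0)"
    by (intro DERIV_sum) (auto intro!: derivative_eq_intros)
  also have "(\<Sum>j\<in>{1..n}. real m * (x j + 0 * of_bool (j = i)) ^ (m - 1) * of_bool (j = i)) =
      (\<Sum>j\<in>{1..n}. if j = i then real m * x i ^ (m - 1) else 0)"
    by (rule sum.cong) auto
  also have "\<dots> = real m * x i ^ (m - 1)"
    using i(1) by simp
  finally have "(g has_real_derivative real m * tensor_apply n m A x i - \<rho> * (real m * x i ^ (m - 1))) (at 0)"
    unfolding g_def by (intro DERIV_diff DERIV_cmult has_derivative_tensor_value[OF sym i(1)])
  moreover have "\<forall>t. \<bar>0 - t\<bar> < x i \<longrightarrow> g t \<le> g 0"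
  proof (intro allI impI)
    fix t assume t: "\<bar>0 - t\<bar> < x i"
    have "x j + t * of_bool (j = i) \<ge> 0" for j
      using x[of j] t by (cases "j = i") auto
    then have "g t \<le> 0"
      using le unfolding g_def by simp
    also have "0 = g 0"
      by (simp add: g_def eq)
    finally show "g t \<le> g 0" .
  qed
  ultimately have "real m * tensor_apply n m A x i - \<rho> * (real m * x i ^ (m - 1)) = 0"
    using i(2) by (intro DERIV_local_max[of g _ 0 "x i"])
  then have "real m * tensor_apply n m A x i = real m * (\<rho> * x i ^ (m - 1))"
    by (simp add: mult_ac)
  then show ?thesis
    using m by simp
qed

text \<open>The equality case of the triangle inequality: the terms w (1 - Re u) are nonnegative
  with sum 0, so Re u = 1 wherever w > 0, and the modulus 1 leaves no imaginary part.\<close>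

lemma weighted_unit_sum:
  fixes u :: "'a \<Rightarrow> complex"
  assumes "finite I" "\<And>j. j \<in> I \<Longrightarrow> w j \<ge> 0" "\<And>j. j \<in> I \<Longrightarrow> norm (u j) = 1"
    and sum: "(\<Sum>j\<in>I. of_real (w j) * u j) = of_real (\<Sum>j\<in>I. w j)"
    and j: "j \<in> I" "w j > 0"
  shows "u j = 1"
proof -
  have "Re (u k) \<le> 1" if "k \<in> I" for k
    using complex_Re_le_cmod[of "u k"] assms(3)[OF that] by simp
  then have nonneg: "0 \<le> w k * (1 - Re (u k))" if "k \<in> I" for k
    using assms(2) that by simp
  have "(\<Sum>k\<in>I. w k * (1 - Re (u k))) = (\<Sum>k\<in>I. w k) - Re (\<Sum>k\<in>I. of_real (w k) * u k)"
    by (simp add: right_diff_distrib sum_subtractf)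
  also have "\<dots> = 0"
    by (simp only: sum Re_complex_of_real diff_self)
  finally have "w j * (1 - Re (u j)) = 0"
    using nonneg assms(1) j(1) by (subst (asm) sum_nonneg_eq_0_iff) auto
  then have Re: "Re (u j) = 1"
    using j(2) by simp
  have "(Re (u j))\<^sup>2 + (Im (u j))\<^sup>2 = 1"
    using assms(3)[OF j(1)] cmod_power2[of "u j"] by simp
  then show ?thesis
    using Re by (simp add: complex_eq_iff)
qed

subsection \<open>Phases of eigenvectors\<close>

text \<open>The triangle inequality in each coordinate, multiplied by the modulus of z i and summed,
  bounds the value at the moduli from below by the same quantity that \<open>le\<close> gives as an
  upper bound.\<close>

lemma norm_eigenvector_attains_maximum:
  fixes z :: "nat \<Rightarrow> complex"
  assumes m: "m \<ge> 1" and nonneg: "nonnegative_tensor n m A"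
    and le: "\<And>y. (\<And>j. y j \<ge> 0) \<Longrightarrow> tensor_value n m A y \<le> \<rho> * (\<Sum>j\<in>{1..n}. y j ^ m)"
    and eigen: "\<And>i. i \<in> {1..n} \<Longrightarrow>
      norm (tensor_apply n m (\<lambda>js. complex_of_real (A js)) z i) = \<rho> * norm (z i) ^ (m - 1)"
  shows "tensor_value n m A (\<lambda>j. norm (z j)) = \<rho> * (\<Sum>j\<in>{1..n}. norm (z j) ^ m)"
proof (rule antisym)
  have "\<rho> * norm (z i) ^ m \<le> norm (z i) * tensor_apply n m A (\<lambda>j. norm (z j)) i" if i: "i \<in> {1..n}" for i
  proof -
    have "norm (complex_of_real (A (i # js)) * (\<Prod>j\<leftarrow>js. z j)) = A (i # js) * (\<Prod>j\<leftarrow>js. norm (z j))"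
      if "js \<in> tensor_indices n (m - 1)" for js
    proof -
      have "A (i # js) \<ge> 0"
        using nonneg that i m by (simp add: nonnegative_tensor_def Cons_in_tensor_indices)
      moreover have "norm (\<Prod>j\<leftarrow>js. z j) = (\<Prod>j\<leftarrow>js. norm (z j))"
        by (induction js) (simp_all add: norm_mult)
      ultimately show ?thesis
        by (simp add: norm_mult)
    qed
    then have "norm (tensor_apply n m (\<lambda>js. complex_of_real (A js)) z i) \<le> tensor_apply n m A (\<lambda>j. norm (z j)) i"
      unfolding tensor_apply_def by (intro sum_norm_le) simp
    then have "norm (z i) * (\<rho> * norm (z i) ^ (m - 1)) \<le> norm (z i) * tensor_apply n m A (\<lambda>j. norm (z j)) i"
      unfolding eigen[OF i] by (rule mult_left_mono) simp
    moreover have "norm (z i) ^ m = norm (z i) * norm (z i) ^ (m - 1)"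
      using m by (simp add: power_eq_if)
    ultimately show ?thesis by (simp add: mult_ac)
  qed
  then show "\<rho> * (\<Sum>j\<in>{1..n}. norm (z j) ^ m) \<le> tensor_value n m A (\<lambda>j. norm (z j))"
    unfolding tensor_value_eq_sum_apply[OF m] sum_distrib_left by (intro sum_mono)
qed (use le in simp)

lemma prod_list_map_cong_mset:
  fixes D :: "'a \<Rightarrow> 'b::comm_monoid_mult"
  assumes "mset js = mset ks"
  shows "(\<Prod>j\<leftarrow>js. D j) = (\<Prod>j\<leftarrow>ks. D j)"
proof -
  have "mset (map D js) = mset (map D ks)"
    using assms by simp
  then show ?thesis
    by (metis prod_mset_prod_list)
qed

lemma weakly_irreducible_nonzero_entry:
  assumes "n \<ge> 1" "weakly_irreducible n m A"
  obtains js where "js \<in> tensor_indices n m" "A js \<noteq> 0"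
proof -
  have "(1, 1) \<in> (tensor_arcs n m A)\<^sup>+"
    using assms by (simp add: weakly_irreducible_def)
  then obtain j where "(1, j) \<in> tensor_arcs n m A"
    by (meson tranclD)
  then show thesis
    using that by (auto simp: tensor_arcs_def)
qed

text \<open>The right side of \<open>phase\<close> depends on which index stands first, the left
  side does not. Symmetry lets any index stand first, so \<open>D j ^ m\<close> agrees along arcs
  and by strong connectivity everywhere.\<close>

lemma colorable_of_phases:
  fixes D :: "nat \<Rightarrow> complex"
  assumes m: "m \<ge> 2" and n: "n \<ge> 1" and l: "l \<ge> 2"
    and sym: "symmetric_tensor n m A" and irr: "weakly_irreducible n m A"
    and D: "\<And>j. D j \<noteq> 0"
    and phase: "\<And>i js. i # js \<in> tensor_indices n m \<Longrightarrow> A (i # js) \<noteq> 0 \<Longrightarrow>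
      (\<Prod>j\<leftarrow>i # js. D j) = cis (2 * pi / real l) * D i ^ m"
  shows "colorable n m l A"
proof -
  define \<zeta> where "\<zeta> = cis (2 * pi / real l)"
  have "\<zeta> \<noteq> 0" by (simp add: \<zeta>_def)
  have m0: "m > 0" using m by simp
  have arc: "D i ^ m = D j ^ m" if arc: "(i, j) \<in> tensor_arcs n m A" for i j
  proof -
    obtain ks where ks: "i # ks \<in> tensor_indices n m" "A (i # ks) \<noteq> 0" "j \<in> set ks"
      using arc by (auto simp: tensor_arcs_def)
    \<comment> \<open>With j in front, this is a rearrangement of the same entry, so
      \<open>phase\<close> applies to it with j in the role of i.\<close>
    let ?js = "i # remove1 j ks"
    have mset: "mset (i # ks) = mset (j # ?js)"
      using ks(3) by simp
    then have "set (i # ks) = set (j # ?js)" "length (i # ks) = length (j # ?js)"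
      by (metis set_mset_mset, metis size_mset)
    then have mem: "j # ?js \<in> tensor_indices n m"
      using ks(1) unfolding tensor_indices_def by simp
    then have "A (j # ?js) \<noteq> 0"
      using sym ks(1,2) mset unfolding symmetric_tensor_def by metis
    then have "\<zeta> * D j ^ m = (\<Prod>j\<leftarrow>j # ?js. D j)"
      using phase[OF mem] by (simp add: \<zeta>_def)
    also have "\<dots> = (\<Prod>j\<leftarrow>i # ks. D j)"
      by (rule prod_list_map_cong_mset) (rule mset[symmetric])
    also have "\<dots> = \<zeta> * D i ^ m"
      using phase[OF ks(1,2)] by (simp add: \<zeta>_def)
    finally show ?thesis
      using \<open>\<zeta> \<noteq> 0\<close> by simp
  qed
  have const: "D j ^ m = D 1 ^ m" if "j \<in> {1..n}" for j
  proof -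
    have "(1, j) \<in> (tensor_arcs n m A)\<^sup>+"
      using irr n that by (simp add: weakly_irreducible_def)
    then show ?thesis
      by (induction rule: trancl_induct) (simp_all add: arc)
  qed
  \<comment> \<open>Only phase ratios matter: normalizing at index 1 makes every E j an m-th root of
    unity and removes the factor \<open>D 1 ^ m\<close> from the products.\<close>
  define E where "E = (\<lambda>j. D j / D 1)"
  have E: "E j ^ m = 1" if "j \<in> {1..n}" for j
    using const[OF that] D by (simp add: E_def power_divide)
  have prod_E: "(\<Prod>j\<leftarrow>js. E j) = \<zeta>" if js: "js \<in> tensor_indices n m" "A js \<noteq> 0" for js
  proof -
    obtain i ks where ik: "js = i # ks"
      using js(1) m0 by (cases js) (auto simp: tensor_indices_def)
    have i: "i \<in> {1..n}"
      using js(1) by (simp add: ik Cons_in_tensor_indices)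
    have len: "length js = m"
      using js(1) by (simp add: tensor_indices_def)
    have "(\<Prod>j\<leftarrow>js. E j) * D 1 ^ length js = (\<Prod>j\<leftarrow>js. D j)"
      using D by (induction js) (simp_all add: E_def field_simps)
    moreover have "(\<Prod>j\<leftarrow>js. D j) = \<zeta> * D 1 ^ m"
      unfolding ik \<zeta>_def const[OF i, symmetric] by (rule phase) (use js ik in simp_all)
    ultimately have "(\<Prod>j\<leftarrow>js. E j) * D 1 ^ m = \<zeta> * D 1 ^ m"
      by (simp only: len)
    then have "(\<Prod>j\<leftarrow>js. E j) = \<zeta> \<or> D 1 ^ m = 0"
      by (simp only: mult_cancel_right disj_commute)
    then show ?thesis
      using D by simp
  qed
  have "\<exists>k<m. E j = cis (2 * pi * real k / real m)" if "j \<in> {1..n}" for j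
  proof -
    have "E j \<in> (\<lambda>k. cis (2 * pi * real k / real m)) ` {..<m}"
      using bij_betw_roots_unity[OF m0] E[OF that] by (simp add: bij_betw_def)
    then show ?thesis by auto
  qed
  then obtain k where k: "\<And>j. j \<in> {1..n} \<Longrightarrow> k j < m \<and> E j = cis (2 * pi * real (k j) / real m)"
    by metis
  \<comment> \<open>Exponents lie in {0..m-1} but colors in {1..m}, so 0 is replaced by m.\<close>
  define \<phi> where "\<phi> = (\<lambda>j. if k j = 0 then m else k j)"
  have \<phi>_range: "\<phi> ` {1..n} \<subseteq> {1..m}"
    using k m0 by (force simp: \<phi>_def)
  have E_\<phi>: "E j = cis (2 * pi / real m * real (\<phi> j))" if "j \<in> {1..n}" for j
  proof -
    have "cis (2 * pi * real (\<phi> j) / real m) = cis (2 * pi * real (k j) / real m)"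
      unfolding cis_fraction_eq_iff[OF m0] by (simp add: \<phi>_def cong_def)
    then show ?thesis
      using k[OF that] by simp
  qed
  obtain js where js: "js \<in> tensor_indices n m" "A js \<noteq> 0"
    using weakly_irreducible_nonzero_entry[OF n irr] .
  have "(\<Prod>j\<leftarrow>js. E j) ^ m = 1"
  proof -
    have "\<forall>j\<in>set js. E j ^ m = 1"
      using E tensor_indices_set[OF js(1)] by blast
    then show ?thesis
      by (induction js) (simp_all add: power_mult_distrib)
  qed
  \<comment> \<open>A single nonzero entry suffices to make \<zeta> a product of m-th roots of
    unity. Since \<zeta> is the primitive l-th root \<open>cis (2 * pi / l)\<close>, this forces l
    to divide m.\<close>
  then have "\<zeta> ^ m = 1"
    using prod_E[OF js] by simp
  then have "cis (2 * pi * real m / real l) = cis (2 * pi * real 0 / real l)"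
    by (simp add: \<zeta>_def DeMoivre mult_ac)
  then have "[m = 0] (mod l)"
    using l by (subst (asm) cis_fraction_eq_iff) auto
  then have dvd: "l dvd m"
    by (simp add: cong_0_iff)
  have "[(\<Sum>i\<leftarrow>js. \<phi> i) = m div l] (mod m)" if js: "js \<in> tensor_indices n m" "A js \<noteq> 0" for js
  proof -
    have "map E js = map (\<lambda>j. cis (2 * pi / real m * real (\<phi> j))) js"
      using E_\<phi> tensor_indices_set[OF js(1)] by simp
    then have "\<zeta> = (\<Prod>j\<leftarrow>js. cis (2 * pi / real m * real (\<phi> j)))"
      using prod_E[OF js] by metis
    also have "\<dots> = cis (2 * pi * real (\<Sum>j\<leftarrow>js. \<phi> j) / real m)"
      unfolding prod_list_cis by simp
    finally have "cis (2 * pi * real (\<Sum>j\<leftarrow>js. \<phi> j) / real m) = cis (2 * pi * real (m div l) / real m)"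
      by (simp only: cis_div[OF dvd m0] \<zeta>_def)
    then show ?thesis
      by (simp only: cis_fraction_eq_iff[OF m0])
  qed
  then show ?thesis
    unfolding colorable_def using dvd \<phi>_range by blast
qed

text \<open>Positivity of all coordinates is needed for two vectors: for the maximizer, because the
  eigenvalue equation comes from derivatives at positive coordinates, and for the moduli of the
  rotated eigenvector, because then every nonzero entry has positive weight in the equality case of
  the triangle inequality.\<close>

lemma spectral_symmetric_imp_colorable:
  fixes A :: "nat list \<Rightarrow> real"
  assumes m: "m \<ge> 2" and n: "n \<ge> 1" and l: "l \<ge> 2"
    and sym: "symmetric_tensor n m A" and irr: "weakly_irreducible n m A"
    and nonneg: "nonnegative_tensor n m A"
    and spec: "spectral_symmetric n m l (\<lambda>js. complex_of_real (A js))"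
  shows "colorable n m l A"
proof -
  let ?A = "\<lambda>js. complex_of_real (A js)"
  define \<zeta> where "\<zeta> = cis (2 * pi / real l)"
  have \<zeta>: "norm \<zeta> = 1" "\<zeta> \<noteq> 0" by (simp_all add: \<zeta>_def)
  have m1: "m \<ge> 1" using m by simp
  obtain x where x: "\<And>j. x j \<ge> 0" "(\<Sum>j\<in>{1..n}. x j ^ m) = 1"
    and max: "\<And>y. (\<And>j. y j \<ge> 0) \<Longrightarrow> (\<Sum>j\<in>{1..n}. y j ^ m) = 1 \<Longrightarrow> tensor_value n m A y \<le> tensor_value n m A x"
    using tensor_value_maximizer[OF m1 n nonneg] by metis
  define \<rho> where "\<rho> = tensor_value n m A x"
  have le: "tensor_value n m A y \<le> \<rho> * (\<Sum>j\<in>{1..n}. y j ^ m)" if "\<And>j. y j \<ge> 0" for y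
    unfolding \<rho>_def by (rule tensor_value_le[OF m1 max that])
  have "\<rho> > 0"
  proof -
    obtain js where js: "js \<in> tensor_indices n m" "A js \<noteq> 0"
      using weakly_irreducible_nonzero_entry[OF n irr] .
    then have "0 < A js"
      using nonneg by (simp add: nonnegative_tensor_def less_le)
    also have "\<dots> \<le> (\<Sum>js\<in>tensor_indices n m. A js)"
      using nonneg by (intro member_le_sum js) (auto simp: nonnegative_tensor_def)
    also have "\<dots> = tensor_value n m A (\<lambda>_. 1)"
      by (simp add: tensor_value_def map_replicate_const prod_list_replicate)
    also have "\<dots> \<le> \<rho> * real n"
      using le[of "\<lambda>_. 1"] by simp
    finally show ?thesis
      using n by (simp add: zero_less_mult_iff)
  qed
  have eq: "tensor_value n m A x = \<rho> * (\<Sum>j\<in>{1..n}. x j ^ m)"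
    unfolding \<rho>_def x(2) by simp
  obtain p where p: "p \<in> {1..n}" "x p > 0"
  proof -
    have "\<not> (\<forall>j\<in>{1..n}. x j = 0)"
    proof
      assume "\<forall>j\<in>{1..n}. x j = 0"
      then have "(\<Sum>j\<in>{1..n}. x j ^ m) = (\<Sum>j\<in>{1..n}. 0)"
        using m1 by (intro sum.cong) auto
      then show False using x(2) by simp
    qed
    then show thesis
      using x(1) that by (metis less_le)
  qed
  have pos: "x i > 0" if "i \<in> {1..n}" for i
    using tensor_value_maximizer_pos[OF m nonneg irr le _ x(1) eq p that] \<open>\<rho> > 0\<close> by simp
  have "tensor_apply n m ?A (\<lambda>j. complex_of_real (x j)) i = complex_of_real \<rho> * complex_of_real (x i) ^ (m - 1)"
    if i: "i \<in> {1..n}" for i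
  proof -
    have prod: "(\<Prod>j\<leftarrow>js. complex_of_real (x j)) = complex_of_real (\<Prod>j\<leftarrow>js. x j)" for js
      by (induction js) simp_all
    have "tensor_apply n m ?A (\<lambda>j. complex_of_real (x j)) i = complex_of_real (tensor_apply n m A x i)"
      by (simp add: tensor_apply_def prod)
    then show ?thesis
      using maximizer_eigenvector[OF m1 sym le x(1) eq i pos[OF i]] by simp
  qed
  then have "poly (tensor_charpoly n m ?A) (complex_of_real \<rho>) = 0"
    unfolding poly_tensor_charpoly_eq_0_iff[OF m n] using p
    by (intro exI[of _ "\<lambda>j. complex_of_real (x j)"] conjI bexI[of _ p] ballI) simp_all
  then have "complex_of_real \<rho> \<in># Spec n m ?A"
    using tensor_charpoly_neq_0[OF m n, of ?A] by (simp add: Spec_def)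
  then have "\<zeta> * complex_of_real \<rho> \<in># image_mset (\<lambda>z. \<zeta> * z) (Spec n m ?A)"
    unfolding set_image_mset by (rule imageI)
  then have "\<zeta> * complex_of_real \<rho> \<in># Spec n m ?A"
    using spec unfolding spectral_symmetric_def \<zeta>_def by simp
  then have "poly (tensor_charpoly n m ?A) (\<zeta> * complex_of_real \<rho>) = 0"
    using tensor_charpoly_neq_0[OF m n, of ?A] by (simp add: Spec_def)
  then obtain z p' where z: "p' \<in> {1..n}" "z p' \<noteq> 0"
    "\<forall>i\<in>{1..n}. tensor_apply n m ?A z i = \<zeta> * complex_of_real \<rho> * z i ^ (m - 1)"
    unfolding poly_tensor_charpoly_eq_0_iff[OF m n] by blast
  define y where "y = (\<lambda>j. norm (z j))"
  have y_nonneg: "y j \<ge> 0" for j by (simp add: y_def)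
  have y_eq: "tensor_value n m A y = \<rho> * (\<Sum>j\<in>{1..n}. y j ^ m)"
    unfolding y_def
    by (rule norm_eigenvector_attains_maximum[OF m1 nonneg le])
      (use z(3) \<zeta>(1) \<open>\<rho> > 0\<close> in \<open>simp_all add: norm_mult norm_power\<close>)
  have y_pos: "y i > 0" if "i \<in> {1..n}" for i
    using tensor_value_maximizer_pos[OF m nonneg irr le _ y_nonneg y_eq z(1) _ that] \<open>\<rho> > 0\<close> z(2)
    by (simp add: y_def)
  have y_eigen: "tensor_apply n m A y i = \<rho> * y i ^ (m - 1)" if "i \<in> {1..n}" for i
    by (rule maximizer_eigenvector[OF m1 sym le y_nonneg y_eq that y_pos[OF that]])
  define D where "D = (\<lambda>j. if j \<in> {1..n} then z j / complex_of_real (y j) else 1)"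
  have D: "z j = complex_of_real (y j) * D j" "norm (D j) = 1" if "j \<in> {1..n}" for j
    using y_pos[OF that] that by (simp_all add: D_def norm_divide) (simp_all add: y_def)
  have D_norm: "norm (D j) = 1" for j
    using D(2)[of j] by (cases "j \<in> {1..n}") (auto simp: D_def)
  then have D_nz: "D j \<noteq> 0" for j
    by (metis norm_zero zero_neq_one)
  show ?thesis
  proof (rule colorable_of_phases[OF m n l sym irr, of D])
    show "D j \<noteq> 0" for j by (rule D_nz)
    fix i js assume js: "i # js \<in> tensor_indices n m" and A_js: "A (i # js) \<noteq> 0"
    then have i: "i \<in> {1..n}" and js': "js \<in> tensor_indices n (m - 1)"
      by (simp_all add: Cons_in_tensor_indices)
    \<comment> \<open>Row i of the eigenvalue equation for z, divided by
      \<open>\<zeta> * D i ^ (m - 1)\<close>, is a sum of unit numbers u with weights w. By the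
      equation for the moduli y its value is the sum of the weights, so u = 1 wherever the weight is
      positive.\<close>
    let ?u = "\<lambda>js. (\<Prod>j\<leftarrow>js. D j) / (\<zeta> * D i ^ (m - 1))"
    let ?w = "\<lambda>js. A (i # js) * (\<Prod>j\<leftarrow>js. y j)"
    have z_prod: "(\<Prod>j\<leftarrow>ks. z j) = complex_of_real (\<Prod>j\<leftarrow>ks. y j) * (\<Prod>j\<leftarrow>ks. D j)"
      if "ks \<in> tensor_indices n (m - 1)" for ks
    proof -
      have "\<forall>j\<in>set ks. z j = complex_of_real (y j) * D j"
        using D(1) tensor_indices_set[OF that] by blast
      then show ?thesis by (induction ks) simp_all
    qed
    have "?u js = 1"
    proof (rule weighted_unit_sum[of "tensor_indices n (m - 1)" ?w ?u])
      show "finite (tensor_indices n (m - 1))" by simp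
      show "?w ks \<ge> 0" if "ks \<in> tensor_indices n (m - 1)" for ks
        using nonneg that i m1 prod_list_nonneg_real[of ks y] y_nonneg
        by (simp add: nonnegative_tensor_def Cons_in_tensor_indices)
      show "norm (?u ks) = 1" for ks
      proof -
        have "norm (\<Prod>j\<leftarrow>ks. D j) = 1"
          by (induction ks) (simp_all add: norm_mult D_norm)
        then show ?thesis
          by (simp add: norm_divide norm_mult norm_power \<zeta>(1) D_norm)
      qed
      have "(\<Sum>ks\<in>tensor_indices n (m - 1). complex_of_real (?w ks) * ?u ks) =
          (\<Sum>ks\<in>tensor_indices n (m - 1). ?A (i # ks) * (\<Prod>j\<leftarrow>ks. z j)) / (\<zeta> * D i ^ (m - 1))"
        unfolding sum_divide_distrib by (rule sum.cong) (simp_all add: z_prod)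
      also have "\<dots> = \<zeta> * complex_of_real \<rho> * z i ^ (m - 1) / (\<zeta> * D i ^ (m - 1))"
        using z(3) i by (simp add: tensor_apply_def)
      also have "\<dots> = complex_of_real (\<rho> * y i ^ (m - 1))"
        using \<zeta>(2) D_nz[of i] by (simp add: D(1)[OF i] power_mult_distrib)
      also have "\<rho> * y i ^ (m - 1) = (\<Sum>ks\<in>tensor_indices n (m - 1). ?w ks)"
        using y_eigen[OF i] by (simp add: tensor_apply_def)
      finally show "(\<Sum>ks\<in>tensor_indices n (m - 1). complex_of_real (?w ks) * ?u ks) =
          complex_of_real (\<Sum>ks\<in>tensor_indices n (m - 1). ?w ks)" .
      show "js \<in> tensor_indices n (m - 1)" by (rule js')
      have "\<forall>j\<in>set js. y j > 0"
        using y_pos tensor_indices_set[OF js'] by blast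
      then have "(\<Prod>j\<leftarrow>js. y j) > 0"
        by (induction js) simp_all
      moreover have "A (i # js) > 0"
        using nonneg js A_js by (simp add: nonnegative_tensor_def less_le)
      ultimately show "?w js > 0" by simp
    qed
    then have "(\<Prod>j\<leftarrow>js. D j) = \<zeta> * D i ^ (m - 1)"
      using \<zeta>(2) D_nz[of i] by simp
    moreover have "D i ^ m = D i * D i ^ (m - 1)"
      using m1 by (simp add: power_eq_if)
    ultimately show "(\<Prod>j\<leftarrow>i # js. D j) = cis (2 * pi / real l) * D i ^ m"
      by (simp add: \<zeta>_def)
  qed
qed

theorem theorem3p12:
  fixes A :: "nat list \<Rightarrow> real" and m n l :: nat
  assumes "m \<ge> 2" and "n \<ge> 1" and "l \<ge> 2"
    and "symmetric_tensor n m A"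
    and "weakly_irreducible n m A"
    and "nonnegative_tensor n m A"
  shows "spectral_symmetric n m l (\<lambda>is. complex_of_real (A is)) \<longleftrightarrow> colorable n m l A"
proof
  assume "spectral_symmetric n m l (\<lambda>is. complex_of_real (A is))"
  with assms show "colorable n m l A"
    by (rule spectral_symmetric_imp_colorable)
next
  assume "colorable n m l A"
  then have "colorable n m l (\<lambda>is. complex_of_real (A is))"
    by (simp add: colorable_def)
  with assms(1,2) show "spectral_symmetric n m l (\<lambda>is. complex_of_real (A is))"
    by (rule colorable_imp_spectral_symmetric)
qed

end
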